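(* Let $A$ be a Poisson Hopf algebra, and give its Poisson enveloping algebra $\mathcal{U}(A)$ the bialgebra structure (due to Oh) for which $a\mapsto m_a$ embeds $A$ as a sub-bialgebra. (iii) If $A$ is pointed, then $\mathcal{U}(A)$ is a Hopf algebra with sub-Hopf algebra $A$, and the group-likes satisfy $G(\mathcal{U}(A))=G(A)$. (iv) If $A$ is a connected Hopf algebra, then so is $\mathcal{U}(A)$.
   Context: A Poisson Hopf algebra is a commutative Hopf algebra with a Lie bracket satisfying $\{ab,c\}=a\{b,c\}+\{a,c\}b$ such that $\Delta$ is a Poisson morphism (with $\{a\otimes b,c\otimes d\}=\{a,c\}\otimes bd+ac\otimes\{b,d\}$ on $A\otimes A$). $\mathcal{U}(A)$ is the unital algebra generated by copies $m_a,h_a$ ($a\in A$, linear in $a$) with relations $m_{xy}=m_xm_y$, $h_{\{x,y\}}=h_xh_y-h_yh_x$, $h_{xy}=m_yh_x+m_xh_y$, $m_{\{x,y\}}=h_xm_y-m_yh_x$, $m_1=1$. Its bialgebra structure is given by $\Delta(m_a)=\sum m_{a_1}\otimes m_{a_2}$, $\Delta(h_a)=\sum(h_{a_1}\otimes m_{a_2}+m_{a_1}\otimes h_{a_2})$, $\epsilon(m_a)=\epsilon(a)$, $\epsilon(h_a)=0$, where $\Delta(a)=\sum a_1\otimes a_2$; with this structure the coradical of $\mathcal{U}(A)$ equals the coradical of $A$. A coalgebra is pointed if all its simple subcoalgebras are one-dimensional, and a Hopf algebra is connected if its coradical is $\Bbbk$. *)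

theory Defs
  imports Main
begin

record ('k, 'v) kvs =
  vcar :: "'v set"
  vzero :: 'v
  vadd :: "'v \<Rightarrow> 'v \<Rightarrow> 'v"
  vscale :: "'k \<Rightarrow> 'v \<Rightarrow> 'v"

record ('k, 'v) kbialg = "('k, 'v) kvs" +
  vone :: 'v
  vmul :: "'v \<Rightarrow> 'v \<Rightarrow> 'v"
  cop :: "'v \<Rightarrow> ('v \<times> 'v) list"   \<comment> \<open>comultiplication, an element of V \<otimes> V given as a finite sum of pure tensors\<close>
  cou :: "'v \<Rightarrow> 'k"

definition is_kvs :: "('k::field, 'v, 'z) kvs_scheme \<Rightarrow> bool" where
  "is_kvs V \<longleftrightarrow> vzero V \<in> vcar V \<and>
    (\<forall>x\<in>vcar V. \<forall>y\<in>vcar V. vadd V x y \<in> vcar V) \<and>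
    (\<forall>c. \<forall>x\<in>vcar V. vscale V c x \<in> vcar V) \<and>
    (\<forall>x\<in>vcar V. \<forall>y\<in>vcar V. \<forall>z\<in>vcar V. vadd V (vadd V x y) z = vadd V x (vadd V y z)) \<and>
    (\<forall>x\<in>vcar V. \<forall>y\<in>vcar V. vadd V x y = vadd V y x) \<and>
    (\<forall>x\<in>vcar V. vadd V (vzero V) x = x) \<and>
    (\<forall>x\<in>vcar V. vadd V x (vscale V (-1) x) = vzero V) \<and>
    (\<forall>c. \<forall>x\<in>vcar V. \<forall>y\<in>vcar V. vscale V c (vadd V x y) = vadd V (vscale V c x) (vscale V c y)) \<and>
    (\<forall>c d. \<forall>x\<in>vcar V. vscale V (c + d) x = vadd V (vscale V c x) (vscale V d x)) \<and>
    (\<forall>c d. \<forall>x\<in>vcar V. vscale V (c * d) x = vscale V c (vscale V d x)) \<and>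
    (\<forall>x\<in>vcar V. vscale V 1 x = x)"

definition lin_fun :: "('k::field, 'v, 'z) kvs_scheme \<Rightarrow> ('v \<Rightarrow> 'k) \<Rightarrow> bool" where
  "lin_fun V f \<longleftrightarrow>
    (\<forall>x\<in>vcar V. \<forall>y\<in>vcar V. f (vadd V x y) = f x + f y) \<and>
    (\<forall>c. \<forall>x\<in>vcar V. f (vscale V c x) = c * f x)"

definition vsum :: "('k, 'v, 'z) kvs_scheme \<Rightarrow> 'v list \<Rightarrow> 'v" where
  "vsum V xs = foldr (vadd V) xs (vzero V)"

definition lincomb :: "('k, 'v, 'z) kvs_scheme \<Rightarrow> ('k \<times> 'v) list \<Rightarrow> 'v" where
  "lincomb V l = vsum V (map (\<lambda>(c, v). vscale V c v) l)"

definition vspan :: "('k, 'v, 'z) kvs_scheme \<Rightarrow> 'v set \<Rightarrow> 'v set" where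
  "vspan V S = {lincomb V l | l. set (map snd l) \<subseteq> S}"

definition tpair :: "('v \<Rightarrow> 'k::field) \<Rightarrow> ('v \<Rightarrow> 'k) \<Rightarrow> ('v \<times> 'v) list \<Rightarrow> 'k" where
  "tpair f g xs = sum_list (map (\<lambda>(x, y). f x * g y) xs)"

text \<open>Equality in V \<otimes> V of two finite sums of pure tensors.  Over a field, elements of
  V \<otimes> V are separated by the functionals f \<otimes> g with f, g linear, so this is exactly
  equality in the tensor product.\<close>
definition teq :: "('k::field, 'v, 'z) kvs_scheme \<Rightarrow> ('v \<times> 'v) list \<Rightarrow> ('v \<times> 'v) list \<Rightarrow> bool" where
  "teq V xs ys \<longleftrightarrow> set xs \<subseteq> vcar V \<times> vcar V \<and> set ys \<subseteq> vcar V \<times> vcar V \<and>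
    (\<forall>f g. lin_fun V f \<longrightarrow> lin_fun V g \<longrightarrow> tpair f g xs = tpair f g ys)"

definition is_kalg :: "('k::field, 'v, 'z) kbialg_scheme \<Rightarrow> bool" where
  "is_kalg B \<longleftrightarrow> is_kvs B \<and> vone B \<in> vcar B \<and>
    (\<forall>x\<in>vcar B. \<forall>y\<in>vcar B. vmul B x y \<in> vcar B) \<and>
    (\<forall>x\<in>vcar B. \<forall>y\<in>vcar B. \<forall>z\<in>vcar B. vmul B (vmul B x y) z = vmul B x (vmul B y z)) \<and>
    (\<forall>x\<in>vcar B. vmul B (vone B) x = x \<and> vmul B x (vone B) = x) \<and>
    (\<forall>x\<in>vcar B. \<forall>y\<in>vcar B. \<forall>z\<in>vcar B.
        vmul B x (vadd B y z) = vadd B (vmul B x y) (vmul B x z) \<and>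
        vmul B (vadd B x y) z = vadd B (vmul B x z) (vmul B y z)) \<and>
    (\<forall>c. \<forall>x\<in>vcar B. \<forall>y\<in>vcar B.
        vscale B c (vmul B x y) = vmul B (vscale B c x) y \<and>
        vscale B c (vmul B x y) = vmul B x (vscale B c y))"

definition is_bialg :: "('k::field, 'v, 'z) kbialg_scheme \<Rightarrow> bool" where
  "is_bialg B \<longleftrightarrow> is_kalg B \<and>
    (\<forall>x\<in>vcar B. set (cop B x) \<subseteq> vcar B \<times> vcar B) \<and>
    lin_fun B (cou B) \<and>
    (\<forall>x\<in>vcar B. \<forall>y\<in>vcar B. teq B (cop B (vadd B x y)) (cop B x @ cop B y)) \<and>
    (\<forall>c. \<forall>x\<in>vcar B. teq B (cop B (vscale B c x)) (map (\<lambda>(a, b). (vscale B c a, b)) (cop B x))) \<and>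
    \<comment> \<open>coassociativity, tested against all f \<otimes> g \<otimes> h\<close>
    (\<forall>x\<in>vcar B. \<forall>f g h. lin_fun B f \<longrightarrow> lin_fun B g \<longrightarrow> lin_fun B h \<longrightarrow>
        sum_list (map (\<lambda>(x1, x2). tpair f g (cop B x1) * h x2) (cop B x)) =
        sum_list (map (\<lambda>(x1, x2). f x1 * tpair g h (cop B x2)) (cop B x))) \<and>
    \<comment> \<open>counit\<close>
    (\<forall>x\<in>vcar B. vsum B (map (\<lambda>(x1, x2). vscale B (cou B x1) x2) (cop B x)) = x \<and>
                vsum B (map (\<lambda>(x1, x2). vscale B (cou B x2) x1) (cop B x)) = x) \<and>
    \<comment> \<open>comultiplication and counit are algebra maps\<close>
    (\<forall>x\<in>vcar B. \<forall>y\<in>vcar B. teq B (cop B (vmul B x y))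
        [(vmul B a c, vmul B b d). (a, b) \<leftarrow> cop B x, (c, d) \<leftarrow> cop B y]) \<and>
    teq B (cop B (vone B)) [(vone B, vone B)] \<and>
    (\<forall>x\<in>vcar B. \<forall>y\<in>vcar B. cou B (vmul B x y) = cou B x * cou B y) \<and>
    cou B (vone B) = 1"

definition antipode :: "('k::field, 'v, 'z) kbialg_scheme \<Rightarrow> ('v \<Rightarrow> 'v) \<Rightarrow> bool" where
  "antipode B S \<longleftrightarrow>
    (\<forall>x\<in>vcar B. S x \<in> vcar B) \<and>
    (\<forall>x\<in>vcar B. \<forall>y\<in>vcar B. S (vadd B x y) = vadd B (S x) (S y)) \<and>
    (\<forall>c. \<forall>x\<in>vcar B. S (vscale B c x) = vscale B c (S x)) \<and>
    (\<forall>x\<in>vcar B. vsum B (map (\<lambda>(x1, x2). vmul B (S x1) x2) (cop B x)) = vscale B (cou B x) (vone B) \<and>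
                vsum B (map (\<lambda>(x1, x2). vmul B x1 (S x2)) (cop B x)) = vscale B (cou B x) (vone B))"

definition is_hopf :: "('k::field, 'v, 'z) kbialg_scheme \<Rightarrow> bool" where
  "is_hopf B \<longleftrightarrow> is_bialg B \<and> (\<exists>S. antipode B S)"

definition subspace :: "('k::field, 'v, 'z) kvs_scheme \<Rightarrow> 'v set \<Rightarrow> bool" where
  "subspace V D \<longleftrightarrow> D \<subseteq> vcar V \<and> vzero V \<in> D \<and>
    (\<forall>x\<in>D. \<forall>y\<in>D. vadd V x y \<in> D) \<and> (\<forall>c. \<forall>x\<in>D. vscale V c x \<in> D)"

definition subcoalg :: "('k::field, 'v, 'z) kbialg_scheme \<Rightarrow> 'v set \<Rightarrow> bool" where
  "subcoalg B D \<longleftrightarrow> subspace B D \<and>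
    (\<forall>x\<in>D. \<exists>ys. set ys \<subseteq> D \<times> D \<and> teq B (cop B x) ys)"

definition simple_subcoalg :: "('k::field, 'v, 'z) kbialg_scheme \<Rightarrow> 'v set \<Rightarrow> bool" where
  "simple_subcoalg B D \<longleftrightarrow> subcoalg B D \<and> D \<noteq> {vzero B} \<and>
    (\<forall>E. subcoalg B E \<and> E \<subseteq> D \<longrightarrow> E = {vzero B} \<or> E = D)"

definition one_dim :: "('k::field, 'v, 'z) kvs_scheme \<Rightarrow> 'v set \<Rightarrow> bool" where
  "one_dim V D \<longleftrightarrow> (\<exists>v\<in>D. v \<noteq> vzero V \<and> D = range (\<lambda>c. vscale V c v))"

definition pointed :: "('k::field, 'v, 'z) kbialg_scheme \<Rightarrow> bool" where
  "pointed B \<longleftrightarrow> (\<forall>D. simple_subcoalg B D \<longrightarrow> one_dim B D)"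

definition coradical :: "('k::field, 'v, 'z) kbialg_scheme \<Rightarrow> 'v set" where
  "coradical B = vspan B (\<Union>{D. simple_subcoalg B D})"

definition connected :: "('k::field, 'v, 'z) kbialg_scheme \<Rightarrow> bool" where
  "connected B \<longleftrightarrow> coradical B = range (\<lambda>c. vscale B c (vone B))"

definition grouplikes :: "('k::field, 'v, 'z) kbialg_scheme \<Rightarrow> 'v set" where
  "grouplikes B = {g \<in> vcar B. g \<noteq> vzero B \<and> teq B (cop B g) [(g, g)]}"

definition tbr :: "('k, 'a, 'z) kbialg_scheme \<Rightarrow> ('a \<Rightarrow> 'a \<Rightarrow> 'a) \<Rightarrow>
    ('a \<times> 'a) list \<Rightarrow> ('a \<times> 'a) list \<Rightarrow> ('a \<times> 'a) list" where
  "tbr A br xs ys = concat [[(br a c, vmul A b d), (vmul A a c, br b d)]. (a, b) \<leftarrow> xs, (c, d) \<leftarrow> ys]"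

definition poisson_hopf :: "('k::field, 'a, 'z) kbialg_scheme \<Rightarrow> ('a \<Rightarrow> 'a \<Rightarrow> 'a) \<Rightarrow> bool" where
  "poisson_hopf A br \<longleftrightarrow> is_hopf A \<and>
    (\<forall>x\<in>vcar A. \<forall>y\<in>vcar A. vmul A x y = vmul A y x) \<and>
    (\<forall>x\<in>vcar A. \<forall>y\<in>vcar A. br x y \<in> vcar A) \<and>
    \<comment> \<open>Lie bracket: bilinear, alternating, Jacobi\<close>
    (\<forall>x\<in>vcar A. \<forall>y\<in>vcar A. \<forall>z\<in>vcar A.
        br (vadd A x y) z = vadd A (br x z) (br y z) \<and>
        br z (vadd A x y) = vadd A (br z x) (br z y)) \<and>
    (\<forall>c. \<forall>x\<in>vcar A. \<forall>y\<in>vcar A.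
        br (vscale A c x) y = vscale A c (br x y) \<and> br x (vscale A c y) = vscale A c (br x y)) \<and>
    (\<forall>x\<in>vcar A. br x x = vzero A) \<and>
    (\<forall>x\<in>vcar A. \<forall>y\<in>vcar A. \<forall>z\<in>vcar A.
        vadd A (br x (br y z)) (vadd A (br y (br z x)) (br z (br x y))) = vzero A) \<and>
    \<comment> \<open>Leibniz rule {ab,c} = a{b,c} + {a,c}b\<close>
    (\<forall>a\<in>vcar A. \<forall>b\<in>vcar A. \<forall>c\<in>vcar A.
        br (vmul A a b) c = vadd A (vmul A a (br b c)) (vmul A (br a c) b)) \<and>
    \<comment> \<open>\<Delta> is a Poisson morphism\<close>
    (\<forall>a\<in>vcar A. \<forall>b\<in>vcar A. teq A (cop A (br a b)) (tbr A br (cop A a) (cop A b)))"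

text \<open>Expressions in the free unital associative k-algebra on generators m_a, h_a.\<close>
datatype ('k, 'a) uexp =
    UM 'a | UH 'a | UZero | UOne
  | UAdd "('k, 'a) uexp" "('k, 'a) uexp"
  | UMul "('k, 'a) uexp" "('k, 'a) uexp"
  | UScal 'k "('k, 'a) uexp"

definition usub :: "('k::field, 'a) uexp \<Rightarrow> ('k, 'a) uexp \<Rightarrow> ('k, 'a) uexp" where
  "usub p q = UAdd p (UScal (-1) q)"

text \<open>The congruence generated by the k-algebra axioms, linearity of a \<mapsto> m_a, a \<mapsto> h_a
  and the defining relations of U(A).  U(A) is the quotient of expressions by it.\<close>
inductive ueq :: "('k::field, 'a, 'z) kbialg_scheme \<Rightarrow> ('a \<Rightarrow> 'a \<Rightarrow> 'a) \<Rightarrow>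
    ('k, 'a) uexp \<Rightarrow> ('k, 'a) uexp \<Rightarrow> bool" for A br where
  refl: "ueq A br p p"
| sym: "ueq A br p q \<Longrightarrow> ueq A br q p"
| trans: "ueq A br p q \<Longrightarrow> ueq A br q r \<Longrightarrow> ueq A br p r"
| cong_add: "ueq A br p p' \<Longrightarrow> ueq A br q q' \<Longrightarrow> ueq A br (UAdd p q) (UAdd p' q')"
| cong_mul: "ueq A br p p' \<Longrightarrow> ueq A br q q' \<Longrightarrow> ueq A br (UMul p q) (UMul p' q')"
| cong_scal: "ueq A br p p' \<Longrightarrow> ueq A br (UScal c p) (UScal c p')"
| add_assoc: "ueq A br (UAdd (UAdd p q) r) (UAdd p (UAdd q r))"
| add_comm: "ueq A br (UAdd p q) (UAdd q p)"
| add_zero: "ueq A br (UAdd UZero p) p"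
| add_inv: "ueq A br (UAdd p (UScal (-1) p)) UZero"
| scal_add: "ueq A br (UScal c (UAdd p q)) (UAdd (UScal c p) (UScal c q))"
| scal_add2: "ueq A br (UScal (c + d) p) (UAdd (UScal c p) (UScal d p))"
| scal_mult: "ueq A br (UScal (c * d) p) (UScal c (UScal d p))"
| scal_one: "ueq A br (UScal 1 p) p"
| mul_assoc: "ueq A br (UMul (UMul p q) r) (UMul p (UMul q r))"
| mul_one_l: "ueq A br (UMul UOne p) p"
| mul_one_r: "ueq A br (UMul p UOne) p"
| distr_l: "ueq A br (UMul p (UAdd q r)) (UAdd (UMul p q) (UMul p r))"
| distr_r: "ueq A br (UMul (UAdd p q) r) (UAdd (UMul p r) (UMul q r))"
| scal_mul_l: "ueq A br (UScal c (UMul p q)) (UMul (UScal c p) q)"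
| scal_mul_r: "ueq A br (UScal c (UMul p q)) (UMul p (UScal c q))"
| m_add: "ueq A br (UM (vadd A a b)) (UAdd (UM a) (UM b))"
| m_scal: "ueq A br (UM (vscale A c a)) (UScal c (UM a))"
| h_add: "ueq A br (UH (vadd A a b)) (UAdd (UH a) (UH b))"
| h_scal: "ueq A br (UH (vscale A c a)) (UScal c (UH a))"
| rel_mm: "ueq A br (UM (vmul A x y)) (UMul (UM x) (UM y))"
| rel_hbr: "ueq A br (UH (br x y)) (usub (UMul (UH x) (UH y)) (UMul (UH y) (UH x)))"
| rel_hm: "ueq A br (UH (vmul A x y)) (UAdd (UMul (UM y) (UH x)) (UMul (UM x) (UH y)))"
| rel_mbr: "ueq A br (UM (br x y)) (usub (UMul (UH x) (UM y)) (UMul (UM y) (UH x)))"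
| rel_one: "ueq A br (UM (vone A)) UOne"

fun ucop :: "('k::field, 'a, 'z) kbialg_scheme \<Rightarrow> ('k, 'a) uexp \<Rightarrow> (('k, 'a) uexp \<times> ('k, 'a) uexp) list" where
  "ucop A (UM a) = map (\<lambda>(a1, a2). (UM a1, UM a2)) (cop A a)"
| "ucop A (UH a) = concat (map (\<lambda>(a1, a2). [(UH a1, UM a2), (UM a1, UH a2)]) (cop A a))"
| "ucop A UZero = []"
| "ucop A UOne = [(UOne, UOne)]"
| "ucop A (UAdd p q) = ucop A p @ ucop A q"
| "ucop A (UMul p q) = [(UMul a c, UMul b d). (a, b) \<leftarrow> ucop A p, (c, d) \<leftarrow> ucop A q]"
| "ucop A (UScal c p) = map (\<lambda>(a, b). (UScal c a, b)) (ucop A p)"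

fun ucou :: "('k::field, 'a, 'z) kbialg_scheme \<Rightarrow> ('k, 'a) uexp \<Rightarrow> 'k" where
  "ucou A (UM a) = cou A a"
| "ucou A (UH a) = 0"
| "ucou A UZero = 0"
| "ucou A UOne = 1"
| "ucou A (UAdd p q) = ucou A p + ucou A q"
| "ucou A (UMul p q) = ucou A p * ucou A q"
| "ucou A (UScal c p) = c * ucou A p"

definition ucls :: "('k::field, 'a, 'z) kbialg_scheme \<Rightarrow> ('a \<Rightarrow> 'a \<Rightarrow> 'a) \<Rightarrow> ('k, 'a) uexp \<Rightarrow> ('k, 'a) uexp set" where
  "ucls A br p = {q. ueq A br p q}"

definition urep :: "('k, 'a) uexp set \<Rightarrow> ('k, 'a) uexp" where
  "urep X = (SOME p. p \<in> X)"

definition U_of :: "('k::field, 'a, 'z) kbialg_scheme \<Rightarrow> ('a \<Rightarrow> 'a \<Rightarrow> 'a) \<Rightarrow> ('k, ('k, 'a) uexp set) kbialg" where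
  "U_of A br = \<lparr> vcar = range (ucls A br),
     vzero = ucls A br UZero,
     vadd = (\<lambda>X Y. ucls A br (UAdd (urep X) (urep Y))),
     vscale = (\<lambda>c X. ucls A br (UScal c (urep X))),
     vone = ucls A br UOne,
     vmul = (\<lambda>X Y. ucls A br (UMul (urep X) (urep Y))),
     cop = (\<lambda>X. map (\<lambda>(p, q). (ucls A br p, ucls A br q)) (ucop A (urep X))),
     cou = (\<lambda>X. ucou A (urep X)) \<rparr>"

definition mU :: "('k::field, 'a, 'z) kbialg_scheme \<Rightarrow> ('a \<Rightarrow> 'a \<Rightarrow> 'a) \<Rightarrow> 'a \<Rightarrow> ('k, 'a) uexp set" where
  "mU A br a = ucls A br (UM a)"

end

theory Submission
  imports Defs
begin

text \<open>
  The antipode of A extends to an anti-endomorphism of U(A): on generators it must be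
  \<open>m\<^sub>a \<mapsto> m(S a)\<close> and \<open>h\<^sub>a \<mapsto> - \<Sum> m(S a\<^sub>1) h(a\<^sub>2) m(S a\<^sub>3)\<close>, and the defining relations are respected
  because both sides of each relation become equal after convolution with the invertible map
  \<open>x \<otimes> y \<mapsto> m\<^sub>x m\<^sub>y\<close>. U(A) acts on A, with \<open>m\<^sub>a\<close> acting by multiplication and \<open>h\<^sub>a\<close> by the
  bracket, and evaluating at 1 gives a linear retraction of \<open>a \<mapsto> m\<^sub>a\<close>.

  The number of factors \<open>h\<close> defines a coalgebra filtration of U(A) with bottom piece A. A functional
  that vanishes on A has convolution powers that eventually vanish on each element; hence a nonzero
  subcoalgebra D cannot meet A trivially, as the functional could then be chosen to agree with
  the counit on D. So simple subcoalgebras and group-likes of U(A) lie in A.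

  Tensors are handled through their values under bilinear forms: equality tested on products of
  linear functionals implies equality under all bilinear forms.
\<close>

section \<open>Tensors and linear functionals\<close>

text \<open>The value of the antipode on h is forced: the antipode axiom at h_a reads sum S(h(a1))
  m(a2) = - sum m(S a1) h(a2), and convolving on the right with m after S isolates S(h_a). The
  relations are checked by the same mechanism: after convolution with m_x m_y, pairs such as m(S a1)
  m(a2) collapse to counits, and what remains on the two sides can be compared.

  The obstacle is that nothing here is a canonical object. Elements of U(A) are classes with chosen
  representatives, and a coproduct is a list that is meaningful only up to \<open>teq\<close>. An
  identity between Sweedler sums is therefore stated as a scalar identity, after an arbitrary
  linear, bilinear or trilinear form has been applied; coassociativity and the collapse of antipodes
  become manipulations of nested finite sums. Since linear functionals separate vectors, identities
  in U(A) itself are recovered from the scalar ones.\<close>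

definition tsum :: "('v \<Rightarrow> 'w \<Rightarrow> 'k::field) \<Rightarrow> ('v \<times> 'w) list \<Rightarrow> 'k" where
  "tsum \<phi> xs = sum_list (map (\<lambda>(x, y). \<phi> x y) xs)"

lemma tsum_Nil [simp]: "tsum \<phi> [] = 0"
  and tsum_Cons [simp]: "tsum \<phi> ((x, y) # xs) = \<phi> x y + tsum \<phi> xs"
  and tsum_append [simp]: "tsum \<phi> (xs @ ys) = tsum \<phi> xs + tsum \<phi> ys"
  by (simp_all add: tsum_def)

lemma tpair_eq_tsum: "tpair f g xs = tsum (\<lambda>x y. f x * g y) xs"
  by (simp add: tpair_def tsum_def)

lemma tsum_cong:
  assumes "\<And>x y. (x, y) \<in> set xs \<Longrightarrow> \<phi> x y = \<psi> x y"
  shows "tsum \<phi> xs = tsum \<psi> xs"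
  unfolding tsum_def using assms by (intro arg_cong[where f = sum_list] map_cong) auto

lemma tsum_add: "tsum (\<lambda>x y. \<phi> x y + \<psi> x y) xs = tsum \<phi> xs + tsum \<psi> xs"
  by (induction xs) (auto simp: algebra_simps)

lemma tsum_diff: "tsum (\<lambda>x y. \<phi> x y - \<psi> x y) xs = tsum \<phi> xs - tsum \<psi> xs"
  by (induction xs) (auto simp: algebra_simps)

lemma tsum_minus: "tsum (\<lambda>x y. - \<phi> x y) xs = - tsum \<phi> xs"
  by (induction xs) auto

lemma tsum_mult_left: "tsum (\<lambda>x y. c * \<phi> x y) xs = c * tsum \<phi> xs"
  by (induction xs) (auto simp: algebra_simps)

lemma tsum_mult_right: "tsum (\<lambda>x y. \<phi> x y * c) xs = tsum \<phi> xs * c"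
  by (induction xs) (auto simp: algebra_simps)

lemma tsum_zero [simp]: "tsum (\<lambda>x y. 0) xs = 0"
  by (induction xs) auto

lemma tsum_swap:
  "tsum (\<lambda>a b. tsum (\<lambda>c d. \<phi> a b c d) ys) xs = tsum (\<lambda>c d. tsum (\<lambda>a b. \<phi> a b c d) xs) ys"
  by (induction xs) (auto simp: tsum_add)

lemma tsum_map: "tsum \<phi> (map (\<lambda>(a, b). (g a b, h a b)) xs) = tsum (\<lambda>a b. \<phi> (g a b) (h a b)) xs"
  by (induction xs) auto

lemma tsum_concat_map:
  "tsum \<phi> (concat (map (\<lambda>(a, b). F a b) xs)) = tsum (\<lambda>a b. tsum \<phi> (F a b)) xs"
  by (induction xs) auto

lemma tsum_concat_concat_map:
  "tsum \<phi> (concat (concat (map (\<lambda>(a, b). F a b) xs))) = tsum (\<lambda>a b. tsum \<phi> (concat (F a b))) xs"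
  by (induction xs) auto

lemma sum_list_eq_tsum: "sum_list (map (\<lambda>(x, y). \<phi> x y) xs) = tsum \<phi> xs"
  by (simp add: tsum_def)

section \<open>Vector spaces and the separation of vectors by functionals\<close>

locale kvs_space =
  fixes V :: "('k::field, 'v, 'z) kvs_scheme"
  assumes kvs: "is_kvs V"
begin

lemma zero_closed [simp]: "vzero V \<in> vcar V"
  and add_closed [simp]: "x \<in> vcar V \<Longrightarrow> y \<in> vcar V \<Longrightarrow> vadd V x y \<in> vcar V"
  and scale_closed [simp]: "x \<in> vcar V \<Longrightarrow> vscale V c x \<in> vcar V"
  using kvs by (simp_all add: is_kvs_def)

lemma add_assoc: "x \<in> vcar V \<Longrightarrow> y \<in> vcar V \<Longrightarrow> z \<in> vcar V \<Longrightarrow> vadd V (vadd V x y) z = vadd V x (vadd V y z)"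
  and add_comm: "x \<in> vcar V \<Longrightarrow> y \<in> vcar V \<Longrightarrow> vadd V x y = vadd V y x"
  and add_zero_left [simp]: "x \<in> vcar V \<Longrightarrow> vadd V (vzero V) x = x"
  and add_inverse: "x \<in> vcar V \<Longrightarrow> vadd V x (vscale V (-1) x) = vzero V"
  and scale_add: "x \<in> vcar V \<Longrightarrow> y \<in> vcar V \<Longrightarrow> vscale V c (vadd V x y) = vadd V (vscale V c x) (vscale V c y)"
  and scale_scale: "x \<in> vcar V \<Longrightarrow> vscale V c (vscale V d x) = vscale V (c * d) x"
  and scale_one [simp]: "x \<in> vcar V \<Longrightarrow> vscale V 1 x = x"
  using kvs unfolding is_kvs_def by metis+

lemma scale_plus: "x \<in> vcar V \<Longrightarrow> vscale V (c + d) x = vadd V (vscale V c x) (vscale V d x)"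
  using kvs unfolding is_kvs_def by meson

lemma add_left_comm:
  "x \<in> vcar V \<Longrightarrow> y \<in> vcar V \<Longrightarrow> z \<in> vcar V \<Longrightarrow> vadd V x (vadd V y z) = vadd V y (vadd V x z)"
  by (metis add_assoc add_comm)

lemma add_zero_right [simp]: "x \<in> vcar V \<Longrightarrow> vadd V x (vzero V) = x"
  using add_comm add_zero_left zero_closed by metis

lemma scale_zero [simp]: "x \<in> vcar V \<Longrightarrow> vscale V 0 x = vzero V"
  using scale_plus[of x 1 "-1"] by (simp add: add_inverse)

lemma scale_zero_right [simp]: "vscale V c (vzero V) = vzero V"
  by (metis scale_zero scale_scale zero_closed mult_zero_right)

lemma add_eq_zero_imp:
  assumes "x \<in> vcar V" "y \<in> vcar V" "vadd V x (vscale V (-1) y) = vzero V"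
  shows "x = y"
proof -
  have "x = vadd V (vadd V x (vscale V (-1) y)) y"
    using assms(1,2) by (simp add: add_assoc add_comm[of "vscale V (-1) y"] add_inverse)
  then show ?thesis using assms by simp
qed

lemma lin_funD:
  assumes "lin_fun V f"
  shows "x \<in> vcar V \<Longrightarrow> y \<in> vcar V \<Longrightarrow> f (vadd V x y) = f x + f y"
    and "x \<in> vcar V \<Longrightarrow> f (vscale V c x) = c * f x"
    and "f (vzero V) = 0"
proof -
  show "x \<in> vcar V \<Longrightarrow> f (vscale V c x) = c * f x" for x c
    using assms by (simp add: lin_fun_def)
  from this[of "vzero V" 0] show "f (vzero V) = 0" by simp
qed (use assms in \<open>simp add: lin_fun_def\<close>)

lemma subspaceD:
  assumes "subspace V W"
  shows "W \<subseteq> vcar V" "vzero V \<in> W" "x \<in> W \<Longrightarrow> y \<in> W \<Longrightarrow> vadd V x y \<in> W" "x \<in> W \<Longrightarrow> vscale V c x \<in> W"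
  using assms by (auto simp: subspace_def)

lemma subspace_add_line:
  assumes W: "subspace V W" and v: "v \<in> vcar V"
  shows "subspace V {vadd V w (vscale V c v) | w c. w \<in> W}"
proof -
  have WV: "w \<in> W \<Longrightarrow> w \<in> vcar V" for w using subspaceD(1)[OF W] by blast
  have "\<exists>w'' c''. vadd V (vadd V w (vscale V c v)) (vadd V w' (vscale V c' v)) = vadd V w'' (vscale V c'' v) \<and> w'' \<in> W"
    if "w \<in> W" "w' \<in> W" for w w' c c'
  proof (intro exI conjI)
    show "vadd V (vadd V w (vscale V c v)) (vadd V w' (vscale V c' v)) = vadd V (vadd V w w') (vscale V (c + c') v)"
      using that v by (simp add: WV scale_plus add_assoc add_left_comm[of "vscale V c v" w'])
  qed (use that subspaceD(3)[OF W] in auto)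
  moreover have "\<exists>w'' c''. vscale V d (vadd V w (vscale V c v)) = vadd V w'' (vscale V c'' v) \<and> w'' \<in> W"
    if "w \<in> W" for w c d
    using that v subspaceD(4)[OF W] by (metis WV scale_add scale_closed scale_scale)
  moreover have "\<exists>w c. vzero V = vadd V w (vscale V c v) \<and> w \<in> W"
    using subspaceD(2)[OF W] v by (intro exI[of _ "vzero V"] exI[of _ 0]) simp
  ultimately show ?thesis
    unfolding subspace_def using v by (auto simp: WV)
qed

text \<open>Zorn's lemma gives a subspace N that is maximal among those containing W but not a. It
  is a hyperplane complementary to the line through a, and f is the coordinate along a modulo
  N.\<close>

lemma separating_functional:
  assumes W: "subspace V W" and a: "a \<in> vcar V" "a \<notin> W"
  obtains f where "lin_fun V f" "\<And>w. w \<in> W \<Longrightarrow> f w = 0" "f a = 1"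
proof -
  define \<A> where "\<A> = {W'. subspace V W' \<and> W \<subseteq> W' \<and> a \<notin> W'}"
  have "\<A> \<noteq> {}" using W a by (auto simp: \<A>_def)
  moreover have "\<Union>\<C> \<in> \<A>" if ne: "\<C> \<noteq> {}" and ch: "subset.chain \<A> \<C>" for \<C>
  proof -
    have sub: "\<And>X. X \<in> \<C> \<Longrightarrow> subspace V X \<and> W \<subseteq> X \<and> a \<notin> X"
      using ch by (auto simp: subset.chain_def \<A>_def)
    have lin: "\<And>X Y. X \<in> \<C> \<Longrightarrow> Y \<in> \<C> \<Longrightarrow> X \<subseteq> Y \<or> Y \<subseteq> X"
      using ch by (auto simp: subset.chain_def)
    have "subspace V (\<Union>\<C>)"
      unfolding subspace_def
    proof (intro conjI ballI allI)
      show "\<Union>\<C> \<subseteq> vcar V" using sub subspaceD(1) by blast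
      show "vzero V \<in> \<Union>\<C>" using sub ne subspaceD(2) by blast
      show "vadd V x y \<in> \<Union>\<C>" if xy: "x \<in> \<Union>\<C>" "y \<in> \<Union>\<C>" for x y
      proof -
        obtain X Y where XY: "X \<in> \<C>" "Y \<in> \<C>" "x \<in> X" "y \<in> Y" using xy by blast
        then consider "x \<in> Y" | "y \<in> X" using lin by blast
        then show ?thesis using XY sub subspaceD(3) by cases blast+
      qed
      show "vscale V c x \<in> \<Union>\<C>" if "x \<in> \<Union>\<C>" for c x
        using that sub subspaceD(4) by blast
    qed
    then show ?thesis using ne sub by (auto simp: \<A>_def)
  qed
  ultimately obtain N where N: "N \<in> \<A>" "\<And>X. X \<in> \<A> \<Longrightarrow> N \<subseteq> X \<Longrightarrow> X = N"
    using subset_Zorn_nonempty[of \<A>] by blast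
  have sN: "subspace V N" and WN: "W \<subseteq> N" and aN: "a \<notin> N"
    using N(1) by (auto simp: \<A>_def)
  have NV: "n \<in> N \<Longrightarrow> n \<in> vcar V" for n using subspaceD(1)[OF sN] by blast
  have ex: "\<exists>c. vadd V v (vscale V (- c) a) \<in> N" if v: "v \<in> vcar V" for v
  proof (cases "v \<in> N")
    case True
    then show ?thesis using a v by (intro exI[of _ 0]) simp
  next
    case False
    let ?X = "{vadd V w (vscale V c v) | w c. w \<in> N}"
    have "v \<in> ?X" using subspaceD(2)[OF sN] v
      by (intro CollectI exI[of _ "vzero V"] exI[of _ 1]) simp
    moreover have NX: "N \<subseteq> ?X"
    proof
      fix n assume "n \<in> N"
      then show "n \<in> ?X" using v by (intro CollectI exI[of _ n] exI[of _ 0]) (simp add: NV)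
    qed
    ultimately have "?X \<notin> \<A>" using N(2)[of ?X] False by blast
    \<comment> \<open>By maximality, N enlarged by v contains a, say a = n + d v. Here d is nonzero
      because a is not in N, so v - (1/d) a lies in N.\<close>
    then have "a \<in> ?X" using subspace_add_line[OF sN v] NX WN by (auto simp: \<A>_def)
    then obtain n d where nd: "n \<in> N" "a = vadd V n (vscale V d v)" by blast
    have d: "d \<noteq> 0" using nd aN v by (cases "d = 0") (auto simp: NV)
    have "vadd V v (vscale V (- inverse d) a) = vscale V (- inverse d) n"
      using d v nd(1) unfolding nd(2)
      by (simp add: NV scale_add scale_scale add_left_comm[of v] add_inverse)
    then show ?thesis using nd subspaceD(4)[OF sN] by metis
  qed
  \<comment> \<open>Two different coordinates for v would put a nonzero multiple of a into
    N.\<close>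
  have un: "c = d" if "v \<in> vcar V" and c: "vadd V v (vscale V (- c) a) \<in> N"
    and d: "vadd V v (vscale V (- d) a) \<in> N" for v c d
  proof (rule ccontr)
    assume "c \<noteq> d"
    have "vadd V (vadd V v (vscale V (- c) a)) (vscale V (-1) (vadd V v (vscale V (- d) a)))
      = vadd V (vadd V v (vscale V (-1) v)) (vadd V (vscale V (-c) a) (vscale V d a))"
      using that a by (simp add: scale_add scale_scale add_assoc add_left_comm[of "vscale V (- c) a"])
    also have "\<dots> = vscale V (d - c) a"
      using that a by (simp add: add_inverse scale_plus[symmetric])
    finally have "vscale V (d - c) a \<in> N" using c d subspaceD[OF sN] by metis
    then have "vscale V (inverse (d - c)) (vscale V (d - c) a) \<in> N" using subspaceD[OF sN] by metis
    then show False using aN a \<open>c \<noteq> d\<close> by (simp add: scale_scale)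
  qed
  define f where "f v = (THE c. vadd V v (vscale V (- c) a) \<in> N)" for v
  have fI: "f v = c" if "v \<in> vcar V" "vadd V v (vscale V (- c) a) \<in> N" for v c
    unfolding f_def using that un by blast
  have fN: "vadd V v (vscale V (- f v) a) \<in> N" if "v \<in> vcar V" for v
    using ex[OF that] fI[OF that] by blast
  show ?thesis
  proof
    show "lin_fun V f" unfolding lin_fun_def
    proof (intro conjI ballI allI)
      fix x y assume xy: "x \<in> vcar V" "y \<in> vcar V"
      have "vadd V (vadd V x y) (vscale V (- (f x + f y)) a)
        = vadd V (vadd V x (vscale V (- f x) a)) (vadd V y (vscale V (- f y) a))"
        using xy a scale_plus[of a "- f x" "- f y"] by (simp add: add_assoc add_left_comm[of "vscale V (- f x) a" y])
      then show "f (vadd V x y) = f x + f y"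
        using xy subspaceD(3)[OF sN fN fN] by (intro fI) auto
    next
      fix c x assume x: "x \<in> vcar V"
      have "vadd V (vscale V c x) (vscale V (- (c * f x)) a) = vscale V c (vadd V x (vscale V (- f x) a))"
        using x a by (simp add: scale_add scale_scale)
      then show "f (vscale V c x) = c * f x"
        using x subspaceD(4)[OF sN fN] by (intro fI) auto
    qed
    show "f w = 0" if "w \<in> W" for w
      using that WN NV a by (intro fI) auto
    show "f a = 1"
      using a subspaceD(2)[OF sN] by (intro fI) (auto simp: add_inverse)
  qed
qed

lemma functional_eqI:
  assumes "x \<in> vcar V" "y \<in> vcar V" "\<And>f. lin_fun V f \<Longrightarrow> f x = f y"
  shows "x = y"
proof (rule ccontr)
  assume "x \<noteq> y"
  then have "vadd V x (vscale V (-1) y) \<notin> {vzero V}" using add_eq_zero_imp assms by blast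
  moreover have "subspace V {vzero V}" by (simp add: subspace_def)
  ultimately obtain f where f: "lin_fun V f" "f (vadd V x (vscale V (-1) y)) = 1"
    using separating_functional[of "{vzero V}"] assms by (metis add_closed scale_closed)
  have "f (vadd V x (vscale V (-1) y)) = f x - f y" using f(1) assms(1,2) by (simp add: lin_funD)
  then show False using assms(3)[OF f(1)] f(2) by simp
qed

lemma vsum_closed: "set xs \<subseteq> vcar V \<Longrightarrow> vsum V xs \<in> vcar V"
  by (induction xs) (auto simp: vsum_def)

lemma vsum_subspace: "subspace V W \<Longrightarrow> set xs \<subseteq> W \<Longrightarrow> vsum V xs \<in> W"
  by (induction xs) (auto simp: vsum_def subspace_def)

lemma lin_fun_vsum:
  assumes "lin_fun V f" "set xs \<subseteq> vcar V"
  shows "f (vsum V xs) = sum_list (map f xs)"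
  using assms(2)
proof (induction xs)
  case Nil
  then show ?case using lin_funD(3)[OF assms(1)] by (simp add: vsum_def)
next
  case (Cons x xs)
  then show ?case using lin_funD(1)[OF assms(1), of x "vsum V xs"] vsum_closed[of xs] by (simp add: vsum_def)
qed

lemma lin_fun_vsum_map:
  assumes "lin_fun V f" "\<And>x y. (x, y) \<in> set ys \<Longrightarrow> h x y \<in> vcar V"
  shows "f (vsum V (map (\<lambda>(x, y). h x y) ys)) = tsum (\<lambda>x y. f (h x y)) ys"
proof -
  have "set (map (\<lambda>(x, y). h x y) ys) \<subseteq> vcar V" using assms(2) by auto
  from lin_fun_vsum[OF assms(1) this] show ?thesis
    by (simp add: tsum_def comp_def case_prod_unfold)
qed

lemma scale_mem_vspan:
  assumes "v \<in> T" "v \<in> vcar V"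
  shows "vscale V c v \<in> vspan V T"
proof -
  have "vscale V c v = lincomb V [(c, v)]" using assms by (simp add: lincomb_def vsum_def)
  then show ?thesis unfolding vspan_def using assms(1) by fastforce
qed

section \<open>Rewriting tensors with independent first components\<close>

primrec lspan :: "'v list \<Rightarrow> 'v set" where
  "lspan [] = {vzero V}"
| "lspan (b # bs) = {vadd V w (vscale V c b) | w c. w \<in> lspan bs}"

lemma subspace_lspan: "set bs \<subseteq> vcar V \<Longrightarrow> subspace V (lspan bs)"
proof (induction bs)
  case Nil
  then show ?case by (simp add: subspace_def)
next
  case (Cons b bs)
  then show ?case using subspace_add_line[of "lspan bs" b] by simp
qed

lemma set_subset_lspan: "set bs \<subseteq> vcar V \<Longrightarrow> set bs \<subseteq> lspan bs"
proof (induction bs)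
  case (Cons b bs)
  have sub: "subspace V (lspan bs)" using Cons.prems by (intro subspace_lspan) auto
  have "b \<in> lspan (b # bs)" using Cons.prems subspaceD(2)[OF sub]
    by (auto intro!: exI[of _ "vzero V"] exI[of _ 1])
  moreover have "x \<in> lspan (b # bs)" if "x \<in> lspan bs" for x
    using that Cons.prems subspaceD(1)[OF sub] by (auto intro!: exI[of _ x] exI[of _ 0])
  ultimately show ?case using Cons by auto
qed simp

text \<open>The second slot carries bare operations rather than a vector space: besides V itself,
  the intended instance is lists of pairs under concatenation.\<close>

definition bilin_on :: "('w \<Rightarrow> 'w \<Rightarrow> 'w) \<Rightarrow> ('k \<Rightarrow> 'w \<Rightarrow> 'w) \<Rightarrow> 'w set \<Rightarrow> ('v \<Rightarrow> 'w \<Rightarrow> 'k) \<Rightarrow> bool" where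
  "bilin_on wadd wscale Q \<phi> \<longleftrightarrow> (\<forall>t\<in>Q. lin_fun V (\<lambda>a. \<phi> a t)) \<and>
    (\<forall>a\<in>vcar V. (\<forall>s\<in>Q. \<forall>t\<in>Q. \<phi> a (wadd s t) = \<phi> a s + \<phi> a t) \<and> (\<forall>c. \<forall>t\<in>Q. \<phi> a (wscale c t) = c * \<phi> a t))"

text \<open>If a is the combination of the first components b_i with coefficients c_i, the term a
  tensor t is distributed over the list by adding c_i t to the i-th second component. Since
  \<open>lspan\<close> recurses along the list, each induction step peels off one b_i.\<close>

lemma absorb_term:
  assumes cl: "\<And>s t. s \<in> Q \<Longrightarrow> t \<in> Q \<Longrightarrow> wadd s t \<in> Q" "\<And>c t. t \<in> Q \<Longrightarrow> wscale c t \<in> Q"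
    and t: "t \<in> Q" and "set xs \<subseteq> vcar V \<times> Q" "a \<in> lspan (map fst xs)"
  shows "\<exists>ys. map fst ys = map fst xs \<and> set ys \<subseteq> vcar V \<times> Q \<and>
    (\<forall>\<phi>. bilin_on wadd wscale Q \<phi> \<longrightarrow> tsum \<phi> ys = \<phi> a t + tsum \<phi> xs)"
  using assms(4,5)
proof (induction xs arbitrary: a)
  case Nil
  have "\<phi> (vzero V) t = 0" if "bilin_on wadd wscale Q \<phi>" for \<phi>
    using that t lin_funD(3)[of "\<lambda>a. \<phi> a t"] by (auto simp: bilin_on_def)
  then show ?case using Nil by simp
next
  case (Cons x xs)
  obtain b s where x: "x = (b, s)" by (cases x)
  obtain w c where wc: "w \<in> lspan (map fst xs)" "a = vadd V w (vscale V c b)"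
    using Cons.prems x by auto
  from Cons.IH[OF _ wc(1)] Cons.prems obtain ys where ys: "map fst ys = map fst xs" "set ys \<subseteq> vcar V \<times> Q"
    "\<And>\<phi>. bilin_on wadd wscale Q \<phi> \<Longrightarrow> tsum \<phi> ys = \<phi> w t + tsum \<phi> xs" by auto
  have b: "b \<in> vcar V" "s \<in> Q" and xs: "set (map fst xs) \<subseteq> vcar V" using Cons.prems x by auto
  then have w: "w \<in> vcar V" using subspaceD(1)[OF subspace_lspan[OF xs]] wc by auto
  have "tsum \<phi> ((b, wadd s (wscale c t)) # ys) = \<phi> a t + tsum \<phi> (x # xs)"
    if \<phi>: "bilin_on wadd wscale Q \<phi>" for \<phi>
  proof -
    have "\<phi> a t = \<phi> w t + c * \<phi> b t"
      using \<phi> t w b lin_funD[of "\<lambda>a. \<phi> a t"] by (auto simp: bilin_on_def wc)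
    moreover have "\<phi> b (wadd s (wscale c t)) = \<phi> b s + c * \<phi> b t"
      using \<phi> t b cl by (auto simp: bilin_on_def)
    ultimately show ?thesis using ys(3)[OF \<phi>] by (simp add: x)
  qed
  then show ?case using ys b cl t x by (intro exI[of _ "(b, wadd s (wscale c t)) # ys"]) auto
qed

text \<open>A sum of pure tensors can be rewritten so that the first components are linearly
  independent. Independence is recorded by dual functionals; the second components are
  only required to carry operations, so that they may themselves be formal tensors.\<close>

lemma independent_form:
  assumes cl: "\<And>s t. s \<in> Q \<Longrightarrow> t \<in> Q \<Longrightarrow> wadd s t \<in> Q" "\<And>c t. t \<in> Q \<Longrightarrow> wscale c t \<in> Q"
    and "set xs \<subseteq> vcar V \<times> Q"
  shows "\<exists>zs. fst ` set zs \<subseteq> fst ` set xs \<and> set zs \<subseteq> vcar V \<times> Q \<and>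
    (\<forall>\<phi>. bilin_on wadd wscale Q \<phi> \<longrightarrow> tsum \<phi> zs = tsum \<phi> xs) \<and>
    (\<forall>us a t vs. zs = us @ (a, t) # vs \<longrightarrow>
      (\<exists>f. lin_fun V f \<and> f a = 1 \<and> (\<forall>b\<in>fst ` set (us @ vs). f b = 0)))"
  using assms(3)
proof (induction "length xs" arbitrary: xs rule: less_induct)
  case less
  show ?case
  proof (cases "\<exists>us a t vs. xs = us @ (a, t) # vs \<and> a \<in> lspan (map fst (us @ vs))")
    \<comment> \<open>A dependent first component is absorbed by the others, which shortens the
      list; its length is the induction measure.\<close>
    case True
    then obtain us a t vs where xs: "xs = us @ (a, t) # vs" "a \<in> lspan (map fst (us @ vs))" by blast
    have t: "t \<in> Q" and uv: "set (us @ vs) \<subseteq> vcar V \<times> Q" using less.prems xs by auto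
    from absorb_term[where wadd = wadd and wscale = wscale, OF cl t uv xs(2)]
    obtain ys where ys: "map fst ys = map fst (us @ vs)" "set ys \<subseteq> vcar V \<times> Q"
      "\<forall>\<phi>. bilin_on wadd wscale Q \<phi> \<longrightarrow> tsum \<phi> ys = \<phi> a t + tsum \<phi> (us @ vs)" by blast
    have "length ys = length (us @ vs)" using arg_cong[OF ys(1), of length] by simp
    then have "length ys < length xs" using xs by simp
    from less.hyps[OF this ys(2)] obtain zs where
      zs: "fst ` set zs \<subseteq> fst ` set ys" "set zs \<subseteq> vcar V \<times> Q"
      "\<forall>\<phi>. bilin_on wadd wscale Q \<phi> \<longrightarrow> tsum \<phi> zs = tsum \<phi> ys"
      "\<forall>us a t vs. zs = us @ (a, t) # vs \<longrightarrow>
      (\<exists>f. lin_fun V f \<and> f a = 1 \<and> (\<forall>b\<in>fst ` set (us @ vs). f b = 0))" by blast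
    have "fst ` set ys \<subseteq> fst ` set xs"
      using arg_cong[OF ys(1), of set] xs by auto
    with zs ys xs show ?thesis by (intro exI[of _ zs]) auto
  next
    case False
    have "\<exists>f. lin_fun V f \<and> f a = 1 \<and> (\<forall>b\<in>fst ` set (us @ vs). f b = 0)"
      if xs: "xs = us @ (a, t) # vs" for us a t vs
    proof -
      have V: "set (map fst (us @ vs)) \<subseteq> vcar V" "a \<in> vcar V" using less.prems xs by auto
      have "a \<notin> lspan (map fst (us @ vs))" using False xs by blast
      then obtain f where "lin_fun V f" "\<And>w. w \<in> lspan (map fst (us @ vs)) \<Longrightarrow> f w = 0" "f a = 1"
        using separating_functional[OF subspace_lspan[OF V(1)] V(2)] by blast
      then show ?thesis using set_subset_lspan[OF V(1)] by (intro exI[of _ f]) auto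
    qed
    then show ?thesis using less.prems by (intro exI[of _ xs]) auto
  qed
qed

lemma tsum_dual:
  assumes "zs = us @ (a, t) # vs" "f a = 1" "\<forall>b\<in>fst ` set (us @ vs). f b = 0"
  shows "tsum (\<lambda>x y. f x * g y) zs = g t"
proof -
  have "tsum (\<lambda>x y. f x * g y) ws = tsum (\<lambda>x y. 0) ws" if "set ws \<subseteq> set (us @ vs)" for ws
    using that assms(3) by (intro tsum_cong) force
  from this[of us] this[of vs] show ?thesis using assms(1,2) by simp
qed

text \<open>In an independent form, the functional dual to a first component extracts
  \<open>g t\<close> from the vanishing sum. So every g in G kills every second component t, and by
  \<open>null\<close> the form phi cannot see such a t either.\<close>

lemma tsum_zero_if_functionals_zero:
  assumes cl: "\<And>s t. s \<in> Q \<Longrightarrow> t \<in> Q \<Longrightarrow> wadd s t \<in> Q" "\<And>c t. t \<in> Q \<Longrightarrow> wscale c t \<in> Q"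
    and xs: "set xs \<subseteq> vcar V \<times> Q"
    and G: "\<And>f g. lin_fun V f \<Longrightarrow> g \<in> G \<Longrightarrow> bilin_on wadd wscale Q (\<lambda>x y. f x * g y)"
    and null: "\<And>a t. a \<in> vcar V \<Longrightarrow> t \<in> Q \<Longrightarrow> (\<And>g. g \<in> G \<Longrightarrow> g t = 0) \<Longrightarrow> \<phi> a t = 0"
    and \<phi>: "bilin_on wadd wscale Q \<phi>"
    and zero: "\<And>f g. lin_fun V f \<Longrightarrow> g \<in> G \<Longrightarrow> tsum (\<lambda>x y. f x * g y) xs = 0"
  shows "tsum \<phi> xs = 0"
proof -
  obtain zs where zs: "set zs \<subseteq> vcar V \<times> Q"
    "\<And>\<phi>. bilin_on wadd wscale Q \<phi> \<Longrightarrow> tsum \<phi> zs = tsum \<phi> xs"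
    "\<And>us a t vs. zs = us @ (a, t) # vs \<Longrightarrow>
      (\<exists>f. lin_fun V f \<and> f a = 1 \<and> (\<forall>b\<in>fst ` set (us @ vs). f b = 0))"
    using independent_form[where wadd = wadd and wscale = wscale, OF cl xs] by blast
  have "\<phi> a t = 0" if at: "(a, t) \<in> set zs" for a t
  proof (rule null)
    show "a \<in> vcar V" "t \<in> Q" using at zs(1) by auto
    fix g assume g: "g \<in> G"
    obtain us vs where uv: "zs = us @ (a, t) # vs" using at by (meson split_list)
    then obtain f where f: "lin_fun V f" "f a = 1" "\<forall>b\<in>fst ` set (us @ vs). f b = 0"
      using zs(3) by blast
    have "g t = tsum (\<lambda>x y. f x * g y) zs" using tsum_dual[OF uv f(2,3)] by simp
    also have "\<dots> = 0" using zs(2)[OF G[OF f(1) g]] zero[OF f(1) g] by simp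
    finally show "g t = 0" .
  qed
  then have "tsum \<phi> zs = tsum (\<lambda>x y. 0) zs" by (intro tsum_cong) auto
  then show ?thesis using zs(2)[OF \<phi>] by simp
qed

section \<open>Bilinear and trilinear forms on tensors\<close>

definition bilin :: "('v \<Rightarrow> 'v \<Rightarrow> 'k) \<Rightarrow> bool" where
  "bilin \<phi> \<longleftrightarrow> (\<forall>y\<in>vcar V. lin_fun V (\<lambda>x. \<phi> x y)) \<and> (\<forall>x\<in>vcar V. lin_fun V (\<phi> x))"

lemma bilin_on_carrier_iff: "bilin_on (vadd V) (vscale V) (vcar V) \<phi> \<longleftrightarrow> bilin \<phi>"
  unfolding bilin_on_def bilin_def lin_fun_def by blast

lemma lin_fun_prod: "lin_fun V f \<Longrightarrow> lin_fun V g \<Longrightarrow> bilin (\<lambda>x y. f x * g y)"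
  by (auto simp: bilin_def lin_fun_def algebra_simps)

lemma tsum_zero_if_tpair_zero:
  assumes "set xs \<subseteq> vcar V \<times> vcar V"
    and "\<And>f g. lin_fun V f \<Longrightarrow> lin_fun V g \<Longrightarrow> tpair f g xs = 0" and \<phi>: "bilin \<phi>"
  shows "tsum \<phi> xs = 0"
proof (rule tsum_zero_if_functionals_zero[where Q = "vcar V" and G = "{g. lin_fun V g}" and wadd = "vadd V" and wscale = "vscale V"])
  show "\<phi> a t = 0" if "a \<in> vcar V" "t \<in> vcar V" "\<And>g. g \<in> {g. lin_fun V g} \<Longrightarrow> g t = 0" for a t
  proof -
    have "t = vzero V" using that(2,3) by (intro functional_eqI) (simp_all add: lin_funD(3))
    then show ?thesis using \<phi> that lin_funD(3)[of "\<phi> a"] by (auto simp: bilin_def)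
  qed
qed (use assms in \<open>auto simp: bilin_on_carrier_iff lin_fun_prod tpair_eq_tsum\<close>)

definition tneg :: "('v \<times> 'v) list \<Rightarrow> ('v \<times> 'v) list" where
  "tneg xs = map (\<lambda>(a, b). (vscale V (-1) a, b)) xs"

lemma set_tneg: "set xs \<subseteq> vcar V \<times> Q \<Longrightarrow> set (tneg xs) \<subseteq> vcar V \<times> Q"
  by (auto simp: tneg_def)

lemma tsum_tneg:
  assumes "bilin \<phi>" "set xs \<subseteq> vcar V \<times> vcar V"
  shows "tsum \<phi> (tneg xs) = - tsum \<phi> xs"
  using assms(2)
proof (induction xs)
  case (Cons x xs)
  then show ?case using assms(1) lin_funD(2)[of "\<lambda>x. \<phi> x (snd _)"]
    by (auto simp: tneg_def bilin_def lin_fun_def)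
qed (simp add: tneg_def)

lemma teq_bilin:
  assumes "teq V xs ys" "bilin \<phi>"
  shows "tsum \<phi> xs = tsum \<phi> ys"
proof -
  have car: "set xs \<subseteq> vcar V \<times> vcar V" "set ys \<subseteq> vcar V \<times> vcar V"
    using assms by (auto simp: teq_def)
  have "tsum \<phi> (xs @ tneg ys) = 0"
  proof (rule tsum_zero_if_tpair_zero[OF _ _ assms(2)])
    show "tpair f g (xs @ tneg ys) = 0" if "lin_fun V f" "lin_fun V g" for f g
      using that car assms(1) tsum_tneg[OF lin_fun_prod[OF that]] by (simp add: tpair_eq_tsum teq_def)
  qed (use car set_tneg[OF car(2)] in auto)
  then show ?thesis using tsum_tneg[OF assms(2) car(2)] by simp
qed

text \<open>Triples (a, b, c) are treated as pairs of a and a formal tensor (a list), so that the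
  two-factor case applies twice.\<close>

lemma trilinear_zero:
  assumes xs: "set xs \<subseteq> vcar V \<times> {ts. set ts \<subseteq> vcar V \<times> vcar V}"
    and \<phi>: "\<And>a. a \<in> vcar V \<Longrightarrow> bilin (\<phi> a)"
      "\<And>b c. b \<in> vcar V \<Longrightarrow> c \<in> vcar V \<Longrightarrow> lin_fun V (\<lambda>a. \<phi> a b c)"
    and zero: "\<And>f g h. lin_fun V f \<Longrightarrow> lin_fun V g \<Longrightarrow> lin_fun V h \<Longrightarrow>
      tsum (\<lambda>a ts. f a * tpair g h ts) xs = 0"
  shows "tsum (\<lambda>a ts. tsum (\<phi> a) ts) xs = 0"
proof (rule tsum_zero_if_functionals_zero[where Q = "{ts. set ts \<subseteq> vcar V \<times> vcar V}"
      and G = "{tpair g h | g h. lin_fun V g \<and> lin_fun V h}" and wadd = "(@)"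
      and wscale = "\<lambda>c. map (\<lambda>(x, y). (vscale V c x, y))"])
  have sc: "tsum \<psi> (map (\<lambda>(x, y). (vscale V c x, y)) ts) = c * tsum \<psi> ts"
    if "bilin \<psi>" "set ts \<subseteq> vcar V \<times> vcar V" for \<psi> c ts
    using that(2)
    by (induction ts) (use that(1) in \<open>auto simp: bilin_def lin_fun_def algebra_simps\<close>)
  show "bilin_on (@) (\<lambda>c. map (\<lambda>(x, y). (vscale V c x, y))) {ts. set ts \<subseteq> vcar V \<times> vcar V} (\<lambda>x y. f x * g y)"
    if "lin_fun V f" "g \<in> {tpair g h | g h. lin_fun V g \<and> lin_fun V h}" for f g
    using that by (auto simp: bilin_on_def tpair_eq_tsum sc lin_fun_prod lin_fun_def algebra_simps)
  have lin: "lin_fun V (\<lambda>a. tsum (\<phi> a) ts)" if "set ts \<subseteq> vcar V \<times> vcar V" for ts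
    using that
  proof (induction ts)
    case (Cons t ts)
    obtain b c where t: "t = (b, c)" by (cases t)
    then show ?case using Cons \<phi>(2)[of b c] by (auto simp: lin_fun_def algebra_simps)
  qed (simp add: lin_fun_def)
  show "bilin_on (@) (\<lambda>c. map (\<lambda>(x, y). (vscale V c x, y))) {ts. set ts \<subseteq> vcar V \<times> vcar V} (\<lambda>a. tsum (\<phi> a))"
    using sc \<phi>(1) lin by (auto simp: bilin_on_def)
  \<comment> \<open>By the two-factor case, a formal tensor killed by every \<open>tpair g h\<close>
    is killed by the bilinear form \<open>\<phi> a\<close>.\<close>
  show "tsum (\<phi> a) ts = 0" if "a \<in> vcar V" "ts \<in> {ts. set ts \<subseteq> vcar V \<times> vcar V}"
    "\<And>g. g \<in> {tpair g h | g h. lin_fun V g \<and> lin_fun V h} \<Longrightarrow> g ts = 0" for a ts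
    using that by (intro tsum_zero_if_tpair_zero \<phi>(1)) auto
qed (use xs zero in auto)

text \<open>Slicing: with independent first components, a second component is recovered by applying
  the dual functional to the first leg. Slicing \<open>ys\<close> in the same way exhibits it as a
  combination of elements of \<open>Q'\<close>. The first components stay in P because
  \<open>independent_form\<close> introduces no new ones.\<close>

lemma restrict_second:
  assumes "teq V xs ys" "subspace V P" "subspace V Q" "subspace V Q'"
    and "set xs \<subseteq> P \<times> Q" "set ys \<subseteq> vcar V \<times> Q'"
  shows "\<exists>zs. set zs \<subseteq> P \<times> (Q \<inter> Q') \<and> teq V xs zs"
proof -
  have car: "P \<subseteq> vcar V" "Q \<subseteq> vcar V" "Q' \<subseteq> vcar V" using assms subspaceD by blast+
  have xs: "set xs \<subseteq> vcar V \<times> Q" using assms car by auto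
  have clQ: "\<And>s t. s \<in> Q \<Longrightarrow> t \<in> Q \<Longrightarrow> vadd V s t \<in> Q" "\<And>c t. t \<in> Q \<Longrightarrow> vscale V c t \<in> Q"
    using subspaceD(3,4)[OF assms(3)] by auto
  obtain zs where zs: "fst ` set zs \<subseteq> fst ` set xs" "set zs \<subseteq> vcar V \<times> Q"
    "\<And>\<phi>. bilin_on (vadd V) (vscale V) Q \<phi> \<Longrightarrow> tsum \<phi> zs = tsum \<phi> xs"
    "\<And>us a t vs. zs = us @ (a, t) # vs \<Longrightarrow>
      (\<exists>f. lin_fun V f \<and> f a = 1 \<and> (\<forall>b\<in>fst ` set (us @ vs). f b = 0))"
    using independent_form[where wadd = "vadd V" and wscale = "vscale V", OF clQ xs] by blast
  have bil: "bilin_on (vadd V) (vscale V) Q (\<lambda>x y. f x * g y)" if "lin_fun V f" "lin_fun V g" for f g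
    using that car by (auto simp: bilin_on_def lin_fun_def algebra_simps subset_iff)
  have tq: "tsum (\<lambda>x y. f x * g y) zs = tsum (\<lambda>x y. f x * g y) ys" if "lin_fun V f" "lin_fun V g" for f g
    using zs(3)[OF bil[OF that]] assms(1) that by (simp add: teq_def tpair_eq_tsum)
  have "b \<in> Q'" if ab: "(a, b) \<in> set zs" for a b
  proof -
    obtain us vs where uv: "zs = us @ (a, b) # vs" using ab by (meson split_list)
    then obtain f where f: "lin_fun V f" "f a = 1" "\<forall>b\<in>fst ` set (us @ vs). f b = 0"
      using zs(4) by blast
    let ?L = "map (\<lambda>(x, y). vscale V (f x) y) ys"
    have L: "set ?L \<subseteq> Q'" using assms(6) subspaceD(4)[OF assms(4)] by auto
    have "b = vsum V ?L"
    proof (rule functional_eqI)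
      show "b \<in> vcar V" using ab zs(2) car by auto
      show "vsum V ?L \<in> vcar V" using L car by (intro vsum_closed) auto
      fix g assume g: "lin_fun V g"
      have "g b = tsum (\<lambda>x y. f x * g y) ys" using tsum_dual[OF uv f(2,3)] tq[OF f(1) g] by metis
      also have "\<dots> = tsum (\<lambda>x y. g (vscale V (f x) y)) ys"
        using assms(6) car by (intro tsum_cong) (auto simp: lin_funD[OF g])
      also have "\<dots> = g (vsum V ?L)"
        using L car by (intro lin_fun_vsum_map[OF g, symmetric]) auto
      finally show "g b = g (vsum V ?L)" .
    qed
    then show ?thesis using vsum_subspace[OF assms(4) L] by simp
  qed
  moreover have "a \<in> P" if "(a, b) \<in> set zs" for a b
  proof -
    have "a \<in> fst ` set zs" using that by force
    then obtain x where "x \<in> set xs" "a = fst x" using zs(1) by blast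
    then show ?thesis using assms(5) by auto
  qed
  ultimately have sub: "set zs \<subseteq> P \<times> (Q \<inter> Q')" using zs(2) by auto
  moreover have "teq V xs zs"
    using sub assms(1) car tq by (auto simp: teq_def tpair_eq_tsum)
  ultimately show ?thesis by blast
qed

lemma tsum_flip: "tsum \<phi> (map prod.swap xs) = tsum (\<lambda>x y. \<phi> y x) xs"
  by (induction xs) auto

lemma teq_flip:
  assumes "teq V xs ys"
  shows "teq V (map prod.swap xs) (map prod.swap ys)"
proof -
  have flip: "tpair f g (map prod.swap zs) = tpair g f zs" for f g zs
    by (simp add: tpair_eq_tsum tsum_flip mult.commute)
  show ?thesis using assms by (auto simp: teq_def flip)
qed

text \<open>Over a field, the tensor squares of D and E meet in the tensor square of their
  intersection. Slicing treats the second leg; after swapping the legs it treats the first.\<close>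

lemma teq_inter:
  assumes "teq V xs ys" "subspace V D" "subspace V E" "set xs \<subseteq> D \<times> D" "set ys \<subseteq> E \<times> E"
  shows "\<exists>zs. set zs \<subseteq> (D \<inter> E) \<times> (D \<inter> E) \<and> teq V xs zs"
proof -
  have DE: "subspace V (D \<inter> E)" using assms(2,3) by (auto simp: subspace_def)
  have car: "E \<subseteq> vcar V" using assms subspaceD by blast
  obtain zs where zs: "set zs \<subseteq> D \<times> (D \<inter> E)" "teq V xs zs"
    using restrict_second[OF assms(1,2,2,3,4)] assms(5) car by blast
  have "teq V zs ys" using zs(2) assms(1) by (auto simp: teq_def)
  from restrict_second[OF teq_flip[OF this] DE assms(2,3)] zs assms(5) car
  obtain ws where ws: "set ws \<subseteq> (D \<inter> E) \<times> (D \<inter> E)" "teq V (map prod.swap zs) ws" by fastforce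
  have "teq V zs (map prod.swap ws)" using teq_flip[OF ws(2)] by (simp add: comp_def)
  then have "teq V xs (map prod.swap ws)" using zs(2) by (auto simp: teq_def)
  moreover have "set (map prod.swap ws) \<subseteq> (D \<inter> E) \<times> (D \<inter> E)" using ws by auto
  ultimately show ?thesis by blast
qed

end

section \<open>Sweedler sums in a Poisson Hopf algebra\<close>

text \<open>The antipode is a parameter, chosen once in the final proof; the full carrier removes
  membership conditions in A.\<close>

locale poisson_hopf_algebra =
  fixes A :: "('k::field, 'a) kbialg" and br :: "'a \<Rightarrow> 'a \<Rightarrow> 'a" and S :: "'a \<Rightarrow> 'a"
  assumes poisson: "poisson_hopf A br" and carrier_UNIV: "vcar A = UNIV" and antipode_S: "antipode A S"
begin

lemma bialg_A: "is_bialg A" and kalg_A: "is_kalg A" and kvs_A: "is_kvs A"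
proof -
  show bialg: "is_bialg A" using poisson unfolding poisson_hopf_def is_hopf_def by blast
  then show kalg: "is_kalg A" unfolding is_bialg_def by blast
  then show "is_kvs A" unfolding is_kalg_def by blast
qed

sublocale A: kvs_space A
  by unfold_locales (rule kvs_A)

abbreviation addA (infixl "\<boxplus>" 65) where "x \<boxplus> y \<equiv> vadd A x y"
abbreviation mulA (infixl "\<odot>" 70) where "x \<odot> y \<equiv> vmul A x y"
abbreviation scaleA (infixr "\<cdot>" 75) where "c \<cdot> x \<equiv> vscale A c x"
abbreviation cop_A ("\<Delta>") where "\<Delta> \<equiv> cop A"
abbreviation cou_A ("\<epsilon>") where "\<epsilon> \<equiv> cou A"

lemma lin_fun_A: "lin_fun A f \<longleftrightarrow> (\<forall>x y. f (x \<boxplus> y) = f x + f y) \<and> (\<forall>c x. f (c \<cdot> x) = c * f x)"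
  by (simp add: lin_fun_def carrier_UNIV)

lemma bilin_A: "A.bilin \<phi> \<longleftrightarrow> (\<forall>x y z. \<phi> (x \<boxplus> y) z = \<phi> x z + \<phi> y z) \<and> (\<forall>c x y. \<phi> (c \<cdot> x) y = c * \<phi> x y) \<and>
    (\<forall>x y z. \<phi> z (x \<boxplus> y) = \<phi> z x + \<phi> z y) \<and> (\<forall>c x y. \<phi> x (c \<cdot> y) = c * \<phi> x y)"
  by (auto simp: A.bilin_def lin_fun_A carrier_UNIV)

lemma mulA_assoc: "(x \<odot> y) \<odot> z = x \<odot> (y \<odot> z)"
  and mulA_comm: "x \<odot> y = y \<odot> x"
  and mulA_one [simp]: "vone A \<odot> x = x" "x \<odot> vone A = x"
  and mulA_add: "x \<odot> (y \<boxplus> z) = (x \<odot> y) \<boxplus> (x \<odot> z)" "(x \<boxplus> y) \<odot> z = (x \<odot> z) \<boxplus> (y \<odot> z)"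
  and mulA_scale: "(c \<cdot> x) \<odot> y = c \<cdot> (x \<odot> y)" "x \<odot> (c \<cdot> y) = c \<cdot> (x \<odot> y)"
  using kalg_A poisson unfolding is_kalg_def poisson_hopf_def carrier_UNIV by (metis UNIV_I)+

lemma br_add: "br (x \<boxplus> y) z = br x z \<boxplus> br y z" "br z (x \<boxplus> y) = br z x \<boxplus> br z y"
  and br_scale: "br (c \<cdot> x) y = c \<cdot> br x y" "br x (c \<cdot> y) = c \<cdot> br x y"
  and br_self: "br x x = vzero A"
  and br_jacobi: "br x (br y z) \<boxplus> (br y (br z x) \<boxplus> br z (br x y)) = vzero A"
  and br_mul: "br (x \<odot> y) z = (x \<odot> br y z) \<boxplus> (br x z \<odot> y)"
  and cop_br_teq: "teq A (\<Delta> (br x y)) (tbr A br (\<Delta> x) (\<Delta> y))"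
  using poisson by (auto simp: poisson_hopf_def carrier_UNIV)

lemma S_add: "S (x \<boxplus> y) = S x \<boxplus> S y" and S_scale: "S (c \<cdot> x) = c \<cdot> S x"
  using antipode_S by (auto simp: antipode_def carrier_UNIV)

lemmas A_lin = mulA_add mulA_scale br_add br_scale S_add S_scale

lemma br_anti: "br y x = (-1) \<cdot> br x y"
proof -
  have "vzero A = br (x \<boxplus> y) (x \<boxplus> y)" by (simp add: br_self)
  also have "\<dots> = br x y \<boxplus> br y x" 
    unfolding br_add by (simp add: br_self[of x] br_self[of y] carrier_UNIV A.add_comm[of "br y x" "br x y"])
  finally have "br y x \<boxplus> (-1) \<cdot> ((-1) \<cdot> br x y) = vzero A"
    by (simp add: carrier_UNIV A.scale_scale A.add_comm)
  then show ?thesis by (rule A.add_eq_zero_imp[rotated 2]) (simp_all add: carrier_UNIV)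
qed

lemma tsum_scale_left: "A.bilin \<phi> \<Longrightarrow> tsum \<phi> (map (\<lambda>(a, b). (c \<cdot> a, b)) xs) = c * tsum \<phi> xs"
  by (simp add: tsum_map bilin_A tsum_mult_left)

lemma tsum_cop_add: "A.bilin \<phi> \<Longrightarrow> tsum \<phi> (\<Delta> (x \<boxplus> y)) = tsum \<phi> (\<Delta> x) + tsum \<phi> (\<Delta> y)"
  and tsum_cop_scale: "A.bilin \<phi> \<Longrightarrow> tsum \<phi> (\<Delta> (c \<cdot> x)) = c * tsum \<phi> (\<Delta> x)"
  and tsum_cop_one: "A.bilin \<phi> \<Longrightarrow> tsum \<phi> (\<Delta> (vone A)) = \<phi> (vone A) (vone A)"
proof -
  have "teq A (\<Delta> (x \<boxplus> y)) (\<Delta> x @ \<Delta> y)" "teq A (\<Delta> (c \<cdot> x)) (map (\<lambda>(a, b). (c \<cdot> a, b)) (\<Delta> x))"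
    "teq A (\<Delta> (vone A)) [(vone A, vone A)]"
    using bialg_A by (simp_all add: is_bialg_def carrier_UNIV)
  from this[THEN A.teq_bilin, of \<phi>]
  show "A.bilin \<phi> \<Longrightarrow> tsum \<phi> (\<Delta> (x \<boxplus> y)) = tsum \<phi> (\<Delta> x) + tsum \<phi> (\<Delta> y)"
    "A.bilin \<phi> \<Longrightarrow> tsum \<phi> (\<Delta> (c \<cdot> x)) = c * tsum \<phi> (\<Delta> x)"
    "A.bilin \<phi> \<Longrightarrow> tsum \<phi> (\<Delta> (vone A)) = \<phi> (vone A) (vone A)"
    by (simp_all add: tsum_scale_left)
qed

lemma lin_fun_tsum_cop: "A.bilin \<phi> \<Longrightarrow> lin_fun A (\<lambda>x. tsum \<phi> (\<Delta> x))"
  by (simp add: lin_fun_A tsum_cop_add tsum_cop_scale)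

lemma tsum_cop_mul:
  assumes "A.bilin \<phi>"
  shows "tsum \<phi> (\<Delta> (x \<odot> y)) = tsum (\<lambda>a b. tsum (\<lambda>c d. \<phi> (a \<odot> c) (b \<odot> d)) (\<Delta> y)) (\<Delta> x)"
proof -
  have "teq A (\<Delta> (x \<odot> y)) [(a \<odot> c, b \<odot> d). (a, b) \<leftarrow> \<Delta> x, (c, d) \<leftarrow> \<Delta> y]"
    using bialg_A by (simp add: is_bialg_def carrier_UNIV)
  from A.teq_bilin[OF this assms] show ?thesis by (simp add: tsum_concat_map tsum_map)
qed

lemma tsum_cop_br:
  assumes "A.bilin \<phi>"
  shows "tsum \<phi> (\<Delta> (br x y)) =
    tsum (\<lambda>a b. tsum (\<lambda>c d. \<phi> (br a c) (b \<odot> d) + \<phi> (a \<odot> c) (br b d)) (\<Delta> y)) (\<Delta> x)"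
  using A.teq_bilin[OF cop_br_teq assms, of x y]
  by (simp add: tbr_def tsum_concat_map tsum_concat_concat_map add.assoc)

lemma lin_cou: "lin_fun A \<epsilon>" and cou_mul: "\<epsilon> (x \<odot> y) = \<epsilon> x * \<epsilon> y" and cou_one: "\<epsilon> (vone A) = 1"
  using bialg_A by (simp_all add: is_bialg_def carrier_UNIV)

lemma cou_lin: "\<epsilon> (x \<boxplus> y) = \<epsilon> x + \<epsilon> y" "\<epsilon> (c \<cdot> x) = c * \<epsilon> x"
  using lin_cou by (simp_all add: lin_fun_A)

lemma tsum_counit_left: "lin_fun A f \<Longrightarrow> tsum (\<lambda>a b. \<epsilon> a * f b) (\<Delta> x) = f x"
  and tsum_counit_right: "lin_fun A f \<Longrightarrow> tsum (\<lambda>a b. f a * \<epsilon> b) (\<Delta> x) = f x"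
proof -
  have "vsum A (map (\<lambda>(x1, x2). \<epsilon> x1 \<cdot> x2) (\<Delta> x)) = x" "vsum A (map (\<lambda>(x1, x2). \<epsilon> x2 \<cdot> x1) (\<Delta> x)) = x"
    using bialg_A by (simp_all add: is_bialg_def carrier_UNIV)
  then have "f x = tsum (\<lambda>a b. f (\<epsilon> a \<cdot> b)) (\<Delta> x)" "f x = tsum (\<lambda>a b. f (\<epsilon> b \<cdot> a)) (\<Delta> x)" if "lin_fun A f"
    using A.lin_fun_vsum_map[OF that, of "\<Delta> x" "\<lambda>a b. \<epsilon> a \<cdot> b"]
      A.lin_fun_vsum_map[OF that, of "\<Delta> x" "\<lambda>a b. \<epsilon> b \<cdot> a"] by (simp_all add: carrier_UNIV)
  then show "lin_fun A f \<Longrightarrow> tsum (\<lambda>a b. \<epsilon> a * f b) (\<Delta> x) = f x"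
    "lin_fun A f \<Longrightarrow> tsum (\<lambda>a b. f a * \<epsilon> b) (\<Delta> x) = f x"
    by (simp_all add: lin_fun_A mult.commute)
qed

lemma tsum_antipode_left: "lin_fun A f \<Longrightarrow> tsum (\<lambda>a b. f (S a \<odot> b)) (\<Delta> x) = \<epsilon> x * f (vone A)"
  and tsum_antipode_right: "lin_fun A f \<Longrightarrow> tsum (\<lambda>a b. f (a \<odot> S b)) (\<Delta> x) = \<epsilon> x * f (vone A)"
proof -
  have "vsum A (map (\<lambda>(x1, x2). S x1 \<odot> x2) (\<Delta> x)) = \<epsilon> x \<cdot> vone A" "vsum A (map (\<lambda>(x1, x2). x1 \<odot> S x2) (\<Delta> x)) = \<epsilon> x \<cdot> vone A"
    using antipode_S by (simp_all add: antipode_def carrier_UNIV)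
  then have "f (\<epsilon> x \<cdot> vone A) = tsum (\<lambda>a b. f (S a \<odot> b)) (\<Delta> x)" "f (\<epsilon> x \<cdot> vone A) = tsum (\<lambda>a b. f (a \<odot> S b)) (\<Delta> x)" if "lin_fun A f"
    using A.lin_fun_vsum_map[OF that, of "\<Delta> x" "\<lambda>a b. S a \<odot> b"]
      A.lin_fun_vsum_map[OF that, of "\<Delta> x" "\<lambda>a b. a \<odot> S b"] by (simp_all add: carrier_UNIV)
  then show "lin_fun A f \<Longrightarrow> tsum (\<lambda>a b. f (S a \<odot> b)) (\<Delta> x) = \<epsilon> x * f (vone A)"
    "lin_fun A f \<Longrightarrow> tsum (\<lambda>a b. f (a \<odot> S b)) (\<Delta> x) = \<epsilon> x * f (vone A)"
    by (simp_all add: lin_fun_A mult.commute)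
qed

text \<open>The counit axiom and the Poisson property of Delta give eps{x,y} = eps{x,y} + eps{x,y},
  which forces 0 in every characteristic.\<close>

lemma cou_br: "\<epsilon> (br x y) = 0"
proof -
  have lin: "lin_fun A (\<lambda>a. \<epsilon> (br a y))" for y by (simp add: lin_fun_A A_lin cou_lin)
  have lin': "lin_fun A (\<lambda>a. \<epsilon> (br x a))" for x by (simp add: lin_fun_A A_lin cou_lin)
  have "\<epsilon> (br x y) = tsum (\<lambda>a b. \<epsilon> a * \<epsilon> b) (\<Delta> (br x y))"
    using tsum_counit_left[OF lin_cou] by simp
  also have "\<dots> = tsum (\<lambda>a b. tsum (\<lambda>c d. (\<epsilon> (br a c) * \<epsilon> d) * \<epsilon> b + \<epsilon> a * (\<epsilon> c * \<epsilon> (br b d))) (\<Delta> y)) (\<Delta> x)"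
    by (subst tsum_cop_br) (simp_all add: bilin_A cou_lin cou_mul algebra_simps)
  also have "\<dots> = \<epsilon> (br x y) + \<epsilon> (br x y)"
    by (simp add: tsum_add tsum_mult_left tsum_mult_right tsum_counit_left tsum_counit_right lin lin')
  finally show ?thesis by (metis add_0_right add_left_cancel)
qed

text \<open>The definition tests coassociativity on products of three functionals only. The
  trilinear criterion extends it to all trilinear forms, which is the shape used in every later
  Sweedler computation.\<close>

lemma tsum_coassoc:
  assumes \<phi>: "\<And>a. A.bilin (\<phi> a)" "\<And>b c. lin_fun A (\<lambda>a. \<phi> a b c)"
  shows "tsum (\<lambda>x c. tsum (\<lambda>a b. \<phi> a b c) (\<Delta> x)) (\<Delta> z) = tsum (\<lambda>a x. tsum (\<lambda>b c. \<phi> a b c) (\<Delta> x)) (\<Delta> z)"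
proof -
  \<comment> \<open>The formal difference of the two bracketings, written as triples; the sign of
    the second one sits in its middle leg.\<close>
  define L where "L = concat (map (\<lambda>(x, c). map (\<lambda>(a, b). (a, [(b, c)])) (\<Delta> x)) (\<Delta> z)) @
    map (\<lambda>(a, x). (a, map (\<lambda>(b, c). ((-1) \<cdot> b, c)) (\<Delta> x))) (\<Delta> z)"
  have eq: "tsum (\<lambda>a ts. tsum (\<phi> a) ts) L = tsum (\<lambda>x c. tsum (\<lambda>a b. \<phi> a b c) (\<Delta> x)) (\<Delta> z) -
    tsum (\<lambda>a x. tsum (\<lambda>b c. \<phi> a b c) (\<Delta> x)) (\<Delta> z)"
    if bil: "\<And>a. A.bilin (\<phi> a)" for \<phi>
  proof -
    have "\<phi> a ((-1) \<cdot> b) = (\<lambda>c. - \<phi> a b c)" for a b using bil[of a] by (auto simp: bilin_A)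
    then show ?thesis by (simp add: L_def tsum_concat_map tsum_map tsum_minus)
  qed
  have "tsum (\<lambda>a ts. tsum (\<phi> a) ts) L = 0"
  proof (rule A.trilinear_zero)
    fix f g h assume fgh: "lin_fun A f" "lin_fun A g" "lin_fun A h"
    have "tsum (\<lambda>a ts. f a * tpair g h ts) L = tsum (\<lambda>a ts. tsum (\<lambda>b c. f a * (g b * h c)) ts) L"
      by (simp add: tpair_eq_tsum tsum_mult_left)
    also have "\<dots> = 0"
    proof (subst eq)
      show "A.bilin (\<lambda>b c. f a * (g b * h c))" for a
        using fgh by (simp add: bilin_A lin_fun_A algebra_simps)
      have "sum_list (map (\<lambda>(x1, x2). tpair f g (\<Delta> x1) * h x2) (\<Delta> z)) =
        sum_list (map (\<lambda>(x1, x2). f x1 * tpair g h (\<Delta> x2)) (\<Delta> z))"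
        using bialg_A fgh by (simp add: is_bialg_def carrier_UNIV)
      then show "tsum (\<lambda>x c. tsum (\<lambda>a b. f a * (g b * h c)) (\<Delta> x)) (\<Delta> z) -
        tsum (\<lambda>a x. tsum (\<lambda>b c. f a * (g b * h c)) (\<Delta> x)) (\<Delta> z) = 0"
        by (simp add: sum_list_eq_tsum tpair_eq_tsum tsum_mult_left tsum_mult_right flip: mult.assoc)
           (simp add: mult.assoc tsum_mult_left)
    qed
    finally show "tsum (\<lambda>a ts. f a * tpair g h ts) L = 0" .
  qed (use \<phi> in \<open>simp_all add: carrier_UNIV\<close>)
  then show ?thesis using eq[OF \<phi>(1)] by simp
qed

section \<open>The enveloping algebra\<close>

abbreviation U where "U \<equiv> U_of A br"
abbreviation cl where "cl \<equiv> ucls A br"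
abbreviation addU (infixl "\<oplus>" 65) where "X \<oplus> Y \<equiv> vadd U X Y"
abbreviation mulU (infixl "\<otimes>" 70) where "X \<otimes> Y \<equiv> vmul U X Y"
abbreviation scaleU (infixr "*\<^sub>U" 75) where "c *\<^sub>U X \<equiv> vscale U c X"
abbreviation oneU ("\<one>") where "\<one> \<equiv> vone U"
abbreviation M where "M \<equiv> mU A br"
definition H where "H a = cl (UH a)"

lemma cl_eq_iff: "cl p = cl q \<longleftrightarrow> ueq A br p q"
  unfolding ucls_def using ueq.refl ueq.sym ueq.trans by blast

lemma ueq_urep: "ueq A br (urep (cl p)) p"
proof -
  have "p \<in> cl p" by (simp add: ucls_def ueq.refl)
  then have "urep (cl p) \<in> cl p" unfolding urep_def by (rule someI)
  then show ?thesis by (auto simp: ucls_def intro: ueq.sym)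
qed

text \<open>The congruence rules of \<open>ueq\<close> as rewriting: choices of representatives are
  erased, so that each law of U(A) reduces to one rule of \<open>ueq\<close>.\<close>

lemma cl_urep [simp]:
  "cl (urep (cl p)) = cl p"
  "cl (UAdd (urep (cl p)) q) = cl (UAdd p q)" "cl (UAdd q (urep (cl p))) = cl (UAdd q p)"
  "cl (UMul (urep (cl p)) q) = cl (UMul p q)" "cl (UMul q (urep (cl p))) = cl (UMul q p)"
  "cl (UScal c (urep (cl p))) = cl (UScal c p)"
  unfolding cl_eq_iff by (intro ueq_urep ueq.intros(4-6) ueq.refl)+

lemma U_simps: "vcar U = range cl" "vzero U = cl UZero" "\<one> = cl UOne"
  "X \<oplus> Y = cl (UAdd (urep X) (urep Y))" "X \<otimes> Y = cl (UMul (urep X) (urep Y))"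
  "c *\<^sub>U X = cl (UScal c (urep X))"
  "cop U X = map (\<lambda>(p, q). (cl p, cl q)) (ucop A (urep X))" "cou U X = ucou A (urep X)"
  by (simp_all add: U_of_def)

lemma cl_ops: "cl (UM a) = M a" "cl (UH a) = H a" "cl UOne = \<one>" "cl UZero = vzero U"
  "cl (UAdd p q) = cl p \<oplus> cl q" "cl (UMul p q) = cl p \<otimes> cl q" "cl (UScal c p) = c *\<^sub>U cl p"
  by (simp_all add: U_simps mU_def H_def)

text \<open>The operations on classes only depend on chosen representatives, so all the laws below
  except the unit laws hold for arbitrary sets of expressions, without a carrier condition.\<close>

lemma U_add_assoc: "(X \<oplus> Y) \<oplus> Z = X \<oplus> (Y \<oplus> Z)"
  and U_add_comm: "X \<oplus> Y = Y \<oplus> X"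
  and U_scale_add: "c *\<^sub>U (X \<oplus> Y) = c *\<^sub>U X \<oplus> c *\<^sub>U Y"
  and U_scale_plus: "(c + d) *\<^sub>U X = c *\<^sub>U X \<oplus> d *\<^sub>U X"
  and U_scale_scale: "c *\<^sub>U d *\<^sub>U X = (c * d) *\<^sub>U X"
  and U_add_inverse: "X \<oplus> (-1) *\<^sub>U X = vzero U"
  and U_mul_assoc: "(X \<otimes> Y) \<otimes> Z = X \<otimes> (Y \<otimes> Z)"
  and U_distrib: "X \<otimes> (Y \<oplus> Z) = (X \<otimes> Y) \<oplus> (X \<otimes> Z)" "(X \<oplus> Y) \<otimes> Z = (X \<otimes> Z) \<oplus> (Y \<otimes> Z)"
  and U_scale_mul: "(c *\<^sub>U X) \<otimes> Y = c *\<^sub>U (X \<otimes> Y)" "X \<otimes> (c *\<^sub>U Y) = c *\<^sub>U (X \<otimes> Y)"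
  unfolding U_simps cl_urep cl_eq_iff by (rule ueq.intros(7-30) ueq.intros(7-30)[THEN ueq.sym])+

lemma U_unit: "vzero U \<oplus> cl p = cl p" "1 *\<^sub>U cl p = cl p" "\<one> \<otimes> cl p = cl p" "cl p \<otimes> \<one> = cl p"
  unfolding U_simps cl_urep cl_eq_iff by (rule ueq.intros(7-30))+

text \<open>Outside the carrier, multiplication by 1 replaces X by the class of its chosen
  representative. Scaling by 1 has the same effect, and a \<open>ufun\<close> does not distinguish
  \<open>1 *\<^sub>U X\<close> from X.\<close>

lemma U_one_mul: "\<one> \<otimes> X = 1 *\<^sub>U X" "X \<otimes> \<one> = 1 *\<^sub>U X"
proof -
  have "\<one> \<otimes> X = cl (urep X)" "X \<otimes> \<one> = cl (urep X)" "1 *\<^sub>U X = cl (urep X)"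
    unfolding U_simps cl_urep cl_eq_iff by (rule ueq.intros(7-30))+
  then show "\<one> \<otimes> X = 1 *\<^sub>U X" "X \<otimes> \<one> = 1 *\<^sub>U X" by simp_all
qed

lemma M_add: "M (a \<boxplus> b) = M a \<oplus> M b"
  and M_scale: "M (c \<cdot> a) = c *\<^sub>U M a"
  and H_add: "H (a \<boxplus> b) = H a \<oplus> H b"
  and H_scale: "H (c \<cdot> a) = c *\<^sub>U H a"
  and M_mul: "M (x \<odot> y) = M x \<otimes> M y"
  and M_one: "M (vone A) = \<one>"
  and H_mul: "H (x \<odot> y) = M y \<otimes> H x \<oplus> M x \<otimes> H y"
  and H_br: "H (br x y) = H x \<otimes> H y \<oplus> (-1) *\<^sub>U (H y \<otimes> H x)"
  and M_br: "M (br x y) = H x \<otimes> M y \<oplus> (-1) *\<^sub>U (M y \<otimes> H x)"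
  unfolding cl_ops[symmetric] cl_eq_iff usub_def[symmetric] by (rule ueq.intros(7-30))+

lemma M_comm: "M x \<otimes> M y = M y \<otimes> M x"
  by (metis M_mul mulA_comm)

lemma M_left_comm: "M x \<otimes> (M y \<otimes> Z) = M y \<otimes> (M x \<otimes> Z)"
  by (metis M_comm U_mul_assoc)

lemmas MH_lin = M_add M_scale H_add H_scale
lemmas U_lin = U_distrib U_scale_mul

text \<open>Linearity on all sets of expressions, not only on classes, so that multilinear
  computations in U(A) carry no carrier conditions.\<close>

definition ufun where
  "ufun f \<longleftrightarrow> (\<forall>X Y. f (X \<oplus> Y) = f X + f Y) \<and> (\<forall>c X. f (c *\<^sub>U X) = (c::'k) * f X)"

lemma ufunD: "ufun f \<Longrightarrow> f (X \<oplus> Y) = f X + f Y" "ufun f \<Longrightarrow> f (c *\<^sub>U X) = c * f X"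
  by (auto simp: ufun_def)

lemma ufun_unit: "ufun f \<Longrightarrow> f (\<one> \<otimes> X) = f X" "ufun f \<Longrightarrow> f (X \<otimes> \<one>) = f X" "ufun f \<Longrightarrow> f (cl (urep X)) = f X"
  using U_unit(2)[of "urep X"] by (simp_all add: U_one_mul ufun_def) (metis U_simps(6) cl_urep(6) mult_1)

lemma ufun_zero: "ufun f \<Longrightarrow> f (vzero U) = 0"
  unfolding U_add_inverse[of \<one>, symmetric] by (simp add: ufun_def)

lemma ufun_mul: "ufun f \<Longrightarrow> ufun (\<lambda>X. f (X \<otimes> Y))" "ufun f \<Longrightarrow> ufun (\<lambda>X. f (Y \<otimes> X))"
  by (simp_all add: ufun_def U_lin)

lemma ufun_M: "ufun f \<Longrightarrow> lin_fun A (\<lambda>x. f (M x))" and ufun_H: "ufun f \<Longrightarrow> lin_fun A (\<lambda>x. f (H x))"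
  by (simp_all add: ufun_def lin_fun_A MH_lin)

text \<open>Passing first to the class of the representative leaves f unchanged on the carrier and
  makes it linear on arbitrary sets.\<close>

lemma lin_fun_imp_ufun: "lin_fun U f \<Longrightarrow> ufun (\<lambda>X. f (cl (urep X)))"
  unfolding ufun_def U_simps(4,6) cl_urep lin_fun_def
  by (simp add: cl_ops U_simps(1))

lemma ufun_imp_lin_fun: "ufun f \<Longrightarrow> lin_fun U f"
  by (simp add: ufun_def lin_fun_def)

lemma cl_closed [simp]: "cl p \<in> vcar U"
  by (simp add: U_simps(1))

lemma ops_closed [simp]: "X \<oplus> Y \<in> vcar U" "X \<otimes> Y \<in> vcar U" "c *\<^sub>U X \<in> vcar U" "vzero U \<in> vcar U"
  "\<one> \<in> vcar U" "M a \<in> vcar U" "H a \<in> vcar U"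
  unfolding mU_def H_def U_simps(2-6) by (rule cl_closed)+

lemma U_unit_carrier: "X \<in> vcar U \<Longrightarrow> vzero U \<oplus> X = X" "X \<in> vcar U \<Longrightarrow> 1 *\<^sub>U X = X"
  "X \<in> vcar U \<Longrightarrow> \<one> \<otimes> X = X" "X \<in> vcar U \<Longrightarrow> X \<otimes> \<one> = X"
  unfolding U_simps(1) using U_unit by blast+

lemma kalg_U: "is_kalg U"
  unfolding is_kalg_def is_kvs_def
  by (simp add: U_unit_carrier U_scale_add U_scale_plus U_scale_scale U_add_inverse U_mul_assoc U_lin U_add_assoc)
     (simp add: U_add_comm)

sublocale U: kvs_space U
  by unfold_locales (use kalg_U in \<open>simp add: is_kalg_def\<close>)

lemma U_eqI:
  assumes "X \<in> vcar U" "Y \<in> vcar U" "\<And>f. ufun f \<Longrightarrow> f X = f Y"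
  shows "X = Y"
proof (rule U.functional_eqI[OF assms(1,2)])
  fix f assume "lin_fun U f"
  from assms(3)[OF lin_fun_imp_ufun[OF this]] show "f X = f Y"
    using assms(1,2) by (auto simp: U_simps(1))
qed

section \<open>Invariance of the coproduct under the relations of U(A)\<close>

definition ubil where
  "ubil \<phi> \<longleftrightarrow> (\<forall>Y. ufun (\<lambda>X. \<phi> X Y)) \<and> (\<forall>X. ufun (\<phi> X))"

lemma ubilI: "(\<And>Y. ufun (\<lambda>X. \<phi> X Y)) \<Longrightarrow> (\<And>X. ufun (\<phi> X)) \<Longrightarrow> ubil \<phi>"
  by (simp add: ubil_def)

lemma ubilD:
  assumes "ubil \<phi>"
  shows "\<phi> (X \<oplus> Y) Z = \<phi> X Z + \<phi> Y Z" "\<phi> Z (X \<oplus> Y) = \<phi> Z X + \<phi> Z Y"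
    "\<phi> (c *\<^sub>U X) Z = c * \<phi> X Z" "\<phi> Z (c *\<^sub>U X) = c * \<phi> Z X"
  using assms by (auto simp: ubil_def ufun_def)

lemma ubil_M: "ubil \<phi> \<Longrightarrow> A.bilin (\<lambda>x y. \<phi> (M x) (M y))"
  and ubil_HM: "ubil \<phi> \<Longrightarrow> A.bilin (\<lambda>x y. \<phi> (H x) (M y) + \<phi> (M x) (H y))"
  by (simp_all add: bilin_A MH_lin ubilD algebra_simps)

lemma ubil_mul: "ubil \<phi> \<Longrightarrow> ubil (\<lambda>Z W. \<phi> (X \<otimes> Z) (Y \<otimes> W))"
  by (simp add: ubil_def ufun_def U_lin)

lemma ubil_unit:
  assumes "ubil \<phi>"
  shows "\<phi> (\<one> \<otimes> X) = (\<lambda>Y. \<phi> X Y)" "\<phi> X (\<one> \<otimes> Y) = \<phi> X Y" "\<phi> (X \<otimes> \<one>) = (\<lambda>Y. \<phi> X Y)" "\<phi> X (Y \<otimes> \<one>) = \<phi> X Y"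
proof -
  have f: "ufun (\<lambda>X. \<phi> X Y)" "ufun (\<phi> X)" for X Y using assms by (auto simp: ubil_def)
  show "\<phi> (\<one> \<otimes> X) = (\<lambda>Y. \<phi> X Y)" "\<phi> (X \<otimes> \<one>) = (\<lambda>Y. \<phi> X Y)"
    using ufun_unit[OF f(1)] by auto
  show "\<phi> X (\<one> \<otimes> Y) = \<phi> X Y" "\<phi> X (Y \<otimes> \<one>) = \<phi> X Y"
    using ufun_unit[OF f(2)] by auto
qed

text \<open>Since phi is evaluated on classes, well-definedness of Delta on U(A) amounts to
  invariance of this scalar under \<open>ueq\<close>.\<close>

definition usum :: "(('k, 'a) uexp set \<Rightarrow> ('k, 'a) uexp set \<Rightarrow> 'k) \<Rightarrow> ('k, 'a) uexp \<Rightarrow> 'k" where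
  "usum \<phi> p = tsum (\<lambda>a b. \<phi> (cl a) (cl b)) (ucop A p)"

lemma usum_simps:
  "usum \<phi> (UM a) = tsum (\<lambda>x y. \<phi> (M x) (M y)) (\<Delta> a)"
  "usum \<phi> (UH a) = tsum (\<lambda>x y. \<phi> (H x) (M y) + \<phi> (M x) (H y)) (\<Delta> a)"
  "usum \<phi> UZero = 0"
  "usum \<phi> UOne = \<phi> \<one> \<one>"
  "usum \<phi> (UAdd p q) = usum \<phi> p + usum \<phi> q"
  "usum \<phi> (UMul p q) = usum (\<lambda>X Y. usum (\<lambda>Z W. \<phi> (X \<otimes> Z) (Y \<otimes> W)) q) p"
  by (simp_all add: usum_def tsum_map tsum_concat_map cl_ops)

lemma usum_scale: "ubil \<phi> \<Longrightarrow> usum \<phi> (UScal c p) = c * usum \<phi> p"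
  by (simp add: usum_def tsum_map cl_ops ubilD tsum_mult_left)

lemma usum_add_fun: "usum (\<lambda>X Y. \<phi> X Y + \<psi> X Y) p = usum \<phi> p + usum \<psi> p"
  and usum_mult_fun: "usum (\<lambda>X Y. c * \<phi> X Y) p = c * usum \<phi> p"
  by (simp_all add: usum_def tsum_add tsum_mult_left)

lemma ubil_usum_mul: "ubil \<phi> \<Longrightarrow> ubil (\<lambda>X Y. usum (\<lambda>Z W. \<phi> (X \<otimes> Z) (Y \<otimes> W)) q)"
  by (simp add: ubil_def ufun_def U_lin usum_add_fun usum_mult_fun)

text \<open>The commutator of the coproducts of h_x and h_y contains mixed terms such as h_a m_c
  tensor m_b h_d. Moving every m to the left of every h produces m of a bracket, and these
  corrections are the mixed terms supplied by the Poisson property of Delta.\<close>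

lemma usum_rel_hbr:
  assumes \<phi>: "ubil \<phi>"
  shows "usum \<phi> (UH (br x y)) = usum \<phi> (usub (UMul (UH x) (UH y)) (UMul (UH y) (UH x)))"
proof -
  note bil = ubilD[OF \<phi>]
  have "(\<phi> (H (br a c)) (M (b \<odot> d)) + \<phi> (M (br a c)) (H (b \<odot> d))) +
      (\<phi> (H (a \<odot> c)) (M (br b d)) + \<phi> (M (a \<odot> c)) (H (br b d)))
    = ((\<phi> (H a \<otimes> H c) (M b \<otimes> M d) + \<phi> (H a \<otimes> M c) (M b \<otimes> H d)) +
      (\<phi> (M a \<otimes> H c) (H b \<otimes> M d) + \<phi> (M a \<otimes> M c) (H b \<otimes> H d))) -
      ((\<phi> (H c \<otimes> H a) (M d \<otimes> M b) + \<phi> (H c \<otimes> M a) (M d \<otimes> H b)) +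
      (\<phi> (M c \<otimes> H a) (H d \<otimes> M b) + \<phi> (M c \<otimes> M a) (H d \<otimes> H b)))" for a b c d
  proof -
    have comm: "H a \<otimes> M c = M c \<otimes> H a \<oplus> M (br a c)" for a c
      by (simp add: M_br U_add_comm[of "M c \<otimes> H a"] U_add_assoc U_add_comm[of "_ *\<^sub>U _" "M c \<otimes> H a"] U_add_inverse)
    have "br c a = (-1) \<cdot> br a c" "br d b = (-1) \<cdot> br b d" "d \<odot> b = b \<odot> d" "c \<odot> a = a \<odot> c"
      by (rule br_anti mulA_comm)+
    then show ?thesis
      by (simp add: comm H_br H_mul bil M_scale algebra_simps flip: M_mul)
  qed
  then show ?thesis
    using tsum_cop_br[OF ubil_HM[OF \<phi>], of x y]
    by (simp add: usub_def usum_simps usum_scale[OF \<phi>] tsum_swap[of _ "\<Delta> y" "\<Delta> x"] flip: tsum_add tsum_diff)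
qed

text \<open>The form must be arbitrary in the induction: in a product, one factor is tested with phi
  translated by the legs of the other. The defining relations come down to the same relations in
  each leg, combined with compatibility of Delta with the product and bracket of A.\<close>

lemma usum_respects: "ueq A br p q \<Longrightarrow> ubil \<phi> \<Longrightarrow> usum \<phi> p = usum \<phi> q"
proof (induction arbitrary: \<phi> rule: ueq.induct)
  case (cong_mul p p' q q')
  then show ?case by (simp add: usum_simps ubil_mul ubil_usum_mul)
next
  case (rel_hbr x y)
  then show ?case by (rule usum_rel_hbr)
next
  case (m_add a b)
  then show ?case by (simp add: usum_simps tsum_cop_add ubil_M)
next
  case (m_scal c a)
  then show ?case by (simp add: usum_simps tsum_cop_scale ubil_M usum_scale)
next
  case (h_add a b)
  then show ?case by (simp add: usum_simps tsum_cop_add ubil_HM)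
next
  case (h_scal c a)
  then show ?case by (simp add: usum_simps tsum_cop_scale ubil_HM usum_scale)
next
  case (rel_mm x y)
  then show ?case by (simp add: usum_simps tsum_cop_mul ubil_M M_mul)
next
  case (rel_hm x y)
  show ?case
    using tsum_cop_mul[OF ubil_HM[OF rel_hm], of x y]
    by (simp add: usum_simps M_mul H_mul ubilD[OF rel_hm] tsum_swap[of _ "\<Delta> y" "\<Delta> x"] M_comm add_ac flip: tsum_add)
next
  case (rel_mbr x y)
  show ?case
  proof -
    have "\<phi> (M (br a c)) (M (b \<odot> d)) + \<phi> (M (a \<odot> c)) (M (br b d))
      = (\<phi> (H a \<otimes> M c) (M b \<otimes> M d) + \<phi> (M a \<otimes> M c) (H b \<otimes> M d)) -
        (\<phi> (M c \<otimes> H a) (M d \<otimes> M b) + \<phi> (M c \<otimes> M a) (M d \<otimes> H b))" for a b c d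
      by (simp add: M_br M_mul ubilD[OF rel_mbr] M_comm[of c a] M_comm[of d b])
    then show ?thesis
      using tsum_cop_br[OF ubil_M[OF rel_mbr], of x y]
      by (simp add: usub_def usum_simps usum_scale[OF rel_mbr] tsum_swap[of _ "\<Delta> y" "\<Delta> x"] flip: tsum_add tsum_diff)
  qed
next
  case rel_one
  then show ?case by (simp add: usum_simps tsum_cop_one ubil_M M_one)
next
  case (scal_mul_r c p q)
  then show ?case by (simp add: usum_simps usum_scale ubil_mul ubil_usum_mul usum_mult_fun)
next
  case (mul_one_l p)
  then show ?case by (simp add: usum_simps ubil_unit)
next
  case (mul_one_r p)
  then show ?case by (simp add: usum_simps ubil_unit)
qed (simp_all add: usum_simps usum_scale usum_add_fun usum_mult_fun ubil_mul ubil_usum_mul U_mul_assoc U_lin ubilD algebra_simps)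

section \<open>The bialgebra structure\<close>

abbreviation DU where "DU \<phi> X \<equiv> tsum \<phi> (cop U X)"

lemma DU_urep: "DU \<phi> X = usum \<phi> (urep X)"
  by (simp add: U_simps(7) usum_def tsum_map)

lemma DU_cl: "ubil \<phi> \<Longrightarrow> DU \<phi> (cl p) = usum \<phi> p"
  unfolding DU_urep by (rule usum_respects[OF ueq_urep])

text \<open>From here on coproducts are computed from classes alone: the representative chosen in
  \<open>cop U\<close> is invisible to a bilinear form.\<close>

lemma DU_simps:
  assumes "ubil \<phi>"
  shows "DU \<phi> (X \<oplus> Y) = DU \<phi> X + DU \<phi> Y" "DU \<phi> (c *\<^sub>U X) = c * DU \<phi> X"
    "DU \<phi> (X \<otimes> Y) = DU (\<lambda>X1 X2. DU (\<lambda>Y1 Y2. \<phi> (X1 \<otimes> Y1) (X2 \<otimes> Y2)) Y) X"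
    "DU \<phi> \<one> = \<phi> \<one> \<one>"
    "DU \<phi> (M a) = tsum (\<lambda>x y. \<phi> (M x) (M y)) (\<Delta> a)"
    "DU \<phi> (H a) = tsum (\<lambda>x y. \<phi> (H x) (M y) + \<phi> (M x) (H y)) (\<Delta> a)"
proof -
  show "DU \<phi> (X \<oplus> Y) = DU \<phi> X + DU \<phi> Y" "DU \<phi> (c *\<^sub>U X) = c * DU \<phi> X"
    unfolding U_simps(4,6) DU_cl[OF assms] usum_simps usum_scale[OF assms] by (simp_all add: DU_urep)
  show "DU \<phi> (X \<otimes> Y) = DU (\<lambda>X1 X2. DU (\<lambda>Y1 Y2. \<phi> (X1 \<otimes> Y1) (X2 \<otimes> Y2)) Y) X"
    unfolding U_simps(5)[of X Y] DU_cl[OF assms] usum_simps by (simp add: DU_urep)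
  show "DU \<phi> \<one> = \<phi> \<one> \<one>"
    using DU_cl[OF assms, of UOne] by (simp add: cl_ops usum_simps)
  show "DU \<phi> (M a) = tsum (\<lambda>x y. \<phi> (M x) (M y)) (\<Delta> a)"
    "DU \<phi> (H a) = tsum (\<lambda>x y. \<phi> (H x) (M y) + \<phi> (M x) (H y)) (\<Delta> a)"
    using DU_cl[OF assms, of "UM a"] DU_cl[OF assms, of "UH a"] by (simp_all add: cl_ops usum_simps)
qed

lemma ufun_DU: "ubil \<phi> \<Longrightarrow> ufun (\<lambda>X. DU \<phi> X)"
  by (simp add: ufun_def DU_simps)

lemma ufun_tsum: "(\<And>a b. ufun (\<lambda>X. \<phi> X a b)) \<Longrightarrow> ufun (\<lambda>X. tsum (\<phi> X) xs)"
proof -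
  assume "\<And>a b. ufun (\<lambda>X. \<phi> X a b)"
  then have "\<phi> (X \<oplus> Y) = (\<lambda>a b. \<phi> X a b + \<phi> Y a b)" "\<phi> (c *\<^sub>U X) = (\<lambda>a b. c * \<phi> X a b)" for X Y c
    by (auto simp: ufun_def fun_eq_iff)
  then show ?thesis by (simp add: ufun_def tsum_add tsum_mult_left)
qed

lemma ubil_prod: "ufun f \<Longrightarrow> ufun g \<Longrightarrow> ubil (\<lambda>X Y. f X * g Y)"
  by (simp add: ubil_def ufun_def algebra_simps)

lemma U_induct [consumes 1, case_names M H one zero add mul scale]:
  assumes "X \<in> vcar U" "\<And>a. P (M a)" "\<And>a. P (H a)" "P \<one>" "P (vzero U)"
    "\<And>X Y. X \<in> vcar U \<Longrightarrow> Y \<in> vcar U \<Longrightarrow> P X \<Longrightarrow> P Y \<Longrightarrow> P (X \<oplus> Y)"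
    "\<And>X Y. X \<in> vcar U \<Longrightarrow> Y \<in> vcar U \<Longrightarrow> P X \<Longrightarrow> P Y \<Longrightarrow> P (X \<otimes> Y)"
    "\<And>c X. X \<in> vcar U \<Longrightarrow> P X \<Longrightarrow> P (c *\<^sub>U X)"
  shows "P X"
proof -
  have "P (cl p)" for p by (induction p) (simp_all add: cl_ops assms cl_closed)
  then show ?thesis using assms(1) by (auto simp: U_simps(1))
qed

lemma ucou_respects: "ueq A br p q \<Longrightarrow> ucou A p = ucou A q"
  by (induction rule: ueq.induct)
     (simp_all add: cou_lin cou_mul cou_br cou_one usub_def algebra_simps)

lemma cou_U: "cou U (X \<oplus> Y) = cou U X + cou U Y" "cou U (c *\<^sub>U X) = c * cou U X"
  "cou U (X \<otimes> Y) = cou U X * cou U Y" "cou U \<one> = 1" "cou U (M a) = \<epsilon> a" "cou U (H a) = 0"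
proof -
  have cl: "cou U (cl p) = ucou A p" for p
    unfolding U_simps(8) by (rule ucou_respects[OF ueq_urep])
  show "cou U (X \<oplus> Y) = cou U X + cou U Y" "cou U (c *\<^sub>U X) = c * cou U X"
    "cou U (X \<otimes> Y) = cou U X * cou U Y" "cou U \<one> = 1" "cou U (M a) = \<epsilon> a" "cou U (H a) = 0"
    unfolding U_simps(3-6) cl by (simp_all add: U_simps(8) mU_def H_def cl[unfolded U_simps(8)])
qed

lemma ufun_cou: "ufun (cou U)"
  by (simp add: ufun_def cou_U)

lemma DU_counit:
  assumes "Z \<in> vcar U" "ufun f"
  shows "DU (\<lambda>X Y. cou U X * f Y) Z = f Z" "DU (\<lambda>X Y. f X * cou U Y) Z = f Z"
proof -
  note bil = ubil_prod[OF ufun_cou] ubil_prod[OF _ ufun_cou]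
  \<comment> \<open>The functional is quantified inside the induction because the product case
    applies the hypotheses to f composed with multiplications.\<close>
  have "\<forall>f. ufun f \<longrightarrow> DU (\<lambda>X Y. cou U X * f Y) Z = f Z \<and> DU (\<lambda>X Y. f X * cou U Y) Z = f Z"
    using assms(1)
  proof (induction rule: U_induct)
    case (M a)
    show ?case
      by (simp add: DU_simps bil cou_U tsum_counit_left tsum_counit_right ufun_M)
  next
    case (H a)
    show ?case
      by (simp add: DU_simps bil cou_U tsum_counit_left tsum_counit_right ufun_H)
  next
    case (mul X Y)
    have "DU (\<lambda>X Y. cou U X * f Y) (X \<otimes> Y) = f (X \<otimes> Y)" "DU (\<lambda>X Y. f X * cou U Y) (X \<otimes> Y) = f (X \<otimes> Y)" if f: "ufun f" for f
    proof -
      have "DU (\<lambda>X Y. cou U X * f Y) (X \<otimes> Y) = DU (\<lambda>X1 X2. cou U X1 * DU (\<lambda>Y1 Y2. cou U Y1 * f (X2 \<otimes> Y2)) Y) X"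
        by (simp add: DU_simps bil f cou_U tsum_mult_left mult.assoc)
      also have "\<dots> = f (X \<otimes> Y)" using mul.IH f by (simp add: ufun_mul)
      finally show "DU (\<lambda>X Y. cou U X * f Y) (X \<otimes> Y) = f (X \<otimes> Y)" .
      have "DU (\<lambda>X Y. f X * cou U Y) (X \<otimes> Y) = DU (\<lambda>X1 X2. DU (\<lambda>Y1 Y2. f (X1 \<otimes> Y1) * cou U Y2) Y * cou U X2) X"
        by (simp add: DU_simps bil f cou_U mult_ac tsum_mult_left)
      also have "\<dots> = f (X \<otimes> Y)" using mul.IH f by (simp add: ufun_mul)
      finally show "DU (\<lambda>X Y. f X * cou U Y) (X \<otimes> Y) = f (X \<otimes> Y)" .
    qed
    then show ?case by blast
  next
    case zero
    \<comment> \<open>Zero is rewritten as 1 + (-1) 1, to which the rules for sums and multiples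
      apply.\<close>
    show ?case unfolding U_add_inverse[of \<one>, symmetric]
      by (simp add: DU_simps bil cou_U ufunD)
  qed (simp_all add: DU_simps bil cou_U ufunD)
  then show "DU (\<lambda>X Y. cou U X * f Y) Z = f Z" "DU (\<lambda>X Y. f X * cou U Y) Z = f Z"
    using assms by blast+
qed

section \<open>Coassociativity on the enveloping algebra\<close>

definition utri where
  "utri \<phi> \<longleftrightarrow> (\<forall>b c. ufun (\<lambda>a. \<phi> a b c)) \<and> (\<forall>a c. ufun (\<lambda>b. \<phi> a b c)) \<and> (\<forall>a b. ufun (\<phi> a b))"

lemma utri_ubil:
  assumes "utri \<phi>"
  shows "ubil (\<phi> a)" "ubil (\<lambda>a b. \<phi> a b c)" "ubil (\<lambda>X c. DU (\<lambda>a b. \<phi> a b c) X)" "ubil (\<lambda>a Y. DU (\<phi> a) Y)"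
proof -
  have f: "ufun (\<lambda>a. \<phi> a b c)" "ufun (\<lambda>b. \<phi> a b c)" "ufun (\<phi> a b)" for a b c
    using assms by (auto simp: utri_def)
  show b: "ubil (\<phi> a)" "ubil (\<lambda>a b. \<phi> a b c)" for a c using f by (auto simp: ubil_def)
  show "ubil (\<lambda>X c. DU (\<lambda>a b. \<phi> a b c) X)" "ubil (\<lambda>a Y. DU (\<phi> a) Y)"
    using ufun_DU[OF b(1)] ufun_DU[OF b(2)] ufun_tsum[where \<phi> = "\<lambda>c a b. \<phi> a b c"] ufun_tsum[where \<phi> = \<phi>] f
    by (auto intro!: ubilI)
qed

lemma utriD:
  assumes "utri \<phi>"
  shows "\<phi> (X \<oplus> Y) b c = \<phi> X b c + \<phi> Y b c" "\<phi> a (X \<oplus> Y) c = \<phi> a X c + \<phi> a Y c" "\<phi> a b (X \<oplus> Y) = \<phi> a b X + \<phi> a b Y"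
    "\<phi> (k *\<^sub>U X) b c = k * \<phi> X b c" "\<phi> a (k *\<^sub>U X) c = k * \<phi> a X c" "\<phi> a b (k *\<^sub>U X) = k * \<phi> a b X"
  using assms by (auto simp: utri_def ufun_def)

text \<open>On m_z and h_z this is coassociativity of A. For a product, multiplicativity of Delta
  separates the sums over the two factors, so each factor can be reassociated on its own once the
  sums have been interchanged.\<close>

lemma DU_coassoc:
  assumes "Z \<in> vcar U" "utri \<phi>"
  shows "DU (\<lambda>X c. DU (\<lambda>a b. \<phi> a b c) X) Z = DU (\<lambda>a Y. DU (\<phi> a) Y) Z"
  using assms
proof (induction arbitrary: \<phi> rule: U_induct)
  case (M z)
  note b = utri_ubil[OF M] and D = utriD[OF M]
  show ?case unfolding DU_simps[OF b(3)] DU_simps[OF b(4)] DU_simps[OF b(1)] DU_simps[OF b(2)]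
    by (rule tsum_coassoc) (simp_all add: bilin_A lin_fun_A MH_lin D)
next
  case (H z)
  note b = utri_ubil[OF H] and D = utriD[OF H]
  \<comment> \<open>Both bracketings of the threefold coproduct of h_z are the sum in which h sits
    on exactly one of the three legs.\<close>
  have "tsum (\<lambda>x z. tsum (\<lambda>a b. (\<phi> (H a) (M b) (M z) + \<phi> (M a) (H b) (M z)) + \<phi> (M a) (M b) (H z)) (\<Delta> x)) (\<Delta> z)
    = tsum (\<lambda>a x. tsum (\<lambda>b z. (\<phi> (H a) (M b) (M z) + \<phi> (M a) (H b) (M z)) + \<phi> (M a) (M b) (H z)) (\<Delta> x)) (\<Delta> z)"
    by (rule tsum_coassoc) (simp_all add: bilin_A lin_fun_A MH_lin D algebra_simps)
  then show ?case unfolding DU_simps[OF b(3)] DU_simps[OF b(4)] DU_simps[OF b(1)] DU_simps[OF b(2)]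
    by (simp add: tsum_add add.assoc)
next
  case one
  note b = utri_ubil[OF one]
  show ?case unfolding DU_simps[OF b(3)] DU_simps[OF b(4)] DU_simps[OF b(1)] DU_simps[OF b(2)] by rule
next
  case zero
  note b = utri_ubil[OF zero]
  show ?case unfolding ufun_zero[OF ufun_DU[OF b(3)]] ufun_zero[OF ufun_DU[OF b(4)]] by rule
next
  case (add X Y)
  note b = utri_ubil[OF add.prems]
  show ?case using add.IH[OF add.prems] unfolding DU_simps[OF b(3)] DU_simps[OF b(4)] by simp
next
  case (scale c X)
  note b = utri_ubil[OF scale.prems]
  show ?case using scale.IH[OF scale.prems] unfolding DU_simps[OF b(3)] DU_simps[OF b(4)] by simp
next
  case (mul X Y)
  note b = utri_ubil[OF mul.prems] and D = utriD[OF mul.prems]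
  let ?\<psi> = "\<lambda>a a' X2 b b' Y2. \<phi> (a \<otimes> b) (a' \<otimes> b') (X2 \<otimes> Y2)"
  have tri: "utri (\<lambda>b b' Y2. ?\<psi> a a' X2 b b' Y2)" for a a' X2
    by (simp add: utri_def ufun_def D U_lin)
  have tri': "utri (\<lambda>a a' X2. DU (\<lambda>b Y'. DU (\<lambda>b' Y2. ?\<psi> a a' X2 b b' Y2) Y') Y)"
    by (simp add: utri_def ufun_def D U_lin tsum_add tsum_mult_left)
  have "DU (\<lambda>Z c. DU (\<lambda>a b. \<phi> a b c) Z) (X \<otimes> Y)
    = DU (\<lambda>X1 X2. DU (\<lambda>Y1 Y2. DU (\<lambda>a a'. DU (\<lambda>b b'. ?\<psi> a a' X2 b b' Y2) Y1) X1) Y) X"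
    unfolding DU_simps[OF b(3)] DU_simps[OF b(2)] by rule
  also have "\<dots> = DU (\<lambda>X1 X2. DU (\<lambda>a a'. DU (\<lambda>Y1 Y2. DU (\<lambda>b b'. ?\<psi> a a' X2 b b' Y2) Y1) Y) X1) X"
    by (intro tsum_cong tsum_swap)
  also have "\<dots> = DU (\<lambda>X1 X2. DU (\<lambda>a a'. DU (\<lambda>b Y'. DU (\<lambda>b' Y2. ?\<psi> a a' X2 b b' Y2) Y') Y) X1) X"
    by (simp add: mul.IH(2)[OF tri])
  also have "\<dots> = DU (\<lambda>a X'. DU (\<lambda>a' X2. DU (\<lambda>b Y'. DU (\<lambda>b' Y2. ?\<psi> a a' X2 b b' Y2) Y') Y) X') X"
    by (rule mul.IH(1)[OF tri'])
  also have "\<dots> = DU (\<lambda>a X'. DU (\<lambda>b Y'. DU (\<lambda>a' X2. DU (\<lambda>b' Y2. ?\<psi> a a' X2 b b' Y2) Y') X') Y) X"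
    by (intro tsum_cong tsum_swap)
  also have "\<dots> = DU (\<lambda>a Z. DU (\<phi> a) Z) (X \<otimes> Y)"
    unfolding DU_simps[OF b(4)] DU_simps[OF b(1)] by rule
  finally show ?case .
qed

lemma cop_U_closed: "set (cop U X) \<subseteq> vcar U \<times> vcar U"
  by (auto simp: U_simps(1,7))

lemma cl_urep_carrier: "X \<in> vcar U \<Longrightarrow> cl (urep X) = X"
  by (auto simp: U_simps(1))

lemma tsum_carrier_cong:
  assumes "set xs \<subseteq> vcar U \<times> vcar U"
  shows "tsum (\<lambda>X Y. \<phi> (cl (urep X)) (cl (urep Y))) xs = tsum \<phi> xs"
proof (rule tsum_cong)
  fix X Y assume "(X, Y) \<in> set xs"
  then have "X \<in> vcar U" "Y \<in> vcar U" using assms by auto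
  then show "\<phi> (cl (urep X)) (cl (urep Y)) = \<phi> X Y" by (auto simp: U_simps(1))
qed

lemma teq_UI:
  assumes "set xs \<subseteq> vcar U \<times> vcar U" "set ys \<subseteq> vcar U \<times> vcar U"
    and "\<And>f g. ufun f \<Longrightarrow> ufun g \<Longrightarrow> tsum (\<lambda>X Y. f X * g Y) xs = tsum (\<lambda>X Y. f X * g Y) ys"
  shows "teq U xs ys"
  unfolding teq_def tpair_eq_tsum
proof (intro conjI allI impI assms(1,2))
  fix f g assume "lin_fun U f" "lin_fun U g"
  from assms(3)[OF this[THEN lin_fun_imp_ufun]]
  show "tsum (\<lambda>X Y. f X * g Y) xs = tsum (\<lambda>X Y. f X * g Y) ys"
    using tsum_carrier_cong[OF assms(1), of "\<lambda>X Y. f X * g Y"] tsum_carrier_cong[OF assms(2), of "\<lambda>X Y. f X * g Y"]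
    by simp
qed

lemma teq_UD: "teq U xs ys \<Longrightarrow> ufun f \<Longrightarrow> ufun g \<Longrightarrow> tsum (\<lambda>X Y. f X * g Y) xs = tsum (\<lambda>X Y. f X * g Y) ys"
  using ufun_imp_lin_fun by (auto simp: teq_def tpair_eq_tsum)

lemma bialg_U: "is_bialg U"
  unfolding is_bialg_def
proof (intro conjI ballI allI impI)
  show "is_kalg U" by (rule kalg_U)
  show "lin_fun U (cou U)" by (rule ufun_imp_lin_fun[OF ufun_cou])
  show "set (cop U X) \<subseteq> vcar U \<times> vcar U" for X by (rule cop_U_closed)
  show "teq U (cop U (X \<oplus> Y)) (cop U X @ cop U Y)" for X Y
    using cop_U_closed by (intro teq_UI) (auto simp: DU_simps ubil_prod)
  show "teq U (cop U (c *\<^sub>U X)) (map (\<lambda>(a, b). (c *\<^sub>U a, b)) (cop U X))" for c X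
    using cop_U_closed by (intro teq_UI) (auto simp: DU_simps ubil_prod tsum_map ufunD mult.assoc tsum_mult_left)
  show "teq U (cop U (X \<otimes> Y)) [(a \<otimes> c, b \<otimes> d). (a, b) \<leftarrow> cop U X, (c, d) \<leftarrow> cop U Y]" for X Y
    by (intro teq_UI cop_U_closed) (auto simp: DU_simps ubil_prod tsum_map tsum_concat_map)
  show "teq U (cop U \<one>) [(\<one>, \<one>)]"
    by (intro teq_UI cop_U_closed) (auto simp: DU_simps ubil_prod)
  show "cou U (X \<otimes> Y) = cou U X * cou U Y" "cou U \<one> = 1" for X Y by (simp_all add: cou_U)
  fix X assume X: "X \<in> vcar U"
  have in_car: "x \<in> vcar U \<and> y \<in> vcar U" if "(x, y) \<in> set (cop U X)" for x y
    using that cop_U_closed by blast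
  show "vsum U (map (\<lambda>(x1, x2). cou U x1 *\<^sub>U x2) (cop U X)) = X"
    by (rule U_eqI[OF U.vsum_closed X])
       (use in_car X in \<open>auto simp: U.lin_fun_vsum_map ufun_imp_lin_fun ufunD DU_counit\<close>)
  show "vsum U (map (\<lambda>(x1, x2). cou U x2 *\<^sub>U x1) (cop U X)) = X"
    by (rule U_eqI[OF U.vsum_closed X])
       (use in_car X in \<open>auto simp: U.lin_fun_vsum_map ufun_imp_lin_fun ufunD DU_counit mult.commute[of "cou U _"]\<close>)
  fix f g h assume lin: "lin_fun U f" "lin_fun U g" "lin_fun U h"
  \<comment> \<open>These total versions agree with the test functionals on all legs that occur,
    since legs lie in the carrier.\<close>
  let ?f = "\<lambda>X. f (cl (urep X))" and ?g = "\<lambda>X. g (cl (urep X))" and ?h = "\<lambda>X. h (cl (urep X))"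
  note u = lin[THEN lin_fun_imp_ufun]
  have "utri (\<lambda>a b c. ?f a * ?g b * ?h c)"
    using u by (simp add: utri_def ufun_def algebra_simps)
  note co = DU_coassoc[OF X this]
  have eq: "tpair f g (cop U Y) = DU (\<lambda>a b. ?f a * ?g b) Y" "tpair g h (cop U Y) = DU (\<lambda>a b. ?g a * ?h b) Y" for Y
    unfolding tpair_eq_tsum by (rule tsum_carrier_cong[OF cop_U_closed, symmetric])+
  have "sum_list (map (\<lambda>(x1, x2). tpair f g (cop U x1) * h x2) (cop U X)) = DU (\<lambda>x c. DU (\<lambda>a b. ?f a * ?g b * ?h c) x) X"
    unfolding sum_list_eq_tsum eq tsum_mult_right
    by (rule tsum_cong) (auto dest!: in_car simp: cl_urep_carrier)
  moreover have "sum_list (map (\<lambda>(x1, x2). f x1 * tpair g h (cop U x2)) (cop U X)) = DU (\<lambda>a x. DU (\<lambda>b c. ?f a * ?g b * ?h c) x) X"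
    unfolding sum_list_eq_tsum eq mult.assoc tsum_mult_left
    by (rule tsum_cong) (auto dest!: in_car simp: cl_urep_carrier)
  ultimately show "sum_list (map (\<lambda>(x1, x2). tpair f g (cop U x1) * h x2) (cop U X)) =
    sum_list (map (\<lambda>(x1, x2). f x1 * tpair g h (cop U x2)) (cop U X))"
    using co by simp
qed

section \<open>The antipode\<close>

lemma lin_fun_tsum:
  assumes "\<And>a b. lin_fun A (\<lambda>x. \<phi> x a b)"
  shows "lin_fun A (\<lambda>x. tsum (\<phi> x) xs)"
proof -
  have "\<phi> (x \<boxplus> y) = (\<lambda>a b. \<phi> x a b + \<phi> y a b)" "\<phi> (c \<cdot> x) = (\<lambda>a b. c * \<phi> x a b)" for x y c
    using assms by (auto simp: lin_fun_A fun_eq_iff)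
  then show ?thesis by (simp add: lin_fun_A tsum_add tsum_mult_left)
qed

lemma bilinI: "(\<And>y. lin_fun A (\<lambda>x. \<phi> x y)) \<Longrightarrow> (\<And>x. lin_fun A (\<phi> x)) \<Longrightarrow> A.bilin \<phi>"
  by (simp add: A.bilin_def)

section \<open>Values of the antipode on the generators\<close>

definition MS where "MS a = M (S a)"

primrec uexp_sum :: "('k, 'a) uexp list \<Rightarrow> ('k, 'a) uexp" where
  "uexp_sum [] = UZero"
| "uexp_sum (p # ps) = UAdd p (uexp_sum ps)"

text \<open>Kept as an expression so that the antipode can be defined by substitution into
  expressions. The three Sweedler legs come from Delta applied to a and then to the second
  leg.\<close>

definition hs_exp :: "'a \<Rightarrow> ('k, 'a) uexp" where
  "hs_exp a = UScal (-1) (uexp_sum (concat (map (\<lambda>(x, b).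
    map (\<lambda>(y, z). UMul (UM (S x)) (UMul (UH y) (UM (S z)))) (\<Delta> b)) (\<Delta> a))))"

definition HS where "HS a = cl (hs_exp a)"

lemma MS_closed [simp]: "MS a \<in> vcar U" and HS_closed [simp]: "HS a \<in> vcar U"
  by (simp_all add: MS_def HS_def)

lemma MS_lin: "MS (x \<boxplus> y) = MS x \<oplus> MS y" "MS (c \<cdot> x) = c *\<^sub>U MS x"
  by (simp_all add: MS_def S_add S_scale MH_lin)

lemma ufun_uexp_sum: "ufun f \<Longrightarrow> f (cl (uexp_sum ps)) = sum_list (map (\<lambda>p. f (cl p)) ps)"
  by (induction ps) (simp_all add: cl_ops ufunD ufun_zero)

lemma ufun_HS:
  assumes f: "ufun f"
  shows "f (HS a) = - tsum (\<lambda>x b. tsum (\<lambda>y z. f (MS x \<otimes> (H y \<otimes> MS z))) (\<Delta> b)) (\<Delta> a)"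
proof -
  have inner: "sum_list (map (\<lambda>p. f (cl p)) (map (\<lambda>(y, z). UMul (UM (S x)) (UMul (UH y) (UM (S z)))) ys))
    = tsum (\<lambda>y z. f (MS x \<otimes> (H y \<otimes> MS z))) ys" for x ys
    by (induction ys) (auto simp: cl_ops MS_def)
  have "sum_list (map (\<lambda>p. f (cl p)) (concat (map (\<lambda>(x, b).
    map (\<lambda>(y, z). UMul (UM (S x)) (UMul (UH y) (UM (S z)))) (\<Delta> b)) xs)))
    = tsum (\<lambda>x b. tsum (\<lambda>y z. f (MS x \<otimes> (H y \<otimes> MS z))) (\<Delta> b)) xs" for xs
  proof (induction xs)
    case (Cons x xs)
    obtain a b where "x = (a, b)" by (cases x)
    then show ?case using Cons by (simp add: inner del: map_map)
  qed simp
  then show ?thesis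
    by (simp add: HS_def hs_exp_def cl_ops(7) ufunD[OF f] ufun_uexp_sum[OF f])
qed

lemma bilin_H_MS: "ufun f \<Longrightarrow> A.bilin (\<lambda>y z. f (H y \<otimes> MS z))"
  and bilin_MS_H: "ufun f \<Longrightarrow> A.bilin (\<lambda>y z. f (MS y \<otimes> H z))"
  and bilin_MS_M: "ufun f \<Longrightarrow> A.bilin (\<lambda>y z. f (MS y \<otimes> M z))"
  by (simp_all add: bilin_A MS_lin MH_lin U_lin ufunD)

lemma HS_lin: "HS (x \<boxplus> y) = HS x \<oplus> HS y" "HS (c \<cdot> x) = c *\<^sub>U HS x"
proof -
  have bil: "A.bilin (\<lambda>x b. tsum (\<lambda>y z. f (MS x \<otimes> (H y \<otimes> MS z))) (\<Delta> b))" if "ufun f" for f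
    using that
    by (intro bilinI lin_fun_tsum_cop lin_fun_tsum) (simp_all add: bilin_A lin_fun_A MS_lin MH_lin U_lin ufunD)
  show "HS (x \<boxplus> y) = HS x \<oplus> HS y"
    by (rule U_eqI) (simp_all add: ufun_HS ufunD tsum_cop_add[OF bil])
  show "HS (c \<cdot> x) = c *\<^sub>U HS x"
    by (rule U_eqI) (simp_all add: ufun_HS ufunD tsum_cop_scale[OF bil])
qed

lemma tsum_MS_M: "ufun f \<Longrightarrow> tsum (\<lambda>a b. f (MS a \<otimes> M b)) (\<Delta> x) = \<epsilon> x * f \<one>"
  and tsum_M_MS: "ufun f \<Longrightarrow> tsum (\<lambda>a b. f (M a \<otimes> MS b)) (\<Delta> x) = \<epsilon> x * f \<one>"
  using tsum_antipode_left[OF ufun_M] tsum_antipode_right[OF ufun_M] by (simp_all add: MS_def M_mul M_one)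

text \<open>Up to sign, the left side is a sum of m(a1) m(S a2) h(a3) m(S a4), whose first two
  factors collapse to a counit. This is the right-hand antipode identity for h_z.\<close>

lemma tsum_M_HS:
  assumes f: "ufun f"
  shows "tsum (\<lambda>a b. f (M a \<otimes> HS b)) (\<Delta> z) = - tsum (\<lambda>a b. f (H a \<otimes> MS b)) (\<Delta> z)"
proof -
  let ?\<psi> = "\<lambda>x s b. tsum (\<lambda>y t. f (M x \<otimes> (MS s \<otimes> (H y \<otimes> MS t)))) (\<Delta> b)"
  have 1: "tsum (\<lambda>a b. f (M a \<otimes> HS b)) (\<Delta> z) = - tsum (\<lambda>x a. tsum (\<lambda>s b. ?\<psi> x s b) (\<Delta> a)) (\<Delta> z)"
    by (simp add: ufun_HS[OF ufun_mul(2)[OF f]] tsum_minus)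
  have "tsum (\<lambda>x a. tsum (\<lambda>s b. ?\<psi> x s b) (\<Delta> a)) (\<Delta> z) = tsum (\<lambda>x b. tsum (\<lambda>u v. ?\<psi> u v b) (\<Delta> x)) (\<Delta> z)"
    using f by (intro tsum_coassoc[symmetric] bilinI lin_fun_tsum_cop lin_fun_tsum)
      (simp_all add: bilin_A lin_fun_A MS_lin MH_lin U_lin ufunD)
  also have "\<dots> = tsum (\<lambda>x b. \<epsilon> x * tsum (\<lambda>y t. f (H y \<otimes> MS t)) (\<Delta> b)) (\<Delta> z)"
  proof (rule tsum_cong)
    fix x b
    have "tsum (\<lambda>u v. ?\<psi> u v b) (\<Delta> x) = tsum (\<lambda>y t. tsum (\<lambda>u v. f ((M u \<otimes> MS v) \<otimes> (H y \<otimes> MS t))) (\<Delta> x)) (\<Delta> b)"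
      by (subst tsum_swap) (simp add: U_mul_assoc)
    also have "\<dots> = tsum (\<lambda>y t. \<epsilon> x * f (\<one> \<otimes> (H y \<otimes> MS t))) (\<Delta> b)"
      by (simp add: tsum_M_MS[OF ufun_mul(1)[OF f]])
    finally show "tsum (\<lambda>u v. ?\<psi> u v b) (\<Delta> x) = \<epsilon> x * tsum (\<lambda>y t. f (H y \<otimes> MS t)) (\<Delta> b)"
      by (simp add: ufun_unit[OF f] tsum_mult_left)
  qed
  also have "\<dots> = tsum (\<lambda>y t. f (H y \<otimes> MS t)) (\<Delta> z)"
    by (rule tsum_counit_left[OF lin_fun_tsum_cop[OF bilin_H_MS[OF f]]])
  finally show ?thesis using 1 by simp
qed

text \<open>The left-hand antipode identity for h_z. Now the last two factors of m(S a1) h(a2) m(S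
  a3) m(a4) have to collapse, and coassociativity is used twice to make a3 and a4 legs of one
  coproduct.\<close>

lemma tsum_HS_M:
  assumes f: "ufun f"
  shows "tsum (\<lambda>a b. f (HS a \<otimes> M b)) (\<Delta> z) = - tsum (\<lambda>a b. f (MS a \<otimes> H b)) (\<Delta> z)"
proof -
  \<comment> \<open>The first two factors are grouped under the coproduct of b, which leaves t and c
    free to become the legs of another one.\<close>
  let ?\<chi> = "\<lambda>b t c. tsum (\<lambda>s y. f (MS s \<otimes> (H y \<otimes> (MS t \<otimes> M c)))) (\<Delta> b)"
  have "f (HS w \<otimes> M c) = - tsum (\<lambda>b t. ?\<chi> b t c) (\<Delta> w)" for w c
  proof -
    have "f (HS w \<otimes> M c) = - tsum (\<lambda>s b. tsum (\<lambda>y t. f (MS s \<otimes> (H y \<otimes> (MS t \<otimes> M c)))) (\<Delta> b)) (\<Delta> w)"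
      by (simp add: ufun_HS[OF ufun_mul(1)[OF f]] U_mul_assoc)
    also have "tsum (\<lambda>s b. tsum (\<lambda>y t. f (MS s \<otimes> (H y \<otimes> (MS t \<otimes> M c)))) (\<Delta> b)) (\<Delta> w) = tsum (\<lambda>b t. ?\<chi> b t c) (\<Delta> w)"
      using f by (intro tsum_coassoc[symmetric]) (simp_all add: bilin_A lin_fun_A MS_lin MH_lin U_lin ufunD)
    finally show ?thesis .
  qed
  then have 1: "tsum (\<lambda>a b. f (HS a \<otimes> M b)) (\<Delta> z) = - tsum (\<lambda>w c. tsum (\<lambda>b t. ?\<chi> b t c) (\<Delta> w)) (\<Delta> z)"
    by (simp add: tsum_minus)
  have "tsum (\<lambda>w c. tsum (\<lambda>b t. ?\<chi> b t c) (\<Delta> w)) (\<Delta> z) = tsum (\<lambda>b w. tsum (\<lambda>t c. ?\<chi> b t c) (\<Delta> w)) (\<Delta> z)"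
    using f by (intro tsum_coassoc bilinI lin_fun_tsum_cop lin_fun_tsum)
      (simp_all add: bilin_A lin_fun_A MS_lin MH_lin U_lin ufunD)
  also have "\<dots> = tsum (\<lambda>b w. tsum (\<lambda>s y. f (MS s \<otimes> H y)) (\<Delta> b) * \<epsilon> w) (\<Delta> z)"
  proof (rule tsum_cong)
    fix b w
    have "tsum (\<lambda>t c. ?\<chi> b t c) (\<Delta> w) = tsum (\<lambda>s y. tsum (\<lambda>t c. f ((MS s \<otimes> H y) \<otimes> (MS t \<otimes> M c))) (\<Delta> w)) (\<Delta> b)"
      by (subst tsum_swap) (simp add: U_mul_assoc)
    also have "\<dots> = tsum (\<lambda>s y. f ((MS s \<otimes> H y) \<otimes> \<one>) * \<epsilon> w) (\<Delta> b)"
      by (simp add: tsum_MS_M[OF ufun_mul(2)[OF f]] mult.commute)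
    finally show "tsum (\<lambda>t c. ?\<chi> b t c) (\<Delta> w) = tsum (\<lambda>s y. f (MS s \<otimes> H y)) (\<Delta> b) * \<epsilon> w"
      by (simp add: ufun_unit[OF f] tsum_mult_right)
  qed
  also have "\<dots> = tsum (\<lambda>s y. f (MS s \<otimes> H y)) (\<Delta> z)"
    by (rule tsum_counit_right[OF lin_fun_tsum_cop[OF bilin_MS_H[OF f]]])
  finally show ?thesis using 1 by simp
qed

definition abil where
  "abil D \<longleftrightarrow> (\<forall>x y z. D (x \<boxplus> y) z = D x z \<oplus> D y z) \<and> (\<forall>c x z. D (c \<cdot> x) z = c *\<^sub>U D x z) \<and>
    (\<forall>x y z. D z (x \<boxplus> y) = D z x \<oplus> D z y) \<and> (\<forall>c x z. D z (c \<cdot> x) = c *\<^sub>U D z x)"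

text \<open>Convolving with m and then with m after S changes nothing: the inserted factor m(a') m(S
  b) collapses to a counit, which the counit axiom absorbs.\<close>

lemma expand_M_MS:
  assumes f: "ufun f" and D: "\<And>x y. D (x \<boxplus> y) = D x \<oplus> D y" "\<And>c x. D (c \<cdot> x) = c *\<^sub>U D x"
  shows "f (D x) = tsum (\<lambda>w b. tsum (\<lambda>a a'. f (D a \<otimes> (M a' \<otimes> MS b))) (\<Delta> w)) (\<Delta> x)"
proof -
  have "tsum (\<lambda>w b. tsum (\<lambda>a a'. f (D a \<otimes> (M a' \<otimes> MS b))) (\<Delta> w)) (\<Delta> x) =
    tsum (\<lambda>a w. tsum (\<lambda>a' b. f (D a \<otimes> (M a' \<otimes> MS b))) (\<Delta> w)) (\<Delta> x)"
    using f by (intro tsum_coassoc) (simp_all add: bilin_A lin_fun_A MS_lin MH_lin U_lin ufunD D)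
  also have "\<dots> = tsum (\<lambda>a w. f (D a) * \<epsilon> w) (\<Delta> x)"
    by (simp add: tsum_M_MS[OF ufun_mul(2)[OF f]] ufun_unit[OF f] mult.commute)
  also have "\<dots> = f (D x)"
    using f by (intro tsum_counit_right) (simp add: lin_fun_A D ufunD)
  finally show ?thesis by simp
qed

text \<open>The map \<open>x \<otimes> y \<mapsto> m\<^sub>x m\<^sub>y\<close> is convolution invertible, hence can be cancelled on the right.\<close>

lemma M_cancel:
  assumes D: "abil D1" "abil D2" "\<And>x y. D1 x y \<in> vcar U" "\<And>x y. D2 x y \<in> vcar U"
    and eq: "\<And>f x y. ufun f \<Longrightarrow> tsum (\<lambda>a b. tsum (\<lambda>c d. f (D1 a c \<otimes> (M b \<otimes> M d))) (\<Delta> y)) (\<Delta> x) =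
      tsum (\<lambda>a b. tsum (\<lambda>c d. f (D2 a c \<otimes> (M b \<otimes> M d))) (\<Delta> y)) (\<Delta> x)"
  shows "D1 x y = D2 x y"
proof (rule U_eqI[OF D(3,4)])
  fix f assume f: "ufun f"
  \<comment> \<open>All \<open>M\<close> and \<open>MS\<close> factors commute, so m(a') m(c') can
    be brought next to \<open>D a c\<close> as in \<open>eq\<close>; the remaining \<open>MS\<close>
    factors are then absorbed into the functional.\<close>
  have arr: "(X \<otimes> (M c' \<otimes> MS d)) \<otimes> (M a' \<otimes> MS b) = (X \<otimes> (M a' \<otimes> M c')) \<otimes> (MS d \<otimes> MS b)" for X a' c' b d
    unfolding MS_def U_mul_assoc M_left_comm[of "S d" a'] M_left_comm[of c' a'] by rule
  \<comment> \<open>Expand in x and then in y. Exchanging the two middle sums brings the legs of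
    both inner coproducts together, which is where \<open>eq\<close> applies.\<close>
  have key: "f (D x y) = tsum (\<lambda>w b. tsum (\<lambda>v d. tsum (\<lambda>a a'. tsum (\<lambda>c c'.
    f ((D a c \<otimes> (M a' \<otimes> M c')) \<otimes> (MS d \<otimes> MS b))) (\<Delta> v)) (\<Delta> w)) (\<Delta> y)) (\<Delta> x)"
    if "abil D" for D
  proof -
    have "f (D x y) = tsum (\<lambda>w b. tsum (\<lambda>a a'. f (D a y \<otimes> (M a' \<otimes> MS b))) (\<Delta> w)) (\<Delta> x)"
      using that by (intro expand_M_MS[where D = "\<lambda>x. D x y"] f) (simp_all add: abil_def)
    also have "\<dots> = tsum (\<lambda>w b. tsum (\<lambda>a a'. tsum (\<lambda>v d. tsum (\<lambda>c c'.
        f ((D a c \<otimes> (M c' \<otimes> MS d)) \<otimes> (M a' \<otimes> MS b))) (\<Delta> v)) (\<Delta> y)) (\<Delta> w)) (\<Delta> x)"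
    proof (intro tsum_cong)
      fix a a' b
      show "f (D a y \<otimes> (M a' \<otimes> MS b)) = tsum (\<lambda>v d. tsum (\<lambda>c c'.
        f ((D a c \<otimes> (M c' \<otimes> MS d)) \<otimes> (M a' \<otimes> MS b))) (\<Delta> v)) (\<Delta> y)"
        using that by (intro expand_M_MS[where D = "\<lambda>y. D a y" and f = "\<lambda>Z. f (Z \<otimes> (M a' \<otimes> MS b))"] ufun_mul f)
          (simp_all add: abil_def)
    qed
    also have "\<dots> = tsum (\<lambda>w b. tsum (\<lambda>v d. tsum (\<lambda>a a'. tsum (\<lambda>c c'.
        f ((D a c \<otimes> (M c' \<otimes> MS d)) \<otimes> (M a' \<otimes> MS b))) (\<Delta> v)) (\<Delta> w)) (\<Delta> y)) (\<Delta> x)"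
      by (intro tsum_cong tsum_swap)
    finally show ?thesis by (simp only: arr)
  qed
  show "f (D1 x y) = f (D2 x y)"
    unfolding key[OF D(1)] key[OF D(2)]
    by (intro tsum_cong eq[of "\<lambda>Z. f (Z \<otimes> (MS _ \<otimes> MS _))"] ufun_mul f)
qed

lemma MS_comm: "MS x \<otimes> MS y = MS y \<otimes> MS x" "MS x \<otimes> M y = M y \<otimes> MS x"
  "MS x \<otimes> (MS y \<otimes> Z) = MS y \<otimes> (MS x \<otimes> Z)" "MS x \<otimes> (M y \<otimes> Z) = M y \<otimes> (MS x \<otimes> Z)"
  unfolding MS_def by (rule M_comm M_left_comm)+

section \<open>The defining relations for the antipode values\<close>

lemma MS_one: "MS (vone A) = \<one>"
proof (rule U_eqI)
  fix f assume f: "ufun f"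
  have "f (MS (vone A)) = f (MS (vone A) \<otimes> M (vone A))" by (simp add: M_one ufun_unit f)
  also have "\<dots> = f \<one>"
    using tsum_cop_one[OF bilin_MS_M[OF f]] tsum_MS_M[OF f, of "vone A"] by (simp add: cou_one)
  finally show "f (MS (vone A)) = f \<one>" .
qed simp_all

text \<open>Convolved with m_x m_y, both sides become eps(x) eps(y) 1: the left by the antipode
  identity at the product, the right by collapsing one pair after the other. The factors are in the
  order expected of an anti-endomorphism.\<close>

lemma MS_mul: "MS (x \<odot> y) = MS y \<otimes> MS x"
proof (rule M_cancel[where ?D1.0 = "\<lambda>x y. MS (x \<odot> y)" and ?D2.0 = "\<lambda>x y. MS y \<otimes> MS x"])
  show "abil (\<lambda>x y. MS (x \<odot> y))" "abil (\<lambda>x y. MS y \<otimes> MS x)"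
    by (simp_all add: abil_def A_lin MS_lin U_lin)
  fix f x y assume f: "ufun f"
  have "tsum (\<lambda>a b. tsum (\<lambda>c d. f (MS (a \<odot> c) \<otimes> (M b \<otimes> M d))) (\<Delta> y)) (\<Delta> x) = tsum (\<lambda>a b. f (MS a \<otimes> M b)) (\<Delta> (x \<odot> y))"
    by (simp add: tsum_cop_mul[OF bilin_MS_M[OF f]] M_mul)
  also have "\<dots> = \<epsilon> x * (\<epsilon> y * f \<one>)" by (simp add: tsum_MS_M f cou_mul)
  also have "\<dots> = tsum (\<lambda>c d. \<epsilon> x * f (MS c \<otimes> (\<one> \<otimes> M d))) (\<Delta> y)"
    by (simp add: tsum_mult_left ufun_unit ufun_mul f U_unit_carrier tsum_MS_M)
  also have "\<dots> = tsum (\<lambda>c d. tsum (\<lambda>a b. f (MS c \<otimes> ((MS a \<otimes> M b) \<otimes> M d))) (\<Delta> x)) (\<Delta> y)"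
    by (simp add: tsum_MS_M[OF ufun_mul(1)[OF ufun_mul(2)[OF f]]])
  also have "\<dots> = tsum (\<lambda>a b. tsum (\<lambda>c d. f ((MS c \<otimes> MS a) \<otimes> (M b \<otimes> M d))) (\<Delta> y)) (\<Delta> x)"
    by (subst tsum_swap) (simp add: U_mul_assoc)
  finally show "tsum (\<lambda>a b. tsum (\<lambda>c d. f (MS (a \<odot> c) \<otimes> (M b \<otimes> M d))) (\<Delta> y)) (\<Delta> x) =
    tsum (\<lambda>a b. tsum (\<lambda>c d. f ((MS c \<otimes> MS a) \<otimes> (M b \<otimes> M d))) (\<Delta> y)) (\<Delta> x)" .
qed simp_all

lemma U_add_left_comm: "X \<oplus> (Y \<oplus> Z) = Y \<oplus> (X \<oplus> Z)"
  by (metis U_add_assoc U_add_comm)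

lemmas U_add_ac = U_add_assoc U_add_comm U_add_left_comm

definition sum2 :: "('a \<Rightarrow> 'a \<Rightarrow> 'a \<Rightarrow> 'a \<Rightarrow> 'k) \<Rightarrow> 'a \<Rightarrow> 'a \<Rightarrow> 'k" where
  "sum2 F x y = tsum (\<lambda>a b. tsum (\<lambda>c d. F a b c d) (\<Delta> y)) (\<Delta> x)"

lemma sum2_swap: "sum2 F x y = tsum (\<lambda>c d. tsum (\<lambda>a b. F a b c d) (\<Delta> x)) (\<Delta> y)"
  unfolding sum2_def by (rule tsum_swap)

lemma sum2_add: "sum2 (\<lambda>a b c d. F a b c d + G a b c d) x y = sum2 F x y + sum2 G x y"
  and sum2_diff: "sum2 (\<lambda>a b c d. F a b c d - G a b c d) x y = sum2 F x y - sum2 G x y"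
  by (simp_all add: sum2_def tsum_add tsum_diff)

lemma tsum_MS_M_context:
  assumes f: "ufun f"
  shows "tsum (\<lambda>a b. f (X \<otimes> (MS a \<otimes> M b))) (\<Delta> x) = \<epsilon> x * f X"
    "tsum (\<lambda>a b. f (MS a \<otimes> (M b \<otimes> Y))) (\<Delta> x) = \<epsilon> x * f Y"
    "tsum (\<lambda>a b. f (X \<otimes> (MS a \<otimes> (M b \<otimes> Y)))) (\<Delta> x) = \<epsilon> x * f (X \<otimes> Y)"
  using tsum_MS_M[OF ufun_mul(2)[OF f], of X x] tsum_MS_M[OF ufun_mul(1)[OF f], of Y x]
    tsum_MS_M[OF ufun_mul(1)[OF ufun_mul(2)[OF f]], of X Y x]
  by (simp_all add: U_mul_assoc ufun_unit[OF f] ufun_unit[OF ufun_mul(2)[OF f]])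

lemma tsum_HS_M_context:
  assumes f: "ufun f"
  shows "tsum (\<lambda>a b. f (X \<otimes> (HS a \<otimes> (M b \<otimes> Y)))) (\<Delta> x) = - tsum (\<lambda>a b. f (X \<otimes> (MS a \<otimes> (H b \<otimes> Y)))) (\<Delta> x)"
  using tsum_HS_M[OF ufun_mul(1)[OF ufun_mul(2)[OF f]], of X Y x] by (simp add: U_mul_assoc)

text \<open>The antipode identity for h at the product of x and y expresses the convolution of the
  left side with m through \<open>MS\<close> and \<open>H\<close>. In each resulting term one pair
  m(S c) m(d) or m(S a) m(b) collapses, and the convolution of the right side collapses to the same
  expression.\<close>

lemma HS_mul: "HS (x \<odot> y) = HS x \<otimes> MS y \<oplus> HS y \<otimes> MS x"
proof (rule M_cancel[where ?D1.0 = "\<lambda>x y. HS (x \<odot> y)" and ?D2.0 = "\<lambda>x y. HS x \<otimes> MS y \<oplus> HS y \<otimes> MS x"])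
  show "abil (\<lambda>x y. HS (x \<odot> y))"
    by (simp add: abil_def A_lin HS_lin)
  show "abil (\<lambda>x y. HS x \<otimes> MS y \<oplus> HS y \<otimes> MS x)"
    by (simp add: abil_def MS_lin HS_lin U_lin U_scale_add U_add_ac)
  fix f x y assume f: "ufun f"
  have bil: "A.bilin (\<lambda>u v. f (HS u \<otimes> M v) + f (MS u \<otimes> H v))"
    using f by (simp add: bilin_A HS_lin MS_lin MH_lin U_lin ufunD algebra_simps)
  have "0 = tsum (\<lambda>u v. f (HS u \<otimes> M v) + f (MS u \<otimes> H v)) (\<Delta> (x \<odot> y))"
    by (simp add: tsum_add tsum_HS_M f)
  also have "\<dots> = sum2 (\<lambda>a b c d. f (HS (a \<odot> c) \<otimes> (M b \<otimes> M d)) +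
      (f (MS c \<otimes> (M d \<otimes> (MS a \<otimes> H b))) + f (MS c \<otimes> (MS a \<otimes> (M b \<otimes> H d))))) x y"
    by (simp add: tsum_cop_mul[OF bil] sum2_def M_mul H_mul MS_mul U_lin U_mul_assoc ufunD[OF f] MS_comm)
  finally have 1: "sum2 (\<lambda>a b c d. f (HS (a \<odot> c) \<otimes> (M b \<otimes> M d))) x y =
    - (sum2 (\<lambda>a b c d. f (MS c \<otimes> (M d \<otimes> (MS a \<otimes> H b)))) x y + sum2 (\<lambda>a b c d. f (MS c \<otimes> (MS a \<otimes> (M b \<otimes> H d)))) x y)"
    by (simp add: sum2_add add_eq_0_iff)
  have "sum2 (\<lambda>a b c d. f ((HS a \<otimes> MS c \<oplus> HS c \<otimes> MS a) \<otimes> (M b \<otimes> M d))) x y =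
    sum2 (\<lambda>a b c d. f ((HS a \<otimes> M b) \<otimes> (MS c \<otimes> M d))) x y + sum2 (\<lambda>a b c d. f (HS c \<otimes> (MS a \<otimes> (M b \<otimes> M d)))) x y"
    by (simp add: U_lin ufunD[OF f] U_mul_assoc MS_comm sum2_add)
  also have "\<dots> = \<epsilon> y * tsum (\<lambda>a b. f (HS a \<otimes> M b)) (\<Delta> x) + \<epsilon> x * tsum (\<lambda>c d. f (HS c \<otimes> M d)) (\<Delta> y)"
    by (simp add: sum2_def[of "\<lambda>a b c d. f ((HS a \<otimes> M b) \<otimes> (MS c \<otimes> M d))"]
        sum2_swap[of "\<lambda>a b c d. f (HS c \<otimes> (MS a \<otimes> (M b \<otimes> M d)))"] tsum_MS_M_context f tsum_mult_left)
  also have "\<dots> = - (\<epsilon> y * tsum (\<lambda>a b. f (MS a \<otimes> H b)) (\<Delta> x) + \<epsilon> x * tsum (\<lambda>c d. f (MS c \<otimes> H d)) (\<Delta> y))"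
    by (simp add: tsum_HS_M f)
  also have "\<dots> = sum2 (\<lambda>a b c d. f (HS (a \<odot> c) \<otimes> (M b \<otimes> M d))) x y"
    unfolding 1 sum2_def[of "\<lambda>a b c d. f (MS c \<otimes> (M d \<otimes> (MS a \<otimes> H b)))"]
      sum2_swap[of "\<lambda>a b c d. f (MS c \<otimes> (MS a \<otimes> (M b \<otimes> H d)))"]
    by (simp add: tsum_MS_M_context f tsum_mult_left)
  finally show "tsum (\<lambda>a b. tsum (\<lambda>c d. f (HS (a \<odot> c) \<otimes> (M b \<otimes> M d))) (\<Delta> y)) (\<Delta> x) =
    tsum (\<lambda>a b. tsum (\<lambda>c d. f ((HS a \<otimes> MS c \<oplus> HS c \<otimes> MS a) \<otimes> (M b \<otimes> M d))) (\<Delta> y)) (\<Delta> x)"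
    by (simp add: sum2_def)
qed simp_all

text \<open>The counit kills brackets, so \<open>MS\<close> convolved with \<open>M\<close> vanishes
  at {x,y}. Expanding Delta of the bracket, and m of the bracket {b,d} as a commutator of h and m,
  isolates the convolution of the left side.\<close>

lemma MS_br: "MS (br x y) = MS y \<otimes> HS x \<oplus> (-1) *\<^sub>U (HS x \<otimes> MS y)"
proof (rule M_cancel[where ?D1.0 = "\<lambda>x y. MS (br x y)" and ?D2.0 = "\<lambda>x y. MS y \<otimes> HS x \<oplus> (-1) *\<^sub>U (HS x \<otimes> MS y)"])
  show "abil (\<lambda>x y. MS (br x y))"
    by (simp add: abil_def A_lin MS_lin)
  show "abil (\<lambda>x y. MS y \<otimes> HS x \<oplus> (-1) *\<^sub>U (HS x \<otimes> MS y))"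
    by (simp add: abil_def MS_lin HS_lin U_lin U_scale_add U_scale_scale U_add_ac)
  fix f x y assume f: "ufun f"
  have "0 = tsum (\<lambda>u v. f (MS u \<otimes> M v)) (\<Delta> (br x y))"
    by (simp add: tsum_MS_M f cou_br)
  also have "\<dots> = sum2 (\<lambda>a b c d. f (MS (br a c) \<otimes> (M b \<otimes> M d)) +
      (f (MS c \<otimes> (MS a \<otimes> (H b \<otimes> M d))) - f (MS c \<otimes> (M d \<otimes> (MS a \<otimes> H b))))) x y"
    unfolding tsum_cop_br[OF bilin_MS_M[OF f]] sum2_def by (simp add: M_mul M_br MS_mul U_lin U_mul_assoc ufunD[OF f] MS_comm)
  finally have 1: "sum2 (\<lambda>a b c d. f (MS (br a c) \<otimes> (M b \<otimes> M d))) x y =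
    sum2 (\<lambda>a b c d. f (MS c \<otimes> (M d \<otimes> (MS a \<otimes> H b)))) x y - sum2 (\<lambda>a b c d. f (MS c \<otimes> (MS a \<otimes> (H b \<otimes> M d)))) x y"
    by (simp add: sum2_add sum2_diff algebra_simps)
  have "sum2 (\<lambda>a b c d. f ((MS c \<otimes> HS a \<oplus> (-1) *\<^sub>U (HS a \<otimes> MS c)) \<otimes> (M b \<otimes> M d))) x y =
    sum2 (\<lambda>a b c d. f (MS c \<otimes> (HS a \<otimes> (M b \<otimes> M d)))) x y - sum2 (\<lambda>a b c d. f ((HS a \<otimes> M b) \<otimes> (MS c \<otimes> M d))) x y"
    by (simp add: U_lin ufunD[OF f] U_mul_assoc MS_comm sum2_diff)
  also have "\<dots> = - sum2 (\<lambda>a b c d. f (MS c \<otimes> (MS a \<otimes> (H b \<otimes> M d)))) x y - \<epsilon> y * tsum (\<lambda>a b. f (HS a \<otimes> M b)) (\<Delta> x)"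
    by (simp add: sum2_def[of "\<lambda>a b c d. f ((HS a \<otimes> M b) \<otimes> (MS c \<otimes> M d))"]
        sum2_swap[of "\<lambda>a b c d. f (MS c \<otimes> (HS a \<otimes> (M b \<otimes> M d)))"] sum2_swap[of "\<lambda>a b c d. f (MS c \<otimes> (MS a \<otimes> (H b \<otimes> M d)))"]
        tsum_MS_M_context tsum_HS_M_context f tsum_mult_left tsum_minus)
  also have "\<dots> = sum2 (\<lambda>a b c d. f (MS (br a c) \<otimes> (M b \<otimes> M d))) x y"
    unfolding 1 sum2_def[of "\<lambda>a b c d. f (MS c \<otimes> (M d \<otimes> (MS a \<otimes> H b)))"]
    by (simp add: tsum_MS_M_context f tsum_mult_left tsum_HS_M)
  finally show "tsum (\<lambda>a b. tsum (\<lambda>c d. f (MS (br a c) \<otimes> (M b \<otimes> M d))) (\<Delta> y)) (\<Delta> x) =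
    tsum (\<lambda>a b. tsum (\<lambda>c d. f ((MS c \<otimes> HS a \<oplus> (-1) *\<^sub>U (HS a \<otimes> MS c)) \<otimes> (M b \<otimes> M d))) (\<Delta> y)) (\<Delta> x)"
    by (simp add: sum2_def)
qed simp_all

lemma U_sub_move:
  assumes "X = Y \<oplus> (-1) *\<^sub>U Z" "Y \<in> vcar U"
  shows "Y = Z \<oplus> X"
proof -
  have "Z \<oplus> X = Y \<oplus> (Z \<oplus> (-1) *\<^sub>U Z)" unfolding assms(1) by (rule U_add_ac)
  then show ?thesis using assms(2) by (simp add: U_add_inverse)
qed

lemma H_M_comm: "H a \<otimes> M c = M c \<otimes> H a \<oplus> M (br a c)"
  by (rule U_sub_move[OF M_br]) simp

lemma MS_HS_comm: "MS c \<otimes> HS a = HS a \<otimes> MS c \<oplus> MS (br a c)"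
  by (rule U_sub_move[OF MS_br]) simp

text \<open>The bracket terms on the left are commutation corrections: moving \<open>MS\<close> past
  \<open>HS\<close> yields \<open>MS\<close> of a bracket, and moving \<open>H\<close> past
  \<open>M\<close> yields \<open>M\<close> of a bracket. The right side changes sign when (a, b) and
  (c, d) are exchanged, as expected of a commutator.\<close>

lemma HS_br_summand:
  assumes f: "ufun f"
  shows "f (MS (br a c) \<otimes> H (b \<odot> d)) + (f (HS (a \<odot> c) \<otimes> M (br b d)) + f (MS (a \<odot> c) \<otimes> H (br b d))) =
    (f (MS c \<otimes> (HS a \<otimes> (M b \<otimes> H d))) + f (HS c \<otimes> (MS a \<otimes> (H b \<otimes> M d))) + f (MS c \<otimes> (MS a \<otimes> (H b \<otimes> H d)))) -
    (f (HS a \<otimes> (MS c \<otimes> (H d \<otimes> M b))) + f (MS a \<otimes> (HS c \<otimes> (M d \<otimes> H b))) + f (MS a \<otimes> (MS c \<otimes> (H d \<otimes> H b))))"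
proof -
  have comm': "MS c \<otimes> (HS a \<otimes> Z) = HS a \<otimes> (MS c \<otimes> Z) \<oplus> MS (br a c) \<otimes> Z" for a c Z
    by (simp add: MS_HS_comm U_lin flip: U_mul_assoc)
  have anti: "br c a = (-1) \<cdot> br a c" "br d b = (-1) \<cdot> br b d" by (rule br_anti)+
  show ?thesis
    by (simp add: comm' MS_HS_comm H_M_comm HS_mul MS_mul H_mul H_br U_lin U_mul_assoc ufunD[OF f] anti MS_lin MH_lin
        MS_comm(3)[of c a] algebra_simps)
qed

text \<open>The antipode identity for h at {x,y}, rearranged by \<open>HS_br_summand\<close>,
  contains two groups of three sums. In each group, replacing \<open>HS\<close> paired with
  \<open>M\<close> by minus \<open>MS\<close> paired with \<open>H\<close> cancels the term with two
  \<open>MS\<close> and two \<open>H\<close>. The two surviving sums are those obtained from the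
  commutator on the right.\<close>

lemma HS_br: "HS (br x y) = HS y \<otimes> HS x \<oplus> (-1) *\<^sub>U (HS x \<otimes> HS y)"
proof (rule M_cancel[where ?D1.0 = "\<lambda>x y. HS (br x y)" and ?D2.0 = "\<lambda>x y. HS y \<otimes> HS x \<oplus> (-1) *\<^sub>U (HS x \<otimes> HS y)"])
  show "abil (\<lambda>x y. HS (br x y))"
    by (simp add: abil_def A_lin HS_lin)
  show "abil (\<lambda>x y. HS y \<otimes> HS x \<oplus> (-1) *\<^sub>U (HS x \<otimes> HS y))"
    by (simp add: abil_def HS_lin U_lin U_scale_add U_scale_scale U_add_ac)
  fix f x y assume f: "ufun f"
  have bil: "A.bilin (\<lambda>u v. f (HS u \<otimes> M v) + f (MS u \<otimes> H v))"
    using f by (simp add: bilin_A HS_lin MS_lin MH_lin U_lin ufunD algebra_simps)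
  have "0 = tsum (\<lambda>u v. f (HS u \<otimes> M v) + f (MS u \<otimes> H v)) (\<Delta> (br x y))"
    by (simp add: tsum_add tsum_HS_M f)
  also have "\<dots> = sum2 (\<lambda>a b c d. f (HS (br a c) \<otimes> (M b \<otimes> M d)) +
     (f (MS (br a c) \<otimes> H (b \<odot> d)) + (f (HS (a \<odot> c) \<otimes> M (br b d)) + f (MS (a \<odot> c) \<otimes> H (br b d))))) x y"
    by (simp add: tsum_cop_br[OF bil] sum2_def M_mul add.assoc)
  also have "\<dots> = sum2 (\<lambda>a b c d. f (HS (br a c) \<otimes> (M b \<otimes> M d))) x y +
    ((sum2 (\<lambda>a b c d. f (MS c \<otimes> (HS a \<otimes> (M b \<otimes> H d)))) x y + sum2 (\<lambda>a b c d. f (HS c \<otimes> (MS a \<otimes> (H b \<otimes> M d)))) x y +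
      sum2 (\<lambda>a b c d. f (MS c \<otimes> (MS a \<otimes> (H b \<otimes> H d)))) x y) -
    (sum2 (\<lambda>a b c d. f (HS a \<otimes> (MS c \<otimes> (H d \<otimes> M b)))) x y + sum2 (\<lambda>a b c d. f (MS a \<otimes> (HS c \<otimes> (M d \<otimes> H b)))) x y +
      sum2 (\<lambda>a b c d. f (MS a \<otimes> (MS c \<otimes> (H d \<otimes> H b)))) x y))"
    unfolding HS_br_summand[OF f] by (simp add: sum2_add sum2_diff)
  also have "sum2 (\<lambda>a b c d. f (MS c \<otimes> (HS a \<otimes> (M b \<otimes> H d)))) x y = - sum2 (\<lambda>a b c d. f (MS c \<otimes> (MS a \<otimes> (H b \<otimes> H d)))) x y"
    unfolding sum2_swap by (simp add: tsum_HS_M_context f tsum_minus)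
  also have "sum2 (\<lambda>a b c d. f (MS a \<otimes> (HS c \<otimes> (M d \<otimes> H b)))) x y = - sum2 (\<lambda>a b c d. f (MS a \<otimes> (MS c \<otimes> (H d \<otimes> H b)))) x y"
    unfolding sum2_def by (simp add: tsum_HS_M_context f tsum_minus)
  finally have 1: "sum2 (\<lambda>a b c d. f (HS (br a c) \<otimes> (M b \<otimes> M d))) x y =
    sum2 (\<lambda>a b c d. f (HS a \<otimes> (MS c \<otimes> (H d \<otimes> M b)))) x y - sum2 (\<lambda>a b c d. f (HS c \<otimes> (MS a \<otimes> (H b \<otimes> M d)))) x y"
    by (simp add: algebra_simps)
  \<comment> \<open>The commuting factors m_b and m_d are ordered so that in each product the inner
    \<open>HS\<close> is followed by the \<open>M\<close> from the same coproduct.\<close>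
  have "sum2 (\<lambda>a b c d. f ((HS c \<otimes> HS a \<oplus> (-1) *\<^sub>U (HS a \<otimes> HS c)) \<otimes> (M b \<otimes> M d))) x y =
    sum2 (\<lambda>a b c d. f (HS c \<otimes> (HS a \<otimes> (M b \<otimes> M d)))) x y - sum2 (\<lambda>a b c d. f (HS a \<otimes> (HS c \<otimes> (M d \<otimes> M b)))) x y"
    by (simp add: U_lin ufunD[OF f] U_mul_assoc M_comm sum2_diff)
  also have "sum2 (\<lambda>a b c d. f (HS c \<otimes> (HS a \<otimes> (M b \<otimes> M d)))) x y = - sum2 (\<lambda>a b c d. f (HS c \<otimes> (MS a \<otimes> (H b \<otimes> M d)))) x y"
    unfolding sum2_swap by (simp add: tsum_HS_M_context f tsum_minus)
  also have "sum2 (\<lambda>a b c d. f (HS a \<otimes> (HS c \<otimes> (M d \<otimes> M b)))) x y = - sum2 (\<lambda>a b c d. f (HS a \<otimes> (MS c \<otimes> (H d \<otimes> M b)))) x y"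
    unfolding sum2_def by (simp add: tsum_HS_M_context f tsum_minus)
  finally show "tsum (\<lambda>a b. tsum (\<lambda>c d. f (HS (br a c) \<otimes> (M b \<otimes> M d))) (\<Delta> y)) (\<Delta> x) =
    tsum (\<lambda>a b. tsum (\<lambda>c d. f ((HS c \<otimes> HS a \<oplus> (-1) *\<^sub>U (HS a \<otimes> HS c)) \<otimes> (M b \<otimes> M d))) (\<Delta> y)) (\<Delta> x)"
    using 1 by (simp add: sum2_def)
qed simp_all

section \<open>The antipode as an anti-endomorphism of U(A)\<close>

primrec us :: "('k, 'a) uexp \<Rightarrow> ('k, 'a) uexp" where
  "us (UM a) = UM (S a)"
| "us (UH a) = hs_exp a"
| "us UZero = UZero"
| "us UOne = UOne"
| "us (UAdd p q) = UAdd (us p) (us q)"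
| "us (UMul p q) = UMul (us q) (us p)"
| "us (UScal c p) = UScal c (us p)"

lemma cl_us: "cl (us (UM a)) = MS a" "cl (us (UH a)) = HS a"
  by (simp_all add: MS_def mU_def HS_def)

text \<open>In the opposite algebra, \<open>MS\<close> and \<open>HS\<close> satisfy the defining
  relations of m and h.\<close>

lemma us_respects: "ueq A br p q \<Longrightarrow> cl (us p) = cl (us q)"
proof (induction rule: ueq.induct)
  case (rel_mm x y)
  show ?case by (simp only: us.simps(5-7) cl_ops cl_us MS_mul)
next
  case (rel_hbr x y)
  show ?case by (simp only: usub_def us.simps(5-7) cl_ops cl_us HS_br)
next
  case (rel_hm x y)
  show ?case by (simp only: us.simps(5-7) cl_ops cl_us HS_mul)
next
  case (rel_mbr x y)
  show ?case by (simp only: usub_def us.simps(5-7) cl_ops cl_us MS_br)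
next
  case rel_one
  show ?case by (simp only: us.simps(3,4) cl_ops cl_us MS_one)
next
  case (m_add a b)
  show ?case by (simp only: us.simps(5-7) cl_ops cl_us MS_lin)
next
  case (m_scal c a)
  show ?case by (simp only: us.simps(5-7) cl_ops cl_us MS_lin)
next
  case (h_add a b)
  show ?case by (simp only: us.simps(5-7) cl_ops cl_us HS_lin)
next
  case (h_scal c a)
  show ?case by (simp only: us.simps(5-7) cl_ops cl_us HS_lin)
next
  case (add_comm p q)
  show ?case unfolding us.simps cl_ops by (rule U_add_comm)
qed (simp_all add: cl_ops(3-7) U_add_assoc U_unit U_scale_add U_scale_plus U_scale_scale U_add_inverse U_mul_assoc U_lin)

definition SU where "SU X = cl (us (urep X))"

lemma SU_cl: "SU (cl p) = cl (us p)"
  unfolding SU_def by (rule us_respects[OF ueq_urep])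

lemma SU_simps: "SU (X \<oplus> Y) = SU X \<oplus> SU Y" "SU (c *\<^sub>U X) = c *\<^sub>U SU X" "SU (X \<otimes> Y) = SU Y \<otimes> SU X"
  "SU \<one> = \<one>" "SU (M a) = MS a" "SU (H a) = HS a"
  unfolding U_simps(3-6) mU_def H_def SU_cl by (simp_all add: SU_def MS_def mU_def HS_def)

lemma SU_closed [simp]: "SU X \<in> vcar U"
  by (simp add: SU_def)

text \<open>On generators these are the convolution identities for \<open>MS\<close> and
  \<open>HS\<close>. The antipode reverses products, so in SU(Y1) SU(X1) X2 Y2 the inner pair
  collapses first and the outer pair becomes adjacent.\<close>

lemma DU_antipode:
  assumes "Z \<in> vcar U" "ufun f"
  shows "DU (\<lambda>X Y. f (SU X \<otimes> Y)) Z = cou U Z * f \<one>" "DU (\<lambda>X Y. f (X \<otimes> SU Y)) Z = cou U Z * f \<one>"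
proof -
  have bil: "ubil (\<lambda>X Y. f (SU X \<otimes> Y))" "ubil (\<lambda>X Y. f (X \<otimes> SU Y))" if "ufun f" for f
    using that by (simp_all add: ubil_def ufun_def SU_simps U_lin)
  note ufun_ctx = ufun_mul(1)[OF ufun_mul(2)]
  have "\<forall>f. ufun f \<longrightarrow> DU (\<lambda>X Y. f (SU X \<otimes> Y)) Z = cou U Z * f \<one> \<and> DU (\<lambda>X Y. f (X \<otimes> SU Y)) Z = cou U Z * f \<one>"
    using assms(1)
  proof (induction rule: U_induct)
    case (M a)
    show ?case by (simp add: DU_simps bil SU_simps cou_U tsum_MS_M tsum_M_MS)
  next
    case (H a)
    show ?case by (simp add: DU_simps bil SU_simps cou_U tsum_add tsum_HS_M tsum_M_HS)
  next
    case (mul X Y)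
    have "DU (\<lambda>X Y. f (SU X \<otimes> Y)) (X \<otimes> Y) = cou U (X \<otimes> Y) * f \<one>"
      "DU (\<lambda>X Y. f (X \<otimes> SU Y)) (X \<otimes> Y) = cou U (X \<otimes> Y) * f \<one>" if f: "ufun f" for f
    proof -
      \<comment> \<open>The hypotheses are used for f with fixed factors on both sides, the position
        in which the inner pair occurs.\<close>
      have IH: "DU (\<lambda>X1 X2. f (W \<otimes> ((SU X1 \<otimes> X2) \<otimes> Z))) X = cou U X * f (W \<otimes> (\<one> \<otimes> Z))"
        "DU (\<lambda>Y1 Y2. f (W \<otimes> ((Y1 \<otimes> SU Y2) \<otimes> Z))) Y = cou U Y * f (W \<otimes> (\<one> \<otimes> Z))" for W Z
        using mul.IH(1)[rule_format, OF ufun_ctx[OF f]] mul.IH(2)[rule_format, OF ufun_ctx[OF f]] by auto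
      have IH': "DU (\<lambda>Y1 Y2. f (SU Y1 \<otimes> Y2)) Y = cou U Y * f \<one>" "DU (\<lambda>X1 X2. f (X1 \<otimes> SU X2)) X = cou U X * f \<one>"
        using mul.IH f by auto
      have "DU (\<lambda>X Y. f (SU X \<otimes> Y)) (X \<otimes> Y) = DU (\<lambda>Y1 Y2. DU (\<lambda>X1 X2. f (SU Y1 \<otimes> ((SU X1 \<otimes> X2) \<otimes> Y2))) X) Y"
        unfolding DU_simps(3)[OF bil(1)[OF f]] by (subst tsum_swap) (simp add: SU_simps U_mul_assoc)
      also have "\<dots> = cou U X * DU (\<lambda>Y1 Y2. f (SU Y1 \<otimes> Y2)) Y"
        unfolding IH by (simp add: tsum_mult_left ufun_unit(1)[OF ufun_mul(2)[OF f]])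
      finally show "DU (\<lambda>X Y. f (SU X \<otimes> Y)) (X \<otimes> Y) = cou U (X \<otimes> Y) * f \<one>"
        using IH' by (simp add: cou_U)
      have "DU (\<lambda>X Y. f (X \<otimes> SU Y)) (X \<otimes> Y) = DU (\<lambda>X1 X2. DU (\<lambda>Y1 Y2. f (X1 \<otimes> ((Y1 \<otimes> SU Y2) \<otimes> SU X2))) Y) X"
        unfolding DU_simps(3)[OF bil(2)[OF f]] by (simp add: SU_simps U_mul_assoc)
      also have "\<dots> = cou U Y * DU (\<lambda>X1 X2. f (X1 \<otimes> SU X2)) X"
        unfolding IH by (simp add: tsum_mult_left ufun_unit(1)[OF ufun_mul(2)[OF f]])
      finally show "DU (\<lambda>X Y. f (X \<otimes> SU Y)) (X \<otimes> Y) = cou U (X \<otimes> Y) * f \<one>"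
        using IH' by (simp add: cou_U)
    qed
    then show ?case by blast
  next
    case zero
    show ?case unfolding U_add_inverse[of \<one>, symmetric] by (simp add: DU_simps bil cou_U SU_simps)
  qed (simp_all add: DU_simps bil cou_U ufun_unit SU_simps algebra_simps)
  then show "DU (\<lambda>X Y. f (SU X \<otimes> Y)) Z = cou U Z * f \<one>" "DU (\<lambda>X Y. f (X \<otimes> SU Y)) Z = cou U Z * f \<one>"
    using assms(2) by blast+
qed

lemma antipode_SU: "antipode U SU"
  unfolding antipode_def
proof (intro conjI ballI allI)
  fix X assume X: "X \<in> vcar U"
  show "vsum U (map (\<lambda>(x1, x2). SU x1 \<otimes> x2) (cop U X)) = cou U X *\<^sub>U \<one>"
    by (rule U_eqI[OF U.vsum_closed])
       (use X in \<open>auto simp: U.lin_fun_vsum_map ufun_imp_lin_fun ufunD DU_antipode\<close>)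
  show "vsum U (map (\<lambda>(x1, x2). x1 \<otimes> SU x2) (cop U X)) = cou U X *\<^sub>U \<one>"
    by (rule U_eqI[OF U.vsum_closed])
       (use X in \<open>auto simp: U.lin_fun_vsum_map ufun_imp_lin_fun ufunD DU_antipode\<close>)
qed (simp_all add: SU_simps)

lemma hopf_U: "is_hopf U"
  using bialg_U antipode_SU by (auto simp: is_hopf_def)

section \<open>Group-likes and the coradical\<close>

lemma br_mul_right: "br x (y \<odot> z) = (y \<odot> br x z) \<boxplus> (br x y \<odot> z)"
  unfolding br_anti[of x "y \<odot> z"] br_anti[of x z] br_anti[of x y] br_mul
  by (simp add: mulA_scale A.scale_add carrier_UNIV)

lemma br_br: "br (br x y) z = br x (br y z) \<boxplus> (-1) \<cdot> br y (br x z)"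
proof -
  have "br y (br z x) = (-1) \<cdot> br y (br x z)" "br z (br x y) = (-1) \<cdot> br (br x y) z"
    using br_anti[of z x] br_anti[of z "br x y"] by (simp_all add: br_scale)
  then have "(br x (br y z) \<boxplus> (-1) \<cdot> br y (br x z)) \<boxplus> (-1) \<cdot> br (br x y) z = vzero A"
    using br_jacobi[of x y z] by (simp add: A.add_assoc carrier_UNIV)
  then show ?thesis using A.add_eq_zero_imp carrier_UNIV by (metis UNIV_I)
qed

primrec act :: "('k, 'a) uexp \<Rightarrow> 'a \<Rightarrow> 'a" where
  "act (UM a) z = a \<odot> z"
| "act (UH a) z = br a z"
| "act UZero z = vzero A"
| "act UOne z = z"
| "act (UAdd p q) z = act p z \<boxplus> act q z"
| "act (UMul p q) z = act p (act q z)"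
| "act (UScal c p) z = c \<cdot> act p z"

lemma A_ac: "(x \<boxplus> y) \<boxplus> z = x \<boxplus> (y \<boxplus> z)" "x \<boxplus> y = y \<boxplus> x" "x \<boxplus> (y \<boxplus> z) = y \<boxplus> (x \<boxplus> z)"
  using A.add_assoc A.add_comm A.add_left_comm by (simp_all add: carrier_UNIV)

lemma act_lin: "act p (x \<boxplus> y) = act p x \<boxplus> act p y \<and> act p (c \<cdot> x) = c \<cdot> act p x"
proof (induction p arbitrary: x y c)
  case (UAdd p q)
  then show ?case by (simp add: A_ac A.scale_add carrier_UNIV)
next
  case (UScal d p)
  then show ?case by (simp add: A.scale_add A.scale_scale carrier_UNIV mult.commute)
qed (simp_all add: A_lin carrier_UNIV)

text \<open>The relation for h of a bracket becomes the Jacobi identity; those for h of a product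
  and m of a bracket become the Leibniz rule in the first and in the second argument.\<close>

lemma act_respects: "ueq A br p q \<Longrightarrow> act p z = act q z"
proof (induction arbitrary: z rule: ueq.induct)
  case (rel_hbr x y)
  then show ?case by (simp add: usub_def br_br)
next
  case (rel_hm x y)
  then show ?case by (simp add: br_mul mulA_comm A_ac)
next
  case (rel_mbr x y)
  have "(-1) \<cdot> w \<boxplus> (w \<boxplus> v) = v" for w v
    by (simp add: carrier_UNIV A.add_inverse A_ac(2)[of "(-1) \<cdot> w"] flip: A_ac(1))
  then show ?case by (simp add: usub_def br_mul_right A_ac(2)[of _ "(-1) \<cdot> _"])
next
  case (add_comm p q)
  then show ?case by (simp add: A_ac)
next
  case (add_assoc p q r)
  then show ?case by (simp add: A_ac)
qed (simp_all add: act_lin A_lin carrier_UNIV A.add_inverse A.scale_add A.scale_plus A.scale_scale mulA_assoc)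

definition ret where "ret X = act (urep X) (vone A)"

lemma ret_simps: "ret (X \<oplus> Y) = ret X \<boxplus> ret Y" "ret (c *\<^sub>U X) = c \<cdot> ret X" "ret (M a) = a"
proof -
  have cl: "ret (cl p) = act p (vone A)" for p
    unfolding ret_def by (rule act_respects[OF ueq_urep])
  show "ret (X \<oplus> Y) = ret X \<boxplus> ret Y" "ret (c *\<^sub>U X) = c \<cdot> ret X" "ret (M a) = a"
    unfolding U_simps(4,6) mU_def cl by (simp_all add: ret_def)
qed

lemma inj_M: "inj M"
  by (rule inj_on_inverseI[where g = ret]) (rule ret_simps)

lemma ufun_ret: "lin_fun A f \<Longrightarrow> ufun (\<lambda>X. f (ret X))"
  by (simp add: ufun_def lin_fun_A ret_simps)

lemma M_zero: "M (vzero A) = vzero U"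
  using M_scale[of 0 "vone A"] by (simp add: carrier_UNIV)

lemma M_teq:
  assumes "teq A (\<Delta> a) ys"
  shows "teq U (cop U (M a)) (map (\<lambda>(x, y). (M x, M y)) ys)"
proof (rule teq_UI[OF cop_U_closed])
  fix f g assume "ufun f" "ufun g"
  then show "DU (\<lambda>X Y. f X * g Y) (M a) = tsum (\<lambda>X Y. f X * g Y) (map (\<lambda>(x, y). (M x, M y)) ys)"
    using assms ufun_M by (simp add: DU_simps ubil_prod tsum_map teq_def tpair_eq_tsum)
qed auto

text \<open>Functionals on A composed with \<open>ret\<close> are functionals on U(A). The coproduct
  of m_a has its legs in the image of \<open>M\<close>, where \<open>ret\<close> undoes
  \<open>M\<close>, so these functionals read off the coproduct of a.\<close>

lemma ret_teq:
  assumes "teq U (cop U (M a)) ys"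
  shows "teq A (\<Delta> a) (map (\<lambda>(X, Y). (ret X, ret Y)) ys)"
  unfolding teq_def tpair_eq_tsum
proof (intro conjI allI impI)
  fix f g assume fg: "lin_fun A f" "lin_fun A g"
  note u = ufun_ret[OF fg(1)] ufun_ret[OF fg(2)]
  have "tsum (\<lambda>x y. f x * g y) (\<Delta> a) = DU (\<lambda>X Y. f (ret X) * g (ret Y)) (M a)"
    by (simp add: DU_simps(5)[OF ubil_prod[OF u]] ret_simps)
  also have "\<dots> = tsum (\<lambda>x y. f x * g y) (map (\<lambda>(X, Y). (ret X, ret Y)) ys)"
    by (simp add: teq_UD[OF assms u] tsum_map)
  finally show "tsum (\<lambda>x y. f x * g y) (\<Delta> a) = tsum (\<lambda>x y. f x * g y) (map (\<lambda>(X, Y). (ret X, ret Y)) ys)" .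
qed (auto simp: carrier_UNIV)

section \<open>The filtration by degree in h and its convolution powers\<close>

primrec hdeg :: "('k, 'a) uexp \<Rightarrow> nat" where
  "hdeg (UM a) = 0"
| "hdeg (UH a) = 1"
| "hdeg UZero = 0"
| "hdeg UOne = 0"
| "hdeg (UAdd p q) = max (hdeg p) (hdeg q)"
| "hdeg (UMul p q) = hdeg p + hdeg q"
| "hdeg (UScal c p) = hdeg p"

text \<open>The filtration property of the coproduct. Degrees are attached to expressions only:
  \<open>ueq\<close> does not preserve them, as the relation for h of a bracket shows.\<close>

lemma ucop_hdeg: "(a, b) \<in> set (ucop A p) \<Longrightarrow> hdeg a + hdeg b \<le> hdeg p"
proof (induction p arbitrary: a b)
  case (UMul p q)
  then obtain a1 b1 a2 b2 where "(a1, b1) \<in> set (ucop A p)" "(a2, b2) \<in> set (ucop A q)"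
    "a = UMul a1 a2" "b = UMul b1 b2" by auto
  then show ?case using UMul.IH(1)[of a1 b1] UMul.IH(2)[of a2 b2] by simp
next
  case (UAdd p q)
  then show ?case by (auto simp: le_max_iff_disj)
qed auto

lemma subspace_range_M: "subspace U (range M)"
  unfolding subspace_def using M_zero M_add M_scale by (auto simp: image_iff) (metis+)

lemma hdeg_0_imp_range_M: "hdeg p = 0 \<Longrightarrow> cl p \<in> range M"
proof (induction p)
  case (UAdd p q)
  then show ?case using U.subspaceD(3)[OF subspace_range_M] by (simp add: cl_ops)
next
  case (UMul p q)
  then show ?case by (auto simp: cl_ops simp flip: M_mul)
next
  case (UScal c p)
  then show ?case using U.subspaceD(4)[OF subspace_range_M] by (simp add: cl_ops)
qed (auto simp: cl_ops simp flip: M_one M_zero)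

text \<open>Convolution powers in the dual of U(A); the counit is the unit for convolution, hence
  the zeroth power.\<close>

primrec cpow where
  "cpow f 0 X = cou U X"
| "cpow f (Suc n) X = DU (\<lambda>X Y. f X * cpow f n Y) X"

lemma ufun_cpow: "ufun f \<Longrightarrow> ufun (cpow f n)"
proof (induction n)
  case 0
  then show ?case using ufun_cou by (simp add: ufun_def)
next
  case (Suc n)
  then show ?case using ufun_DU[OF ubil_prod[OF Suc.prems Suc.IH[OF Suc.prems]]] by (simp add: ufun_def)
qed

text \<open>In the n-fold coproduct of an element of degree below n, each summand has a leg of
  degree 0. That leg lies in A, where f vanishes.\<close>

lemma cpow_vanishes:
  assumes "ufun f" "\<And>a. f (M a) = 0" "hdeg p < n"
  shows "cpow f n (cl p) = 0"
  using assms(3)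
proof (induction n arbitrary: p)
  case (Suc n)
  have "cpow f (Suc n) (cl p) = tsum (\<lambda>a b. f (cl a) * cpow f n (cl b)) (ucop A p)"
    using DU_cl[OF ubil_prod[OF assms(1) ufun_cpow[OF assms(1)]]] by (simp add: usum_def)
  also have "\<dots> = tsum (\<lambda>a b. 0) (ucop A p)"
  proof (rule tsum_cong)
    fix a b assume "(a, b) \<in> set (ucop A p)"
    \<comment> \<open>If the first leg has positive degree, the second has degree below n and the
      induction hypothesis applies.\<close>
    then have "hdeg a = 0 \<or> hdeg b < n" using ucop_hdeg Suc.prems by fastforce
    then show "f (cl a) * cpow f n (cl b) = 0"
    proof
      assume "hdeg a = 0"
      then obtain x where "cl a = M x" using hdeg_0_imp_range_M by blast
      then show ?thesis using assms(2) by simp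
    qed (simp add: Suc.IH)
  qed
  finally show ?case by simp
qed simp

lemma separating_ufun:
  assumes "subspace U W" "X \<in> vcar U" "X \<notin> W"
  obtains f where "ufun f" "\<And>w. w \<in> W \<Longrightarrow> f w = 0" "f X = 1"
proof -
  obtain f where f: "lin_fun U f" "\<And>w. w \<in> W \<Longrightarrow> f w = 0" "f X = 1"
    using U.separating_functional[OF assms] by blast
  show ?thesis
  proof
    show "ufun (\<lambda>X. f (cl (urep X)))" by (rule lin_fun_imp_ufun[OF f(1)])
    show "f (cl (urep w)) = 0" if "w \<in> W" for w
      using that f(2) U.subspaceD(1)[OF assms(1)] by (simp add: cl_urep_carrier subset_iff)
  qed (simp add: assms cl_urep_carrier f)
qed

text \<open>If the counit vanished on D, then y = sum eps(y1) y2 with legs in D would be 0 for every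
  y in D. Scaling normalises a nonzero value to 1.\<close>

lemma subcoalg_cou_nonzero:
  assumes D: "subcoalg U D" "D \<noteq> {vzero U}"
  obtains x where "x \<in> D" "cou U x = 1"
proof -
  have sub: "subspace U D" using D by (simp add: subcoalg_def)
  obtain y where y: "y \<in> D" "y \<noteq> vzero U" using D U.subspaceD(2)[OF sub] by blast
  have yU: "y \<in> vcar U" using y U.subspaceD(1)[OF sub] by blast
  have "\<exists>x\<in>D. cou U x \<noteq> 0"
  proof (rule ccontr)
    assume "\<not> (\<exists>x\<in>D. cou U x \<noteq> 0)"
    then have z: "cou U x = 0" if "x \<in> D" for x using that by blast
    obtain ys where ys: "set ys \<subseteq> D \<times> D" "teq U (cop U y) ys"
      using D(1) y(1) unfolding subcoalg_def by blast
    have "y = vzero U"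
    proof (rule U_eqI[OF yU])
      fix f assume f: "ufun f"
      have "f y = tsum (\<lambda>X Y. cou U X * f Y) ys"
        using DU_counit(1)[OF yU f] teq_UD[OF ys(2) ufun_cou f] by simp
      also have "\<dots> = tsum (\<lambda>X Y. 0) ys" using ys(1) z by (intro tsum_cong) auto
      finally show "f y = f (vzero U)" using ufun_zero[OF f] by simp
    qed simp
    then show False using y by simp
  qed
  then obtain x where x: "x \<in> D" "cou U x \<noteq> 0" by blast
  show ?thesis
    by (rule that[of "inverse (cou U x) *\<^sub>U x"]) (use x U.subspaceD(4)[OF sub] in \<open>simp_all add: cou_U\<close>)
qed

lemma subcoalg_meets_range_M:
  assumes D: "subcoalg U D" "D \<noteq> {vzero U}"
  shows "\<exists>x\<in>D \<inter> range M. x \<noteq> vzero U"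
proof (rule ccontr)
  assume "\<not> ?thesis"
  then have triv: "x = vzero U" if "x \<in> D" "x \<in> range M" for x using that by blast
  have sub: "subspace U D" using D by (simp add: subcoalg_def)
  note subD = U.subspaceD[OF sub] and subM = U.subspaceD[OF subspace_range_M]
  have DU: "x \<in> D \<Longrightarrow> x \<in> vcar U" for x using subD(1) by blast
  obtain x where x: "x \<in> D" "cou U x = 1" using subcoalg_cou_nonzero[OF D] by blast
  \<comment> \<open>A functional that kills W vanishes on A and on the kernel of the counit in D.
    Normalised at x, it then agrees with the counit on all of D.\<close>
  define W where "W = {m \<oplus> k | m k. m \<in> range M \<and> k \<in> D \<and> cou U k = 0}"
  have W: "subspace U W"
    unfolding subspace_def
  proof (intro conjI ballI allI)
    show "vzero U \<in> W" unfolding W_def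
      by (intro CollectI exI[of _ "vzero U"]) (use subD(2) subM(2) ufun_zero[OF ufun_cou] in simp)
    show "X \<oplus> Y \<in> W" if XY: "X \<in> W" "Y \<in> W" for X Y
    proof -
      obtain m k m' k' where mk: "X = m \<oplus> k" "m \<in> range M" "k \<in> D" "cou U k = 0"
        "Y = m' \<oplus> k'" "m' \<in> range M" "k' \<in> D" "cou U k' = 0" using XY by (auto simp: W_def)
      have "X \<oplus> Y = (m \<oplus> m') \<oplus> (k \<oplus> k')" by (simp add: mk U_add_ac)
      moreover have "m \<oplus> m' \<in> range M" "k \<oplus> k' \<in> D" "cou U (k \<oplus> k') = 0"
        using mk subM(3) subD(3) by (auto simp: cou_U)
      ultimately show ?thesis unfolding W_def by blast
    qed
    show "c *\<^sub>U X \<in> W" if XW: "X \<in> W" for c X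
    proof -
      obtain m k where mk: "X = m \<oplus> k" "m \<in> range M" "k \<in> D" "cou U k = 0" using XW by (auto simp: W_def)
      have "c *\<^sub>U X = c *\<^sub>U m \<oplus> c *\<^sub>U k" by (simp add: mk U_scale_add)
      moreover have "c *\<^sub>U m \<in> range M" "c *\<^sub>U k \<in> D" "cou U (c *\<^sub>U k) = 0"
        using mk subM(4) subD(4) by (auto simp: cou_U)
      ultimately show ?thesis unfolding W_def by blast
    qed
  qed (auto simp: W_def)
  \<comment> \<open>If x = m + k, then m = x - k lies both in D and in A, hence is 0. This leaves x
    = k, although eps(x) = 1 and eps(k) = 0.\<close>
  have "x \<notin> W"
  proof
    assume "x \<in> W"
    then obtain m k where mk: "x = m \<oplus> k" "m \<in> range M" "k \<in> D" "cou U k = 0" by (auto simp: W_def)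
    have mU: "m \<in> vcar U" using mk(2) by auto
    have "x \<oplus> (-1) *\<^sub>U k = m" using mU by (simp add: mk(1) U_add_assoc U_add_inverse)
    then have "m \<in> D" using x(1) mk(3) subD by metis
    then have "m = vzero U" using triv mk(2) by blast
    then have "x = k" using mk(1,3) DU by simp
    then show False using x mk by simp
  qed
  then obtain f where f: "ufun f" "\<And>w. w \<in> W \<Longrightarrow> f w = 0" "f x = 1"
    using separating_ufun[OF W DU[OF x(1)]] by blast
  have fM: "f (M a) = 0" for a
  proof (rule f(2))
    have "M a = M a \<oplus> vzero U" by simp
    then show "M a \<in> W" unfolding W_def using subD(2) ufun_zero[OF ufun_cou] by blast
  qed
  have fD: "f y = cou U y" if y: "y \<in> D" for y
  proof -
    let ?k = "y \<oplus> (- cou U y) *\<^sub>U x"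
    have "?k \<in> D" using y x(1) subD by blast
    moreover have "cou U ?k = 0" using x(2) by (simp add: cou_U)
    moreover have "?k = vzero U \<oplus> ?k" by simp
    ultimately have "?k \<in> W" unfolding W_def using subM(2) by blast
    then have "f ?k = 0" by (rule f(2))
    then show ?thesis using f(3) by (simp add: ufunD[OF f(1)])
  qed
  \<comment> \<open>The agreement with the counit passes to every power because the counit is
    idempotent under convolution and D is closed under Delta.\<close>
  have cpow_D: "cpow f n y = cou U y" if "y \<in> D" for n y
    using that
  proof (induction n arbitrary: y)
    case (Suc n)
    obtain ys where ys: "set ys \<subseteq> D \<times> D" "teq U (cop U y) ys"
      using D(1) Suc.prems unfolding subcoalg_def by blast
    have "cpow f (Suc n) y = tsum (\<lambda>X Y. f X * cpow f n Y) ys"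
      using teq_UD[OF ys(2) f(1) ufun_cpow[OF f(1)]] by simp
    also have "\<dots> = tsum (\<lambda>X Y. cou U X * cou U Y) ys"
      using ys(1) fD Suc.IH by (intro tsum_cong) auto
    also have "\<dots> = cou U y"
      using teq_UD[OF ys(2) ufun_cou ufun_cou] DU_counit(1)[OF DU[OF Suc.prems] ufun_cou] by simp
    finally show ?case .
  qed simp
  obtain p where "x = cl p" using DU[OF x(1)] by (auto simp: U_simps(1))
  \<comment> \<open>One more than the degree bound of a representative is enough for the power to
    vanish at x, where it should equal 1.\<close>
  then have "cpow f (Suc (hdeg p)) x = 0" using cpow_vanishes[OF f(1) fM] by (simp del: cpow.simps)
  then show False using cpow_D[OF x(1)] x(2) by (metis zero_neq_one)
qed

section \<open>Descent of subcoalgebras and group-likes to A\<close>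

lemma subcoalg_M_image:
  assumes "subcoalg A E"
  shows "subcoalg U (M ` E)"
proof -
  have E: "vzero A \<in> E" "\<And>x y. x \<in> E \<Longrightarrow> y \<in> E \<Longrightarrow> x \<boxplus> y \<in> E" "\<And>c x. x \<in> E \<Longrightarrow> c \<cdot> x \<in> E"
    using assms by (auto simp: subcoalg_def subspace_def)
  have "subspace U (M ` E)"
    unfolding subspace_def using E by (auto simp flip: M_zero M_add M_scale)
  moreover have "\<exists>ys. set ys \<subseteq> M ` E \<times> M ` E \<and> teq U (cop U (M a)) ys" if a: "a \<in> E" for a
  proof -
    obtain ys where "set ys \<subseteq> E \<times> E" "teq A (\<Delta> a) ys" using assms a unfolding subcoalg_def by blast
    then show ?thesis using M_teq[of a ys] by (intro exI[of _ "map (\<lambda>(x, y). (M x, M y)) ys"]) auto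
  qed
  ultimately show ?thesis by (auto simp: subcoalg_def)
qed

lemma subcoalg_range_M: "subcoalg U (range M)"
proof (rule subcoalg_M_image)
  have "teq A (\<Delta> x) (\<Delta> x)" for x by (simp add: teq_def carrier_UNIV)
  then show "subcoalg A UNIV" by (auto simp: subcoalg_def subspace_def carrier_UNIV)
qed

text \<open>The coproduct of x has one representation with legs in D and another with legs in E;
  \<open>teq_inter\<close> provides one with legs in both.\<close>

lemma subcoalg_inter:
  assumes "subcoalg U D" "subcoalg U E"
  shows "subcoalg U (D \<inter> E)"
proof -
  have sub: "subspace U D" "subspace U E" using assms by (auto simp: subcoalg_def)
  then have "subspace U (D \<inter> E)" by (auto simp: subspace_def)
  moreover have "\<exists>ws. set ws \<subseteq> (D \<inter> E) \<times> (D \<inter> E) \<and> teq U (cop U x) ws" if x: "x \<in> D \<inter> E" for x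
  proof -
    obtain ys zs where ys: "set ys \<subseteq> D \<times> D" "teq U (cop U x) ys" and zs: "set zs \<subseteq> E \<times> E" "teq U (cop U x) zs"
      using assms x unfolding subcoalg_def by blast
    have "teq U ys zs" using ys(2) zs(2) by (simp add: teq_def)
    from U.teq_inter[OF this sub ys(1) zs(1)] show ?thesis
      using ys(2) by (auto simp: teq_def)
  qed
  ultimately show ?thesis by (simp add: subcoalg_def)
qed

lemma simple_subcoalg_subset_range_M:
  assumes "simple_subcoalg U D"
  shows "D \<subseteq> range M"
proof -
  have D: "subcoalg U D" "D \<noteq> {vzero U}" using assms by (auto simp: simple_subcoalg_def)
  have "D \<inter> range M \<noteq> {vzero U}" using subcoalg_meets_range_M[OF D] by blast
  moreover have "subcoalg U (D \<inter> range M)" by (rule subcoalg_inter[OF D(1) subcoalg_range_M])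
  ultimately have "D \<inter> range M = D" using assms unfolding simple_subcoalg_def by blast
  then show ?thesis by blast
qed

text \<open>D lies in the image of A, where \<open>ret\<close> inverts \<open>M\<close>. A smaller
  subcoalgebra of the preimage would have a smaller image in D, so simplicity is inherited.\<close>

lemma simple_subcoalg_M_vimage:
  assumes D: "simple_subcoalg U D"
  shows "simple_subcoalg A (M -` D)"
proof -
  have DM: "D \<subseteq> range M" by (rule simple_subcoalg_subset_range_M[OF D])
  then have img: "M ` (M -` D) = D" by blast
  have sub: "subspace U D" and co: "subcoalg U D" and ne: "D \<noteq> {vzero U}"
    using D by (auto simp: simple_subcoalg_def subcoalg_def)
  note subD = U.subspaceD[OF sub]
  have "subspace A (M -` D)"
    unfolding subspace_def using subD by (auto simp: carrier_UNIV M_zero M_add M_scale)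
  moreover have "\<exists>ys. set ys \<subseteq> (M -` D) \<times> (M -` D) \<and> teq A (\<Delta> a) ys" if a: "a \<in> M -` D" for a
  proof -
    obtain ys where ys: "set ys \<subseteq> D \<times> D" "teq U (cop U (M a)) ys"
      using co a unfolding subcoalg_def by blast
    have "M (ret X) = X" if "X \<in> D" for X using that DM by (auto simp: ret_simps)
    then have "set (map (\<lambda>(X, Y). (ret X, ret Y)) ys) \<subseteq> (M -` D) \<times> (M -` D)" using ys(1) by fastforce
    then show ?thesis using ret_teq[OF ys(2)] by blast
  qed
  moreover have "M -` D \<noteq> {vzero A}"
  proof
    assume "M -` D = {vzero A}"
    then have "M ` (M -` D) = {vzero U}" by (simp add: M_zero)
    then show False using ne img by simp
  qed
  moreover have "E = {vzero A} \<or> E = M -` D" if "subcoalg A E" "E \<subseteq> M -` D" for E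
  proof -
    have "M ` E = {vzero U} \<or> M ` E = D"
      using D subcoalg_M_image[OF that(1)] that(2) unfolding simple_subcoalg_def by blast
    then show ?thesis
    proof
      assume "M ` E = {vzero U}"
      then have "M ` E = M ` {vzero A}" by (simp add: M_zero)
      then show ?thesis using inj_image_eq_iff[OF inj_M, of E "{vzero A}"] by simp
    next
      assume "M ` E = D"
      then show ?thesis using inj_vimage_image_eq[OF inj_M, of E] by simp
    qed
  qed
  ultimately show ?thesis by (auto simp: simple_subcoalg_def subcoalg_def)
qed

lemma subcoalg_line:
  assumes g: "g \<in> vcar U" "teq U (cop U g) [(g, g)]"
  shows "subcoalg U (range (\<lambda>c. c *\<^sub>U g))"
proof -
  have "vzero U \<in> range (\<lambda>c. c *\<^sub>U g)" by (rule range_eqI[of _ _ 0]) (simp add: U.scale_zero[OF g(1)])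
  then have sub: "subspace U (range (\<lambda>c. c *\<^sub>U g))"
    unfolding subspace_def by (auto simp: U_scale_scale simp flip: U_scale_plus)
  have "teq U (cop U (c *\<^sub>U g)) [(c *\<^sub>U g, g)]" for c
    using teq_UD[OF g(2)] g(1) by (intro teq_UI[OF cop_U_closed]) (auto simp: DU_simps ubil_prod ufunD)
  moreover have "g \<in> range (\<lambda>c. c *\<^sub>U g)" using g(1) by (auto intro!: image_eqI[of _ _ 1])
  ultimately have "\<exists>ys. set ys \<subseteq> range (\<lambda>c. c *\<^sub>U g) \<times> range (\<lambda>c. c *\<^sub>U g) \<and> teq U (cop U (c *\<^sub>U g)) ys" for c
    by (intro exI[of _ "[(c *\<^sub>U g, g)]"]) auto
  then show ?thesis unfolding subcoalg_def using sub by blast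
qed

text \<open>The line through a group-like g is a nonzero subcoalgebra, so it meets the image of A
  outside 0 and g itself lies in that image. Then \<open>ret\<close> transports group-likeness to
  A.\<close>

lemma grouplikes_U: "grouplikes U = M ` grouplikes A"
proof (intro equalityI subsetI)
  fix g assume "g \<in> grouplikes U"
  then have g: "g \<in> vcar U" "g \<noteq> vzero U" "teq U (cop U g) [(g, g)]" by (auto simp: grouplikes_def)
  have "g \<in> range (\<lambda>c. c *\<^sub>U g)" using g(1) by (auto intro!: image_eqI[of _ _ 1])
  then have "range (\<lambda>c. c *\<^sub>U g) \<noteq> {vzero U}" using g(2) by blast
  from subcoalg_meets_range_M[OF subcoalg_line[OF g(1,3)] this]
  obtain X where X: "X \<in> range (\<lambda>c. c *\<^sub>U g)" "X \<in> range M" "X \<noteq> vzero U" by blast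
  then obtain c a where ca: "c *\<^sub>U g = M a" "c *\<^sub>U g \<noteq> vzero U" by (metis rangeE)
  have "c \<noteq> 0" using ca(2) U.scale_zero[OF g(1)] by metis
  then have "g = M (inverse c \<cdot> a)" using g(1) by (simp add: M_scale U_scale_scale flip: ca(1))
  then obtain b where b: "g = M b" by blast
  have "teq A (\<Delta> b) [(b, b)]" using ret_teq[of b "[(g, g)]"] g(3) by (simp add: b ret_simps)
  moreover have "b \<noteq> vzero A" using g(2) b M_zero by auto
  ultimately show "g \<in> M ` grouplikes A" using b by (auto simp: grouplikes_def carrier_UNIV)
next
  fix g assume "g \<in> M ` grouplikes A"
  then obtain b where b: "g = M b" "b \<noteq> vzero A" "teq A (\<Delta> b) [(b, b)]" by (auto simp: grouplikes_def)
  have "g \<noteq> vzero U" using b(1,2) inj_M by (auto simp: inj_eq simp flip: M_zero)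
  then show "g \<in> grouplikes U" using b(1) M_teq[OF b(3)] by (simp add: grouplikes_def)
qed

text \<open>Each simple subcoalgebra of U(A) comes from one of A, whose elements are multiples of 1
  by hypothesis; this bounds the coradical. Conversely, the line through 1 is a simple
  subcoalgebra.\<close>

lemma connected_U:
  assumes "connected A"
  shows "connected U"
proof -
  let ?L = "range (\<lambda>c. c *\<^sub>U \<one>)"
  have one: "teq U (cop U \<one>) [(\<one>, \<one>)]" using bialg_U by (simp add: is_bialg_def)
  have L: "subcoalg U ?L" by (rule subcoalg_line[OF _ one]) simp
  have one0: "\<one> \<noteq> vzero U" using cou_U(4) ufun_zero[OF ufun_cou] by auto
  have oneL: "\<one> \<in> ?L" by (auto intro!: image_eqI[of _ _ 1])
  have simpleL: "simple_subcoalg U ?L"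
    unfolding simple_subcoalg_def
  proof (intro conjI allI impI L)
    show "?L \<noteq> {vzero U}" using oneL one0 by blast
    fix E assume E: "subcoalg U E \<and> E \<subseteq> ?L"
    then have subE: "subspace U E" by (simp add: subcoalg_def)
    show "E = {vzero U} \<or> E = ?L"
    proof (cases "E = {vzero U}")
      case False
      then obtain c where c: "c *\<^sub>U \<one> \<in> E" "c *\<^sub>U \<one> \<noteq> vzero U" using E U.subspaceD(2)[OF subE] by blast
      then have "c \<noteq> 0" by auto
      have "d *\<^sub>U \<one> \<in> E" for d
        using U.subspaceD(4)[OF subE c(1), of "d / c"] \<open>c \<noteq> 0\<close> by (simp add: U_scale_scale)
      then show ?thesis using E by blast
    qed simp
  qed
  have subset: "D \<subseteq> ?L" if D: "simple_subcoalg U D" for D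
  proof
    fix X assume X: "X \<in> D"
    then obtain a where a: "X = M a" using simple_subcoalg_subset_range_M[OF D] by blast
    \<comment> \<open>The factor 1 puts a into the shape of \<open>scale_mem_vspan\<close>.\<close>
    have "1 \<cdot> a \<in> coradical A"
      unfolding coradical_def using simple_subcoalg_M_vimage[OF D] X a
      by (intro A.scale_mem_vspan) (auto simp: carrier_UNIV)
    then obtain c where "a = c \<cdot> vone A" using assms by (auto simp: connected_def carrier_UNIV)
    then show "X \<in> ?L" by (simp add: a M_scale M_one)
  qed
  have "coradical U \<subseteq> ?L"
  proof
    fix X assume "X \<in> coradical U"
    then obtain l where l: "X = lincomb U l" "set (map snd l) \<subseteq> \<Union> {D. simple_subcoalg U D}"
      by (auto simp: coradical_def vspan_def)
    have subL: "subspace U ?L" using L by (simp add: subcoalg_def)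
    have "\<Union> {D. simple_subcoalg U D} \<subseteq> ?L" using subset by blast
    then have "set (map snd l) \<subseteq> ?L" using l(2) by (rule order_trans[rotated])
    then have "v \<in> ?L" if "(c, v) \<in> set l" for c v
    proof -
      have "v \<in> set (map snd l)" using that by force
      then show ?thesis using \<open>set (map snd l) \<subseteq> ?L\<close> by (rule rev_subsetD)
    qed
    then have "set (map (\<lambda>(c, v). c *\<^sub>U v) l) \<subseteq> ?L" using U.subspaceD(4)[OF subL] by auto
    then show "X \<in> ?L" unfolding l(1) lincomb_def by (rule U.vsum_subspace[OF subL])
  qed
  moreover have "?L \<subseteq> coradical U"
  proof -
    have "\<one> \<in> \<Union> {D. simple_subcoalg U D}" using simpleL oneL by (intro UnionI CollectI)
    then show ?thesis unfolding coradical_def by (intro image_subsetI U.scale_mem_vspan) simp_all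
  qed
  ultimately show ?thesis unfolding connected_def by (rule equalityI)
qed

end

theorem theorem2p3:
  fixes A :: "('k::field, 'a) kbialg" and br :: "'a \<Rightarrow> 'a \<Rightarrow> 'a"
  assumes "poisson_hopf A br" and "vcar A = UNIV"
  shows "(pointed A \<longrightarrow>
            is_hopf (U_of A br) \<and>
            inj (mU A br) \<and>
            (\<exists>S. antipode (U_of A br) S \<and> (\<forall>a. S (mU A br a) \<in> range (mU A br))) \<and>
            grouplikes (U_of A br) = mU A br ` grouplikes A)
       \<and> (connected A \<longrightarrow> is_hopf (U_of A br) \<and> connected (U_of A br))"
proof -
  obtain S where S: "antipode A S" using assms(1) by (auto simp: poisson_hopf_def is_hopf_def)
  interpret poisson_hopf_algebra A br S
    by unfold_locales (fact assms S)+
  \<comment> \<open>The antipode sends m_a to m of S a, so it restricts to the image of A.\<close>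
  have "SU (M a) \<in> range M" for a by (simp add: SU_simps MS_def)
  then show ?thesis
    using hopf_U inj_M antipode_SU grouplikes_U connected_U by blast
qed

end
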